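(* Assume the censored parametric regression model described in the context, with true parameter $\vartheta_0\in\Theta$, and let $\hat\vartheta_n$ be a maximizer of $\ell_n$ over $\Theta$. Suppose that (i) $\ell_1(\vartheta)$ has continuous second derivatives with respect to $\vartheta$, and there exists an open neighborhood $V\subseteq\Theta$ of $\vartheta_0$ such that $\mathbb{E}\big[\sup_{\vartheta\in V}|D_{r,s}\ell_1(\vartheta\mid X,Z,\delta)|\big]<\infty$ for all $1\le r,s\le q$; (ii) for $H$-a.e. $x$, $\int\sup_{\vartheta\in V}|D_rf(y\mid\vartheta,x)|\,\nu(dy)<\infty$ for all $1\le r\le q$, with $V$ from (i); (iii) for all $1\le r,s\le q$, $$\int\int\Big[\Big[\int_{-\infty}^cD_{r,s}f(y\mid\vartheta_0,x)\,\nu(dy)\Big]-D_{r,s}F(c\mid\vartheta_0,x)\Big]G(dc\mid x)\,H(dx)=0;$$ (iv) the matrix $$\Sigma=\mathbb{E}\big[\bar G(Y-\mid X)\,D(\tilde\ell_1(\vartheta_0))\,D(\tilde\ell_1(\vartheta_0))^T\big]+\mathbb{E}\Big[\big(\bar F(C\mid\vartheta_0,X)\big)^{-1}\,\mathbb{E}\big[1_{\{Y\le C\}}D(\tilde\ell_1(\vartheta_0))\mid X,C\big]\,\mathbb{E}\big[1_{\{Y\le C\}}D(\tilde\ell_1(\vartheta_0))^T\mid X,C\big]\Big]$$ exists and is positive definite; (v) $\hat\vartheta_n$ converges in probability to $\vartheta_0$. Then $\sqrt n(\hat\vartheta_n-\vartheta_0)$ converges in distribution to $\mathcal{N}_q(0,\Sigma^{-1})$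 as $n\to\infty$.
   Context: Setting. Let $\nu$ be a $\sigma$-finite measure on $[0,\infty)$, $\Theta\subseteq\mathbb{R}^q$, and let $\mathcal{F}=\{f(\cdot\mid\vartheta,\cdot):\vartheta\in\Theta\}$ be a parametric family of conditional densities with respect to $\nu$: $f:\mathbb{R}^p\times[0,\infty)\ni(x,y)\mapsto f(y\mid\vartheta,x)\in(0,\infty)$, with $\int f(y\mid\vartheta,x)\,\nu(dy)=1$. Let $F(c\mid\vartheta,x)=\int_{-\infty}^c f(y\mid\vartheta,x)\,\nu(dy)$ be the corresponding conditional distribution function (the integral $\int_{-\infty}^c$ is over $y\le c$). $X$ is a random vector in $\mathbb{R}^p$ with distribution function $H$; $Y\ge 0$ and $C\ge 0$ are random variables, conditionally independent given $X$; the conditional distribution of $Y$ given $X=x$ has density $f(\cdot\mid\vartheta_0,x)$ with respect to $\nu$, where $\vartheta_0\in\Theta$ is the true parameter; $G(\cdot\mid x)$ is the conditional distribution function of $C$ given $X=x$, and $G(y-\mid x)$ denotes its left limit at $y$. Put $Z=\min(Y,C)$, $\delta=1_{\{Y\le C\}}$. One observes i.i.d. copies $(X_i,Z_i,\delta_i)$ of $(X,Z,\delta)$ (with underlying $Y_i,C_i$). Log-likelihood: $$\ell_n(\vartheta)=\sum_{i=1}^n \Big[\delta_i\log f(Z_i\mid\vartheta,X_i)+(1-\delta_i)\log\big(1-F(Z_i\mid\vartheta,X_i)\big)\Big],$$ where $(1-\delta_i)\log(1-F(Z_i\mid\vartheta,X_i))$ is defined to be $0$ if $F(Z_i\mid\vartheta,X_i)=1$.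 $\ell_1(\vartheta)=\ell_1(\vartheta\mid X,Z,\delta)$ is the log-likelihood of a single observation. $\tilde\ell_n(\vartheta_0)=\sum_{i=1}^n\log f(Y_i\mid\vartheta_0,X_i)$ is the log-likelihood without censoring, so $D(\tilde\ell_1(\vartheta_0))$ is the gradient of $\vartheta\mapsto\log f(Y\mid\vartheta,X)$ at $\vartheta_0$. Notation. For a distribution function, a bar denotes the tail function: $\bar F=1-F$, $\bar G(y-\mid x)=1-G(y-\mid x)$. $D_r=\partial/\partial\vartheta_r$, $D_{r,s}=\partial^2/\partial\vartheta_r\partial\vartheta_s$, $D(\cdot)=(D_1(\cdot),\dots,D_q(\cdot))^T$. The integrand of the second expectation in $\Sigma$ is defined to be zero when $F(C\mid\vartheta_0,X)=1$. *)

theory Defs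
  imports "HOL-Probability.Probability"
begin

text \<open>Calculus in the parameter. If a partial derivative does not exist, \<open>partial_deriv\<close> has an
  unspecified value; existence is therefore always stated separately where it is meant.\<close>

definition partial_differentiable :: "'q::finite \<Rightarrow> (real^'q \<Rightarrow> real) \<Rightarrow> real^'q \<Rightarrow> bool" where
  "partial_differentiable r g \<theta> \<longleftrightarrow>
     (\<lambda>t. g (\<theta> + t *\<^sub>R axis r 1)) field_differentiable at 0"

definition partial_deriv :: "'q::finite \<Rightarrow> (real^'q \<Rightarrow> real) \<Rightarrow> real^'q \<Rightarrow> real" where
  "partial_deriv r g \<theta> = deriv (\<lambda>t. g (\<theta> + t *\<^sub>R axis r 1)) 0"

abbreviation partial_deriv2 :: "'q::finite \<Rightarrow> 'q \<Rightarrow> (real^'q \<Rightarrow> real) \<Rightarrow> real^'q \<Rightarrow> real" where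
  "partial_deriv2 r s g \<equiv> partial_deriv r (partial_deriv s g)"

definition gradient :: "(real^'q::finite \<Rightarrow> real) \<Rightarrow> real^'q \<Rightarrow> real^'q" where
  "gradient g \<theta> = (\<chi> r. partial_deriv r g \<theta>)"

text \<open>Meant for open sets only.\<close>

definition has_continuous_second_derivatives_on ::
    "(real^'q::finite \<Rightarrow> real) \<Rightarrow> (real^'q) set \<Rightarrow> bool" where
  "has_continuous_second_derivatives_on g V \<longleftrightarrow>
     (\<forall>r s. (\<forall>\<theta>\<in>V. partial_differentiable s g \<theta> \<and> partial_differentiable r (partial_deriv s g) \<theta>)
        \<and> continuous_on V (partial_deriv2 r s g))"

definition positive_definite :: "real^'q^'q::finite \<Rightarrow> bool" where
  "positive_definite A \<longleftrightarrow> transpose A = A \<and> (\<forall>v. v \<noteq> 0 \<longrightarrow> v \<bullet> (A *v v) > 0)"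

definition sigma_generated :: "'a measure \<Rightarrow> ('a \<Rightarrow> 'b::topological_space) \<Rightarrow> 'a measure" where
  "sigma_generated M X = vimage_algebra (space M) X borel"

definition cond_exp_given ::
    "'a measure \<Rightarrow> ('a \<Rightarrow> 'b::topological_space) \<Rightarrow> ('a \<Rightarrow> real) \<Rightarrow> 'a \<Rightarrow> real" where
  "cond_exp_given M X U = real_cond_exp M (sigma_generated M X) U"

definition cond_independent ::
    "'a measure \<Rightarrow> ('a \<Rightarrow> 'b::topological_space) \<Rightarrow> ('a \<Rightarrow> real) \<Rightarrow> ('a \<Rightarrow> real) \<Rightarrow> bool" where
  "cond_independent M X Y C \<longleftrightarrow>
     (\<forall>A\<in>sets borel. \<forall>B\<in>sets borel. AE \<omega> in M.
        cond_exp_given M X (\<lambda>\<omega>. indicat_real A (Y \<omega>) * indicat_real B (C \<omega>)) \<omega> =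
        cond_exp_given M X (\<lambda>\<omega>. indicat_real A (Y \<omega>)) \<omega> *
        cond_exp_given M X (\<lambda>\<omega>. indicat_real B (C \<omega>)) \<omega>)"

text \<open>The kernel \<open>x \<mapsto> k x\<close> of densities with respect to \<open>\<nu>\<close> is a version of the conditional
  law of \<open>Y\<close> given \<open>X\<close>.\<close>

definition has_cond_density ::
    "'a measure \<Rightarrow> ('a \<Rightarrow> 'b::topological_space) \<Rightarrow> ('a \<Rightarrow> real) \<Rightarrow> real measure \<Rightarrow>
     ('b \<Rightarrow> real \<Rightarrow> real) \<Rightarrow> bool" where
  "has_cond_density M X Y \<nu> k \<longleftrightarrow>
     (\<forall>A\<in>sets borel. AE \<omega> in M.
        cond_exp_given M X (\<lambda>\<omega>. indicat_real A (Y \<omega>)) \<omega> = (LINT y:A|\<nu>. k (X \<omega>) y))"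

text \<open>A conditional distribution function \<open>G(c|x)\<close> is represented by the probability kernel
  \<open>G\<close> with \<open>G(c|x) = cdf (G x) c\<close>; integration against \<open>G(dc|x)\<close> is integration
  with respect to the measure \<open>G x\<close>.\<close>

definition has_cond_cdf ::
    "'a measure \<Rightarrow> ('a \<Rightarrow> 'b::topological_space) \<Rightarrow> ('a \<Rightarrow> real) \<Rightarrow> ('b \<Rightarrow> real measure) \<Rightarrow> bool" where
  "has_cond_cdf M X C G \<longleftrightarrow>
     G \<in> measurable borel (prob_algebra borel) \<and>
     (\<forall>c. AE \<omega> in M.
        cond_exp_given M X (\<lambda>\<omega>. indicat_real {..c} (C \<omega>)) \<omega> = cdf (G (X \<omega>)) c)"

definition cdf_left :: "real measure \<Rightarrow> real \<Rightarrow> real" where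
  "cdf_left N y = Lim (at_left y) (cdf N)"

definition converges_in_probability ::
    "'a measure \<Rightarrow> (nat \<Rightarrow> 'a \<Rightarrow> 'b::metric_space) \<Rightarrow> 'b \<Rightarrow> bool" where
  "converges_in_probability M T b \<longleftrightarrow>
     (\<forall>\<epsilon>>0. (\<lambda>n. measure M {\<omega> \<in> space M. dist (T n \<omega>) b > \<epsilon>}) \<longlonglongrightarrow> 0)"

text \<open>For random elements \<open>T n\<close> that are Borel measurable.\<close>

definition converges_in_distribution ::
    "'a measure \<Rightarrow> (nat \<Rightarrow> 'a \<Rightarrow> 'b::topological_space) \<Rightarrow> 'b measure \<Rightarrow> bool" where
  "converges_in_distribution M T N \<longleftrightarrow>
     (\<forall>h :: 'b \<Rightarrow> real. continuous_on UNIV h \<and> bounded (range h) \<longrightarrow>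
        (\<lambda>n. \<integral>\<omega>. h (T n \<omega>) \<partial>M) \<longlonglongrightarrow> (\<integral>x. h x \<partial>N))"

text \<open>Multivariate normal law with mean \<open>\<mu>\<close> and positive definite covariance matrix \<open>S\<close>.\<close>

definition multivariate_normal :: "real^'q::finite \<Rightarrow> real^'q^'q \<Rightarrow> (real^'q) measure" where
  "multivariate_normal \<mu> S = density lborel
     (\<lambda>x. ennreal (exp (- ((x - \<mu>) \<bullet> (matrix_inv S *v (x - \<mu>))) / 2)
                   / sqrt ((2 * pi) ^ CARD('q) * det S)))"

text \<open>The parametric family: \<open>f \<theta> x y\<close> stands for \<open>f(y|\<theta>,x)\<close>. Since \<open>\<nu>\<close> lives on
  \<open>[0,\<infinity>)\<close>, the values for negative \<open>y\<close> are irrelevant, and measurability is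
  required for an extension to all real \<open>y\<close>.\<close>

definition conditional_density_family ::
    "real measure \<Rightarrow> (real^'q::finite) set \<Rightarrow> (real^'q \<Rightarrow> real^'p::finite \<Rightarrow> real \<Rightarrow> real) \<Rightarrow> bool" where
  "conditional_density_family \<nu> \<Theta> f \<longleftrightarrow>
     sigma_finite_measure \<nu> \<and> sets \<nu> = sets borel \<and> emeasure \<nu> {..<0} = 0 \<and>
     (\<forall>\<theta>\<in>\<Theta>.
        (\<lambda>(x, y). f \<theta> x y) \<in> borel_measurable borel \<and>
        (\<forall>x. \<forall>y\<ge>0. f \<theta> x y > 0) \<and>
        (\<forall>x. (\<integral>y. f \<theta> x y \<partial>\<nu>) = 1))"

definition cond_df ::
    "real measure \<Rightarrow> (real^'q \<Rightarrow> real^'p \<Rightarrow> real \<Rightarrow> real) \<Rightarrow> real^'q::finite \<Rightarrow> real^'p::finite \<Rightarrow> real \<Rightarrow> real"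
  where "cond_df \<nu> f \<theta> x c = (LINT y:{..c}|\<nu>. f \<theta> x y)"

definition loglik1 ::
    "real measure \<Rightarrow> (real^'q \<Rightarrow> real^'p \<Rightarrow> real \<Rightarrow> real) \<Rightarrow> (real^'p::finite) \<times> real \<times> real \<Rightarrow>
     real^'q::finite \<Rightarrow> real" where
  "loglik1 \<nu> f = (\<lambda>(x, z, d) \<theta>.
     d * ln (f \<theta> x z) +
     (if cond_df \<nu> f \<theta> x z = 1 then 0 else (1 - d) * ln (1 - cond_df \<nu> f \<theta> x z)))"

definition loglik ::
    "real measure \<Rightarrow> (real^'q \<Rightarrow> real^'p \<Rightarrow> real \<Rightarrow> real) \<Rightarrow> (nat \<Rightarrow> (real^'p::finite) \<times> real \<times> real) \<Rightarrow>
     nat \<Rightarrow> real^'q::finite \<Rightarrow> real" where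
  "loglik \<nu> f W n \<theta> = (\<Sum>i<n. loglik1 \<nu> f (W i) \<theta>)"

text \<open>The observation \<open>(X, Z, \<delta>)\<close> with \<open>Z = min Y C\<close> and \<open>\<delta>\<close> the indicator of
  \<open>Y \<le> C\<close>.\<close>

definition observed ::
    "('a \<Rightarrow> 'b) \<Rightarrow> ('a \<Rightarrow> real) \<Rightarrow> ('a \<Rightarrow> real) \<Rightarrow> 'a \<Rightarrow> 'b \<times> real \<times> real" where
  "observed X Y C \<omega> = (X \<omega>, min (Y \<omega>) (C \<omega>), of_bool (Y \<omega> \<le> C \<omega>))"

definition uncensored_score ::
    "(real^'q \<Rightarrow> real^'p \<Rightarrow> real \<Rightarrow> real) \<Rightarrow> real^'q \<Rightarrow> ('a \<Rightarrow> real^'p) \<Rightarrow> ('a \<Rightarrow> real) \<Rightarrow> 'a \<Rightarrow>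
     real^'q::finite" where
  "uncensored_score f \<theta> X Y \<omega> = gradient (\<lambda>\<theta>'. ln (f \<theta>' (X \<omega>) (Y \<omega>))) \<theta>"

text \<open>Integrands of the two expectations in the matrix \<open>\<Sigma>\<close>, entry by entry.\<close>

definition Sigma_integrand1 ::
    "(real^'q \<Rightarrow> real^'p \<Rightarrow> real \<Rightarrow> real) \<Rightarrow> real^'q \<Rightarrow> ('a \<Rightarrow> real^'p) \<Rightarrow> ('a \<Rightarrow> real) \<Rightarrow>
     (real^'p::finite \<Rightarrow> real measure) \<Rightarrow> 'q::finite \<Rightarrow> 'q \<Rightarrow> 'a \<Rightarrow> real" where
  "Sigma_integrand1 f \<theta> X Y G r s \<omega> =
     (1 - cdf_left (G (X \<omega>)) (Y \<omega>)) * uncensored_score f \<theta> X Y \<omega> $ r * uncensored_score f \<theta> X Y \<omega> $ s"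

definition Sigma_integrand2 ::
    "'a measure \<Rightarrow> real measure \<Rightarrow> (real^'q \<Rightarrow> real^'p \<Rightarrow> real \<Rightarrow> real) \<Rightarrow> real^'q \<Rightarrow>
     ('a \<Rightarrow> real^'p::finite) \<Rightarrow> ('a \<Rightarrow> real) \<Rightarrow> ('a \<Rightarrow> real) \<Rightarrow> 'q::finite \<Rightarrow> 'q \<Rightarrow> 'a \<Rightarrow> real" where
  "Sigma_integrand2 M \<nu> f \<theta> X Y C r s \<omega> =
     (let m = (\<lambda>r. cond_exp_given M (\<lambda>\<omega>. (X \<omega>, C \<omega>))
                     (\<lambda>\<omega>. of_bool (Y \<omega> \<le> C \<omega>) * uncensored_score f \<theta> X Y \<omega> $ r) \<omega>)
      in if cond_df \<nu> f \<theta> (X \<omega>) (C \<omega>) = 1 then 0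
         else inverse (1 - cond_df \<nu> f \<theta> (X \<omega>) (C \<omega>)) * m r * m s)"

definition Sigma_matrix ::
    "'a measure \<Rightarrow> real measure \<Rightarrow> (real^'q \<Rightarrow> real^'p \<Rightarrow> real \<Rightarrow> real) \<Rightarrow> real^'q \<Rightarrow>
     ('a \<Rightarrow> real^'p::finite) \<Rightarrow> ('a \<Rightarrow> real) \<Rightarrow> ('a \<Rightarrow> real) \<Rightarrow> (real^'p \<Rightarrow> real measure) \<Rightarrow>
     real^'q^'q::finite" where
  "Sigma_matrix M \<nu> f \<theta> X Y C G =
     (\<chi> r s. \<integral>\<omega>. Sigma_integrand1 f \<theta> X Y G r s \<omega> \<partial>M) +
     (\<chi> r s. \<integral>\<omega>. Sigma_integrand2 M \<nu> f \<theta> X Y C r s \<omega> \<partial>M)"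

text \<open>Existence of \<open>\<Sigma>\<close>: every expectation and every conditional expectation occurring in it
  is that of an integrable function (the library gives both the value 0 for nonmeasurable
  functions).\<close>

definition Sigma_exists ::
    "'a measure \<Rightarrow> real measure \<Rightarrow> (real^'q \<Rightarrow> real^'p \<Rightarrow> real \<Rightarrow> real) \<Rightarrow> real^'q::finite \<Rightarrow>
     ('a \<Rightarrow> real^'p::finite) \<Rightarrow> ('a \<Rightarrow> real) \<Rightarrow> ('a \<Rightarrow> real) \<Rightarrow> (real^'p \<Rightarrow> real measure) \<Rightarrow> bool" where
  "Sigma_exists M \<nu> f \<theta> X Y C G \<longleftrightarrow>
     (\<forall>r s. integrable M (Sigma_integrand1 f \<theta> X Y G r s)) \<and>
     (\<forall>r. integrable M (\<lambda>\<omega>. of_bool (Y \<omega> \<le> C \<omega>) * uncensored_score f \<theta> X Y \<omega> $ r)) \<and>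
     (\<forall>r s. integrable M (Sigma_integrand2 M \<nu> f \<theta> X Y C r s))"

text \<open>The integrand \<open>\<integral>\<^sub>y\<^sub>\<le>\<^sub>c D\<^sub>r\<^sub>s f(y|\<theta>,x) \<nu>(dy) - D\<^sub>r\<^sub>s F(c|\<theta>,x)\<close>.\<close>

definition interchange_defect ::
    "real measure \<Rightarrow> (real^'q \<Rightarrow> real^'p \<Rightarrow> real \<Rightarrow> real) \<Rightarrow> real^'q \<Rightarrow> 'q::finite \<Rightarrow> 'q \<Rightarrow>
     real^'p::finite \<Rightarrow> real \<Rightarrow> real" where
  "interchange_defect \<nu> f \<theta> r s x c =
     (LINT y:{..c}|\<nu>. partial_deriv2 r s (\<lambda>\<theta>'. f \<theta>' x y) \<theta>)
     - partial_deriv2 r s (\<lambda>\<theta>'. cond_df \<nu> f \<theta>' x c) \<theta>"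

end

theory Submission
  imports Defs
begin

text \<open>
  Write \<open>\<ell>\<close> for the log-likelihood of one observation. Two arguments meet in three moment
  identities at the true parameter: \<open>E D\<^sub>r \<ell> = 0\<close>, \<open>E (D\<^sub>r \<ell> D\<^sub>s \<ell>) = \<Sigma>\<^sub>r\<^sub>s\<close> and
  \<open>E D\<^sub>r\<^sub>s \<ell> = - \<Sigma>\<^sub>r\<^sub>s\<close>.

  The first argument derives asymptotic normality from these identities and knows nothing about
  censoring (locale \<open>m_estimation\<close>). The gradient of the log-likelihood of the sample vanishes at
  the maximizer. Let \<open>U\<^sub>n\<close> be the gradient at \<open>\<theta>\<^sub>0\<close> divided by \<open>\<surd>n\<close>, and let \<open>T\<^sub>n\<close> be the
  estimation error multiplied by \<open>\<surd>n\<close>. Expanding the gradient about \<open>\<theta>\<^sub>0\<close> gives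
  \<open>U\<^sub>n - \<Sigma> T\<^sub>n = o(|T\<^sub>n|)\<close> in probability (\<open>linearization\<close>): the averages of the second derivatives
  at \<open>\<theta>\<^sub>0\<close> approach \<open>- \<Sigma>\<close> by the weak law of large numbers, and their oscillation over a small
  ball is small in mean, because the second derivatives are continuous and have an integrable
  envelope. Hence \<open>T\<^sub>n\<close> is close to \<open>\<Sigma>\<inverse> U\<^sub>n\<close>, whose inner products with fixed vectors are
  normalized sums of independent real variables, to which the central limit theorem applies.
  Convergence of these inner products is enough for convergence in distribution, because the
  sequence is tight and every continuous function is close on compact sets to a trigonometric polynomial
  (\<open>converges_in_distribution_trig\<close>). The limit is recognized by computing the law of an inner
  product under the normal density (\<open>distr_multivariate_normal_inner\<close>).

  The second argument proves the identities. By conditional independence, \<open>Y\<close> has density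
  \<open>f(\<cdot>|\<theta>\<^sub>0,x)\<close> given \<open>X = x\<close> and \<open>C = c\<close> (\<open>joint_law\<close>). So the conditional mean of a function of the
  observation is its integral against \<open>f\<close> over \<open>y \<le> c\<close>, plus \<open>1 - F(c)\<close> times its value at the
  censored observation. Moreover \<open>f = exp \<ell>\<close> at an uncensored and \<open>1 - F = exp \<ell>\<close> at a censored
  observation. Therefore \<open>D\<^sub>s \<ell>\<close> multiplied by these weights becomes \<open>D\<^sub>s f\<close> and \<open>- D\<^sub>s F\<close>, and the
  combination \<open>D\<^sub>r\<^sub>s \<ell> + D\<^sub>r \<ell> D\<^sub>s \<ell>\<close> becomes \<open>D\<^sub>r\<^sub>s f\<close> and \<open>- D\<^sub>r\<^sub>s F\<close>. Differentiation under the integral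
  makes the conditional mean of the score vanish for almost every \<open>(x,c)\<close> (\<open>score_mean_zero\<close>). The
  conditional mean of the combination is the defect of interchanging second derivatives and integral,
  which vanishes on average by hypothesis (\<open>information_identity\<close>). In the second moments of the score,
  an uncensored value \<open>y\<close> is observed with probability \<open>P(C \<ge> y | x) = 1 - G(y-|x)\<close>, which gives the
  first matrix of \<open>\<Sigma>\<close> (\<open>uncensored_part\<close>). A censored observation has weight \<open>1 - F\<close> and score
  \<open>- D F / (1 - F)\<close>, where \<open>D F(C)\<close> is the conditional expectation of \<open>1{Y \<le> C} D \<ell>\<close> given \<open>X\<close> and
  \<open>C\<close>; this gives the second matrix (\<open>censored_part\<close>).

  Two points of measure theory shape the formulation. The log-likelihood is smooth for almost every
  observation only; it is replaced by 0 outside a Borel set of full measure, so that all derivatives exist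
  and are measurable. And smoothness in \<open>\<theta>\<close> of \<open>f\<close> at an uncensored observation is known only for
  those \<open>y\<close> that can be observed, so the score in \<open>\<Sigma>\<close> is identified only where \<open>1 - G(y-|x)\<close>
  does not vanish.
\<close>

section \<open>The multivariate normal law\<close>

lemma borel_measurable_vec_lambda:
  assumes "\<And>i. f i \<in> borel_measurable M"
  shows "(\<lambda>x. (\<chi> i. f i x) :: real^'n::finite) \<in> borel_measurable M"
  using assms by (auto simp: borel_measurable_euclidean_space[of "\<lambda>x. (\<chi> i. f i x)"] Basis_vec_def inner_axis)

lemma prod_Basis_vec: "(\<Prod>b\<in>Basis. h b) = (\<Prod>i\<in>UNIV. h (axis i (1::real) :: real^'n::finite))"
  and sum_Basis_vec: "(\<Sum>b\<in>Basis. h' b) = (\<Sum>i\<in>UNIV. h' (axis i (1::real) :: real^'n::finite))"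
proof -
  have B: "(Basis::(real^'n) set) = range (\<lambda>i. axis i 1)" by (auto simp: Basis_vec_def)
  have inj: "inj (\<lambda>i::'n. axis i (1::real))" by (auto simp: inj_on_def axis_eq_axis)
  show "(\<Prod>b\<in>Basis. h b) = (\<Prod>i\<in>UNIV. h (axis i (1::real) :: real^'n))"
    "(\<Sum>b\<in>Basis. h' b) = (\<Sum>i\<in>UNIV. h' (axis i (1::real) :: real^'n))"
    unfolding B by (simp_all add: prod.reindex[OF inj] sum.reindex[OF inj])
qed

text \<open>Makes Fubini's theorem available one coordinate at a time.\<close>

lemma lborel_vec_eq_distr_PiM:
  "(lborel :: (real^'n::finite) measure) = distr (\<Pi>\<^sub>M i\<in>UNIV. lborel) borel (\<lambda>f. \<chi> i. f i)"
proof (rule lborel_eqI)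
  have m: "(\<lambda>f. \<chi> i. f i) \<in> measurable (\<Pi>\<^sub>M i\<in>(UNIV::'n set). (lborel::real measure)) borel"
    by (intro borel_measurable_vec_lambda) measurable
  interpret P: product_sigma_finite "\<lambda>_::'n. lborel :: real measure" by standard
  fix l u :: "real^'n" assume lu: "\<And>b. b \<in> Basis \<Longrightarrow> l \<bullet> b \<le> u \<bullet> b"
  have le: "l $ i \<le> u $ i" for i
    using lu[of "axis i 1"] by (auto simp: inner_axis Basis_vec_def)
  have "emeasure (distr (\<Pi>\<^sub>M i\<in>UNIV. lborel) borel (\<lambda>f. \<chi> i. f i)) (box l u) =
        emeasure (\<Pi>\<^sub>M i\<in>(UNIV::'n set). (lborel::real measure)) (\<Pi>\<^sub>E i\<in>UNIV. {l $ i <..< u $ i})"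
    by (subst emeasure_distr[OF m])
       (auto simp: space_PiM mem_box_cart PiE_iff intro!: arg_cong2[where f=emeasure])
  also have "\<dots> = (\<Prod>i\<in>UNIV. ennreal (u $ i - l $ i))"
    by (subst P.emeasure_PiM) (auto simp: le)
  also have "\<dots> = ennreal (\<Prod>i\<in>UNIV. u $ i - l $ i)"
    by (rule prod_ennreal) (simp add: le)
  also have "(\<Prod>i\<in>UNIV. u $ i - l $ i) = (\<Prod>b\<in>Basis. (u - l) \<bullet> b)"
    by (simp add: prod_Basis_vec inner_axis)
  finally show "emeasure (distr (\<Pi>\<^sub>M i\<in>UNIV. lborel) borel (\<lambda>f. \<chi> i. f i)) (box l u)
     = ennreal (\<Prod>b\<in>Basis. (u - l) \<bullet> b)" .
qed simp

text \<open>With the other coordinates fixed, a shear translates coordinate \<open>m\<close>.\<close>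

lemma nn_integral_lborel_shear:
  fixes \<phi> :: "real^'n::finite \<Rightarrow> ennreal"
  assumes [measurable]: "\<phi> \<in> borel_measurable borel" and mn: "m \<noteq> n"
  shows "(\<integral>\<^sup>+x. \<phi> (\<chi> i. if i = m then x $ m + c * x $ n else x $ i) \<partial>lborel) = (\<integral>\<^sup>+x. \<phi> x \<partial>lborel)"
proof -
  interpret P: product_sigma_finite "\<lambda>_::'n. lborel :: real measure" by standard
  let ?sh = "\<lambda>x::real^'n. \<chi> i. if i = m then x $ m + c * x $ n else x $ i"
  have [measurable]: "(\<lambda>f. \<chi> i. f i) \<in> measurable (\<Pi>\<^sub>M i\<in>(UNIV::'n set). (lborel::real measure)) borel"
    by (intro borel_measurable_vec_lambda) measurable
  have [measurable]: "?sh \<in> borel_measurable borel"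
    by (intro borel_measurable_vec_lambda) auto
  have U: "UNIV = insert m (UNIV - {m})" by auto
  have split: "(\<integral>\<^sup>+x. \<psi> x \<partial>lborel) = (\<integral>\<^sup>+f. (\<integral>\<^sup>+y. \<psi> (\<chi> i. (f(m := y)) i) \<partial>lborel) \<partial>Pi\<^sub>M (UNIV - {m}) (\<lambda>_. lborel))"
    if [measurable]: "\<psi> \<in> borel_measurable borel" for \<psi> :: "real^'n \<Rightarrow> ennreal"
  proof -
    have "(\<integral>\<^sup>+x. \<psi> x \<partial>lborel) = (\<integral>\<^sup>+f. \<psi> (\<chi> i. f i) \<partial>Pi\<^sub>M (insert m (UNIV - {m})) (\<lambda>_. lborel))"
      unfolding U[symmetric] by (subst lborel_vec_eq_distr_PiM) (simp add: nn_integral_distr)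
    also have "\<dots> = (\<integral>\<^sup>+f. (\<integral>\<^sup>+y. \<psi> (\<chi> i. (f(m := y)) i) \<partial>lborel) \<partial>Pi\<^sub>M (UNIV - {m}) (\<lambda>_. lborel))"
      by (subst P.product_nn_integral_insert) (auto simp: U[symmetric])
    finally show ?thesis .
  qed
  have "(\<integral>\<^sup>+x. \<phi> (?sh x) \<partial>lborel) = (\<integral>\<^sup>+f. (\<integral>\<^sup>+y. \<phi> (?sh (\<chi> i. (f(m := y)) i)) \<partial>lborel) \<partial>Pi\<^sub>M (UNIV - {m}) (\<lambda>_. lborel))"
    by (rule split) measurable
  also have "\<dots> = (\<integral>\<^sup>+f. (\<integral>\<^sup>+y. \<phi> (\<chi> i. (f(m := y)) i) \<partial>lborel) \<partial>Pi\<^sub>M (UNIV - {m}) (\<lambda>_. lborel))"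
  proof (rule nn_integral_cong)
    fix f :: "'n \<Rightarrow> real"
    have [measurable]: "(\<lambda>y. \<phi> (\<chi> i. (f(m := y)) i)) \<in> borel_measurable borel"
      by (intro measurable_compose[OF borel_measurable_vec_lambda assms(1)]) (auto simp: fun_upd_def)
    have "(\<integral>\<^sup>+y. \<phi> (?sh (\<chi> i. (f(m := y)) i)) \<partial>lborel) = (\<integral>\<^sup>+y. \<phi> (\<chi> i. (f(m := c * f n + 1 * y)) i) \<partial>lborel)"
      using mn by (intro nn_integral_cong arg_cong[where f=\<phi>]) (auto simp: vec_eq_iff)
    also have "\<dots> = (\<integral>\<^sup>+y. \<phi> (\<chi> i. (f(m := y)) i) \<partial>lborel)"
    proof -
      have "(\<lambda>y. \<phi> (\<chi> i. (f(m := y)) i)) \<in> borel_measurable borel" by measurable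
      from nn_integral_real_affine[OF this, of 1 "c * f n"] show ?thesis by (simp del: fun_upd_apply)
    qed
    finally show "(\<integral>\<^sup>+y. \<phi> (?sh (\<chi> i. (f(m := y)) i)) \<partial>lborel) = (\<integral>\<^sup>+y. \<phi> (\<chi> i. (f(m := y)) i) \<partial>lborel)" .
  qed
  also have "\<dots> = (\<integral>\<^sup>+x. \<phi> x \<partial>lborel)" by (rule split[symmetric]) measurable
  finally show ?thesis .
qed

text \<open>A box goes to a box with the same side lengths in another order.\<close>

lemma lborel_distr_permute_coordinates:
  fixes p :: "'n::finite \<Rightarrow> 'n"
  assumes p: "p permutes UNIV"
  shows "distr lborel borel (\<lambda>x::real^'n. \<chi> i. x $ p i) = lborel"
proof (rule lborel_eqI[symmetric])
  have m: "(\<lambda>x::real^'n. \<chi> i. x $ p i) \<in> borel_measurable borel"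
    by (intro borel_measurable_vec_lambda) auto
  fix l u :: "real^'n" assume lu: "\<And>b. b \<in> Basis \<Longrightarrow> l \<bullet> b \<le> u \<bullet> b"
  have le: "l $ i \<le> u $ i" for i
    using lu[of "axis i 1"] by (auto simp: inner_axis Basis_vec_def)
  let ?q = "inv p"
  have pq: "p (?q i) = i" "?q (p i) = i" for i
    using permutes_inverses[OF p] by auto
  have "(\<lambda>x::real^'n. \<chi> i. x $ p i) -` box l u = box (\<chi> i. l $ ?q i) (\<chi> i. u $ ?q i)"
    apply (auto simp: mem_box_cart)
    apply (metis pq)+
    done
  then have "emeasure (distr lborel borel (\<lambda>x::real^'n. \<chi> i. x $ p i)) (box l u) =
      emeasure lborel (box (\<chi> i. l $ ?q i) (\<chi> i. u $ ?q i))"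
    using m by (simp add: emeasure_distr)
  also have "\<dots> = ennreal (\<Prod>i\<in>UNIV. u $ ?q i - l $ ?q i)"
    using le by (simp add: emeasure_lborel_box_eq prod_Basis_vec inner_axis inner_diff_left) (auto simp: Basis_vec_def inner_axis)
  also have "(\<Prod>i\<in>UNIV. u $ ?q i - l $ ?q i) = (\<Prod>i\<in>UNIV. u $ i - l $ i)"
    using prod.permute[OF permutes_inv[OF p], of "\<lambda>i. u $ i - l $ i"] by (simp add: o_def)
  also have "\<dots> = (\<Prod>b\<in>Basis. (u - l) \<bullet> b)"
    by (simp add: prod_Basis_vec inner_axis)
  finally show "emeasure (distr lborel borel (\<lambda>x::real^'n. \<chi> i. x $ p i)) (box l u) = ennreal (\<Prod>b\<in>Basis. (u - l) \<bullet> b)" .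
qed simp

lemma borel_measurable_matrix_vector_mult:
  fixes B :: "real^'n^'m::finite"
  shows "(\<lambda>x. B *v x) \<in> borel_measurable borel"
  by (intro borel_measurable_continuous_onI linear_continuous_on linear_linear[THEN iffD2]) auto

text \<open>Both sides are compatible with products of matrices, so elementary matrices suffice: diagonal ones,
  transpositions and shears. A matrix with a zero row is excluded by its determinant.\<close>

lemma nn_integral_lborel_linear:
  fixes A :: "real^'n^'n::finite" and \<phi> :: "real^'n \<Rightarrow> ennreal"
  assumes "det A \<noteq> 0" "\<phi> \<in> borel_measurable borel"
  shows "(\<integral>\<^sup>+x. \<phi> x \<partial>lborel) = ennreal \<bar>det A\<bar> * (\<integral>\<^sup>+x. \<phi> (A *v x) \<partial>lborel)"
proof -
  note Mv = borel_measurable_matrix_vector_mult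
  let ?P = "\<lambda>A::real^'n^'n. det A \<noteq> 0 \<longrightarrow> (\<forall>\<phi>\<in>borel_measurable borel.
      (\<integral>\<^sup>+x. \<phi> x \<partial>lborel) = ennreal \<bar>det A\<bar> * (\<integral>\<^sup>+x. \<phi> (A *v x) \<partial>lborel))"
  have "?P A"
  proof (rule induct_matrix_elementary[where P="?P"])
    fix A B :: "real^'n^'n"
    assume A: "?P A"
     and B: "?P B"
    show "?P (A ** B)"
    proof (intro impI ballI)
      fix \<phi> :: "real^'n \<Rightarrow> ennreal" assume d: "det (A ** B) \<noteq> 0" and \<phi>: "\<phi> \<in> borel_measurable borel"
      have "(\<lambda>x. \<phi> (A *v x)) \<in> borel_measurable borel"
        using Mv \<phi> by (rule measurable_compose)
      then have "(\<integral>\<^sup>+x. \<phi> (A *v x) \<partial>lborel) = ennreal \<bar>det B\<bar> * (\<integral>\<^sup>+x. \<phi> (A *v (B *v x)) \<partial>lborel)"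
        using B d by (auto simp: det_mul)
      moreover have "(\<integral>\<^sup>+x. \<phi> x \<partial>lborel) = ennreal \<bar>det A\<bar> * (\<integral>\<^sup>+x. \<phi> (A *v x) \<partial>lborel)"
        using A d \<phi> by (auto simp: det_mul)
      ultimately show "(\<integral>\<^sup>+x. \<phi> x \<partial>lborel) = ennreal \<bar>det (A ** B)\<bar> * (\<integral>\<^sup>+x. \<phi> ((A ** B) *v x) \<partial>lborel)"
        by (simp add: det_mul abs_mult ennreal_mult mult.assoc matrix_vector_mul_assoc)
    qed
  next
    fix A :: "real^'n^'n" and i assume "row i A = 0"
    then show "?P A"
      using det_zero_row(2) by blast
  next
    fix A :: "real^'n^'n" assume dg: "\<And>i j. i \<noteq> j \<Longrightarrow> A$i$j = 0"
    show "?P A"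
    proof (intro impI ballI)
      fix \<phi> :: "real^'n \<Rightarrow> ennreal" assume d: "det A \<noteq> 0" and \<phi>: "\<phi> \<in> borel_measurable borel"
      have dA: "det A = (\<Prod>i\<in>UNIV. A$i$i)" using dg by (rule det_diagonal)
      define c where "c b = b \<bullet> (A *v b)" for b :: "real^'n"
      have c: "c (axis i 1) = A$i$i" for i
        by (simp add: c_def inner_axis' matrix_vector_mult_basis column_def)
      have cnz: "c j \<noteq> 0" if "j \<in> Basis" for j
        using that d unfolding dA Basis_vec_def by (auto simp: c)
      have T: "(\<lambda>x. 0 + (\<Sum>j\<in>Basis. (c j * (x \<bullet> j)) *\<^sub>R j)) = (\<lambda>x. A *v x)"
      proof
        fix x :: "real^'n"
        have "(\<Sum>j\<in>Basis. (c j * (x \<bullet> j)) *\<^sub>R j) = (\<Sum>i\<in>UNIV. (A$i$i * x$i) *\<^sub>R axis i 1)"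
          by (simp add: sum_Basis_vec c inner_axis)
        also have "\<dots> = A *v x"
        proof (rule vec_eq_iff[THEN iffD2], rule allI)
          fix k
          have "(\<Sum>i\<in>UNIV. (A$i$i * x$i) *\<^sub>R axis i 1) $ k = (\<Sum>i\<in>UNIV. if i = k then A$k$k * x$k else 0)"
            unfolding sum_component by (intro sum.cong) (auto simp: axis_def)
          also have "\<dots> = (\<Sum>i\<in>UNIV. if i = k then A$k$i * x$i else 0)" by (auto intro!: sum.cong)
          also have "\<dots> = (A *v x) $ k"
            unfolding matrix_vector_mult_def vec_lambda_beta by (intro sum.cong) (auto simp: dg)
          finally show "(\<Sum>i\<in>UNIV. (A$i$i * x$i) *\<^sub>R axis i 1) $ k = (A *v x) $ k" .
        qed
        finally show "0 + (\<Sum>j\<in>Basis. (c j * (x \<bullet> j)) *\<^sub>R j) = A *v x" by simp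
      qed
      have pr: "(\<Prod>j\<in>Basis. \<bar>c j\<bar>) = \<bar>det A\<bar>"
        unfolding dA by (simp add: prod_Basis_vec c abs_prod)
      have "lborel = density (distr lborel borel (\<lambda>x. A *v x)) (\<lambda>_. ennreal \<bar>det A\<bar>)"
        using lborel_affine_euclidean[of c "0::real^'n", OF cnz] unfolding T pr by simp
      then have "(\<integral>\<^sup>+x. \<phi> x \<partial>lborel) = (\<integral>\<^sup>+x. \<phi> x \<partial>(density (distr lborel borel (\<lambda>x. A *v x)) (\<lambda>_. ennreal \<bar>det A\<bar>)))"
        by simp
      also have "\<dots> = ennreal \<bar>det A\<bar> * (\<integral>\<^sup>+x. \<phi> (A *v x) \<partial>lborel)"
        using Mv[of A] \<phi> by (simp add: nn_integral_density nn_integral_distr nn_integral_cmult measurable_compose[OF Mv \<phi>])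
      finally show "(\<integral>\<^sup>+x. \<phi> x \<partial>lborel) = ennreal \<bar>det A\<bar> * (\<integral>\<^sup>+x. \<phi> (A *v x) \<partial>lborel)" .
    qed
  next
    fix m n :: 'n assume "m \<noteq> n"
    let ?S = "\<chi> i j. mat 1 $ i $ Transposition.transpose m n j :: real^'n^'n"
    let ?p = "Transposition.transpose m n"
    have d: "\<bar>det ?S\<bar> = 1"
      by (simp add: det_permute_columns permutes_swap_id sign_swap_id abs_mult)
    have e: "?S *v x = (\<chi> i. x $ ?p i)" for x :: "real^'n"
    proof -
      have "(?p j = i) = (j = ?p i)" for i j by (metis transpose_involutory)
      then show ?thesis
        by (auto simp: vec_eq_iff matrix_vector_mult_def mat_def if_distrib[of "\<lambda>u. u * _"] eq_commute[of _ "?p _"] cong: if_cong)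
    qed
    show "?P ?S"
    proof (intro impI ballI)
      fix \<phi> :: "real^'n \<Rightarrow> ennreal" assume \<phi>: "\<phi> \<in> borel_measurable borel"
      have "(\<integral>\<^sup>+x. \<phi> x \<partial>lborel) = (\<integral>\<^sup>+x. \<phi> x \<partial>distr lborel borel (\<lambda>x::real^'n. \<chi> i. x $ ?p i))"
        by (subst lborel_distr_permute_coordinates) (auto simp: permutes_swap_id)
      also have "\<dots> = (\<integral>\<^sup>+x. \<phi> (?S *v x) \<partial>lborel)"
        using \<phi> unfolding e by (subst nn_integral_distr) (auto intro!: borel_measurable_vec_lambda)
      finally show "(\<integral>\<^sup>+x. \<phi> x \<partial>lborel) = ennreal \<bar>det ?S\<bar> * (\<integral>\<^sup>+x. \<phi> (?S *v x) \<partial>lborel)"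
        unfolding d by simp
    qed
  next
    fix m n :: 'n and c assume mn: "m \<noteq> n"
    let ?S = "\<chi> i j. if i = m \<and> j = n then c else of_bool (i = j) :: real^'n^'n"
    have "?S = (\<chi> k. if k = m then row m (mat 1) + c *s row n (mat 1) else row k (mat 1))"
      using mn by (auto simp: vec_eq_iff row_def mat_def)
    then have d: "det ?S = 1"
      using det_row_operation[OF mn, of "mat 1 :: real^'n^'n" c] by simp
    have e: "?S *v x = (\<chi> i. if i = m then x $ m + c * x $ n else x $ i)" for x :: "real^'n"
    proof (rule vec_eq_iff[THEN iffD2], rule allI)
      fix i
      show "(?S *v x) $ i = (\<chi> i. if i = m then x $ m + c * x $ n else x $ i) $ i"
      proof (cases "i = m")
        case True
        have "(?S *v x) $ i = (\<Sum>j\<in>UNIV. (if j = n then c * x $ j else 0) + (if j = m then x $ j else 0))"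
          using mn True unfolding matrix_vector_mult_def by (auto intro!: sum.cong)
        then show ?thesis using True by (simp add: sum.distrib)
      next
        case False
        have "(?S *v x) $ i = (\<Sum>j\<in>UNIV. (if j = i then x $ j else 0))"
          using mn False unfolding matrix_vector_mult_def by (auto intro!: sum.cong)
        then show ?thesis using False by simp
      qed
    qed
    show "?P ?S"
      unfolding d e using nn_integral_lborel_shear[OF _ mn] by auto
  qed
  then show ?thesis using assms by blast
qed

lemma matrix_inv_mult_left:
  fixes A :: "real^'n^'n::finite"
  shows "invertible A \<Longrightarrow> matrix_inv A ** A = mat 1"
  and matrix_inv_mult_right: "invertible A \<Longrightarrow> A ** matrix_inv A = mat 1"
  unfolding invertible_def matrix_inv_def by (metis (mono_tags, lifting) someI_ex)+

text \<open>A basis that is orthonormal for the inner product defined by \<open>A\<close>. One of its vectors is taken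
  proportional to \<open>t\<close>, so that in the corresponding coordinates \<open>x \<mapsto> t \<bullet> x\<close> depends on one of them
  only. The Gram-Schmidt process runs over subsets of the index type, which carries no order.\<close>

lemma positive_definite_orthonormal_system:
  fixes A :: "real^'n^'n::finite"
  assumes A: "positive_definite A" and t: "t \<noteq> 0"
  obtains b :: "'n \<Rightarrow> real^'n" and k where
    "\<And>i j. b i \<bullet> (A *v b j) = of_bool (i = j)" "t = sqrt (t \<bullet> (A *v t)) *\<^sub>R b k"
proof -
  have sym: "x \<bullet> (A *v y) = y \<bullet> (A *v x)" for x y
    using A dot_lmul_matrix[of x A y]
    by (metis positive_definite_def inner_commute transpose_matrix_vector)
  have pos: "v \<bullet> (A *v v) > 0" if "v \<noteq> 0" for v
    using A that by (auto simp: positive_definite_def)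
  define nrm where "nrm v = (1 / sqrt (v \<bullet> (A *v v))) *\<^sub>R v" for v
  have nrm1: "nrm v \<bullet> (A *v nrm v) = 1" if "v \<noteq> 0" for v
    using pos[OF that] unfolding nrm_def
    by (simp add: matrix_vector_mult_scaleR real_sqrt_mult_self)
  obtain k :: 'n where True by auto
  have "\<exists>b::'n \<Rightarrow> real^'n. b k = nrm t \<and> (\<forall>i\<in>insert k I. \<forall>j\<in>insert k I. b i \<bullet> (A *v b j) = of_bool (i = j))" for I
  proof (induction I rule: finite_induct[OF finite])
    case 1
    show ?case by (rule exI[of _ "\<lambda>_. nrm t"]) (use nrm1[OF t] in auto)
  next
    case (2 l I)
    then obtain b where b: "b k = nrm t" "\<And>i j. i \<in> insert k I \<Longrightarrow> j \<in> insert k I \<Longrightarrow> b i \<bullet> (A *v b j) = of_bool (i = j)"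
      by blast
    show ?case
    proof (cases "l = k")
      case True then show ?thesis using b by (intro exI[of _ b]) auto
    next
      case False
      let ?T = "(\<lambda>i. A *v b i) ` insert k I"
      have "dim ?T \<le> card ?T" by (rule dim_le_card') simp
      also have "\<dots> \<le> card (insert k I)" by (rule card_image_le) simp
      also have "\<dots> < CARD('n)"
        using 2 False by (intro psubset_card_mono) auto
      \<comment> \<open>Fewer vectors than dimensions have been chosen, so a new direction is left.\<close>
      finally obtain v where v: "v \<noteq> 0" "\<And>y. y \<in> span ?T \<Longrightarrow> orthogonal v y"
        using orthogonal_to_subspace_exists[of ?T] by auto
      have vb: "v \<bullet> (A *v b i) = 0" if "i \<in> insert k I" for i
        using v(2)[of "A *v b i"] that by (auto simp: orthogonal_def intro: span_base)
      have nb: "nrm v \<bullet> (A *v b i) = 0" "b i \<bullet> (A *v nrm v) = 0" if "i \<in> insert k I" for i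
        using vb[OF that] sym[of "b i" "nrm v"] by (auto simp: nrm_def)
      show ?thesis
      proof (rule exI[of _ "b(l := nrm v)"], intro conjI ballI)
        show "(b(l := nrm v)) k = nrm t" using b(1) False by simp
        fix i j assume "i \<in> insert k (insert l I)" "j \<in> insert k (insert l I)"
        then have "i = l \<or> i \<in> insert k I" "j = l \<or> j \<in> insert k I" by auto
        moreover have "l \<notin> insert k I" using 2 False by simp
        ultimately show "(b(l := nrm v)) i \<bullet> (A *v (b(l := nrm v)) j) = of_bool (i = j)"
          using b(2) nb nrm1[OF v(1)] by (cases "i = l"; cases "j = l") (simp_all del: insert_iff; blast)+
      qed
    qed
  qed
  from this[of UNIV] obtain b where b: "b k = nrm t" "\<And>i j. b i \<bullet> (A *v b j) = of_bool (i = j)"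
    by auto
  have "t = sqrt (t \<bullet> (A *v t)) *\<^sub>R b k"
    using pos[OF t] unfolding b(1) nrm_def by simp
  with b(2) show thesis by (rule that)
qed

lemma nn_integral_lborel_vec_prod:
  assumes "\<And>i. h i \<in> borel_measurable borel"
  shows "(\<integral>\<^sup>+z. (\<Prod>i\<in>UNIV. h i (z $ i)) \<partial>(lborel :: (real^'n::finite) measure)) =
    (\<Prod>i\<in>UNIV. \<integral>\<^sup>+x. h i x \<partial>lborel)"
proof -
  interpret P: product_sigma_finite "\<lambda>_::'n. lborel :: real measure" by standard
  have [measurable]: "(\<lambda>f. \<chi> i. f i) \<in> measurable (\<Pi>\<^sub>M i\<in>(UNIV::'n set). (lborel::real measure)) borel"
    by (intro borel_measurable_vec_lambda) measurable
  have [measurable]: "(\<lambda>z::real^'n. \<Prod>i\<in>UNIV. h i (z $ i)) \<in> borel_measurable borel"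
    using assms by (intro borel_measurable_prod_ennreal measurable_compose[OF _ assms]) auto
  show ?thesis
    using assms by (subst lborel_vec_eq_distr_PiM) (simp add: nn_integral_distr P.product_nn_integral_prod)
qed

text \<open>The substitution \<open>x = Q z\<close> with \<open>Q = A P\<^sup>T\<close>, where the rows of \<open>P\<close> are an \<open>A\<close>-orthonormal basis
  with \<open>t\<close> in the direction of its \<open>k\<close>-th vector, turns the quadratic form into \<open>|z|\<^sup>2\<close> and \<open>t \<bullet> x\<close> into
  a multiple of \<open>z\<^sub>k\<close>. The density becomes a product, and all factors but the \<open>k\<close>-th integrate to 1.\<close>

lemma distr_multivariate_normal_inner:
  fixes A :: "real^'n^'n::finite"
  assumes A: "positive_definite A" and t: "t \<noteq> 0"
  shows "distr (multivariate_normal 0 A) borel (\<lambda>x. t \<bullet> x) =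
         distr std_normal_distribution borel (\<lambda>z. sqrt (t \<bullet> (A *v t)) * z)"
proof (rule measure_eqI)
  note borel_measurable_matrix_vector_mult [measurable]
  obtain b :: "'n \<Rightarrow> real^'n" and k where b: "\<And>i j. b i \<bullet> (A *v b j) = of_bool (i = j)"
      and tb: "t = sqrt (t \<bullet> (A *v t)) *\<^sub>R b k"
    using positive_definite_orthonormal_system[OF A t] by blast
  define \<sigma> where "\<sigma> = sqrt (t \<bullet> (A *v t))"
  define P where "P = (\<chi> i j. b i $ j)"
  define Q where "Q = A ** transpose P"
  have Prow: "(P *v x) $ i = b i \<bullet> x" for x i
    by (simp add: P_def matrix_vector_mult_def inner_vec_def)
  have trP: "transpose P *v axis j 1 = b j" for j
    by (simp add: P_def matrix_vector_mult_basis column_def transpose_def vec_eq_iff del: transpose_matrix_vector)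
  have PQ: "P ** Q = mat 1"
  proof -
    have "((P ** Q) *v axis j 1) $ i = (mat 1 *v axis j 1) $ i" for i j
      by (simp add: Q_def matrix_vector_mul_assoc[symmetric] Prow trP b 
            del: matrix_vector_mul_assoc transpose_matrix_vector)
         (simp add: axis_def)
    then show ?thesis
      by (simp add: vec_eq_iff matrix_vector_mult_basis column_def)
  qed
  have "det P * (det A * det P) = 1"
    using arg_cong[OF PQ, of det] by (simp add: det_mul Q_def)
  then have dA: "det A * (det P)\<^sup>2 = 1" and dP: "det P \<noteq> 0"
    by (auto simp: power2_eq_square ac_simps)
  have dA0: "det A > 0"
    using dA dP by (smt (verit) mult_nonpos_nonneg zero_le_power2)
  have dQ: "\<bar>det Q\<bar> = sqrt (det A)"
  proof (rule real_sqrt_unique[symmetric])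
    have "(det Q)\<^sup>2 = det A * (det A * (det P)\<^sup>2)"
      by (simp add: Q_def det_mul power2_eq_square ac_simps)
    then show "\<bar>det Q\<bar>\<^sup>2 = det A" using dA by simp
  qed simp
  then have dQ0: "det Q \<noteq> 0" using dA0 by auto
  have invA: "invertible A" using dA0 by (simp add: invertible_det_nz)
  have Qz: "(Q *v z) \<bullet> (matrix_inv A *v (Q *v z)) = (norm z)\<^sup>2" for z
  proof -
    have "matrix_inv A *v (Q *v z) = transpose P *v z"
      unfolding Q_def by (simp add: matrix_vector_mul_assoc matrix_mul_assoc matrix_inv_mult_left[OF invA])
    then have "(Q *v z) \<bullet> (matrix_inv A *v (Q *v z)) = (P *v (Q *v z)) \<bullet> z"
      by (metis dot_lmul_matrix inner_commute transpose_matrix_vector)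
    also have "\<dots> = z \<bullet> z" by (simp add: matrix_vector_mul_assoc PQ)
    finally show ?thesis by (simp add: power2_norm_eq_inner)
  qed
  have tQ: "t \<bullet> (Q *v z) = \<sigma> * z $ k" for z
  proof -
    have "b k \<bullet> (Q *v z) = z $ k"
      by (simp add: Prow[symmetric] matrix_vector_mul_assoc PQ)
    then show ?thesis using tb unfolding \<sigma>_def[symmetric] by (metis inner_scaleR_left)
  qed
  fix B :: "real set" assume "B \<in> sets (distr (multivariate_normal 0 A) borel (\<lambda>x. t \<bullet> x))"
  then have B [measurable]: "B \<in> sets borel" by simp
  let ?d = "\<lambda>x. ennreal (exp (- (x \<bullet> (matrix_inv A *v x)) / 2) / sqrt ((2 * pi) ^ CARD('n) * det A))"
  have [measurable]: "?d \<in> borel_measurable borel" by measurable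
  define h where "h i z = (if i = k then indicator B (\<sigma> * z) else 1) * ennreal (std_normal_density z)" for i :: 'n and z
  have h [measurable]: "h i \<in> borel_measurable borel" for i unfolding h_def by measurable
  have "emeasure (distr (multivariate_normal 0 A) borel (\<lambda>x. t \<bullet> x)) B =
      (\<integral>\<^sup>+x. ?d x * indicator B (t \<bullet> x) \<partial>lborel)"
    unfolding multivariate_normal_def
    by (subst emeasure_distr) (simp_all add: emeasure_density indicator_vimage[symmetric] indicator_def vimage_def del: minus_divide_left times_divide_eq_left power_mult_distrib)
  also have "\<dots> = ennreal \<bar>det Q\<bar> * (\<integral>\<^sup>+z. ?d (Q *v z) * indicator B (t \<bullet> (Q *v z)) \<partial>lborel)"
    by (rule nn_integral_lborel_linear[OF dQ0]) measurable
  also have "\<dots> = (\<integral>\<^sup>+z. ennreal \<bar>det Q\<bar> * (?d (Q *v z) * indicator B (t \<bullet> (Q *v z))) \<partial>lborel)"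
    by (rule nn_integral_cmult[symmetric]) measurable
  also have "\<dots> = (\<integral>\<^sup>+z. (\<Prod>i\<in>UNIV. h i (z $ i)) \<partial>(lborel :: (real^'n) measure))"
  proof (intro nn_integral_cong)
    fix z :: "real^'n"
    have "\<bar>det Q\<bar> * (exp (- (norm z)\<^sup>2 / 2) / sqrt ((2 * pi) ^ CARD('n) * det A)) = 
        exp (- (norm z)\<^sup>2 / 2) / sqrt (2 * pi) ^ CARD('n)"
      using dA0 by (simp add: dQ real_sqrt_mult real_sqrt_power power_mult_distrib)
    also have "\<dots> = (\<Prod>i\<in>UNIV. std_normal_density (z $ i))"
    proof -
      have "(norm z)\<^sup>2 = (\<Sum>i\<in>UNIV. (z $ i)\<^sup>2)"
        unfolding power2_norm_eq_inner by (simp add: inner_vec_def power2_eq_square)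
      then have "exp (- (norm z)\<^sup>2 / 2) = (\<Prod>i\<in>UNIV. exp (- (z $ i)\<^sup>2 / 2))"
        by (simp add: exp_sum[symmetric] sum_negf sum_divide_distrib)
      then show ?thesis by (simp add: std_normal_density_def prod_dividef prod.distrib power_one_over divide_simps)
    qed
    finally have e: "\<bar>det Q\<bar> * (exp (- (norm z)\<^sup>2 / 2) / sqrt ((2 * pi) ^ CARD('n) * det A)) = 
        (\<Prod>i\<in>UNIV. std_normal_density (z $ i))" .
    have "(\<Prod>i\<in>UNIV. h i (z $ i)) = (\<Prod>i\<in>UNIV. (if i = k then indicator B (\<sigma> * z $ i) else 1)) * (\<Prod>i\<in>UNIV. ennreal (std_normal_density (z $ i)))"
      by (simp add: h_def prod.distrib)
    also have "\<dots> = indicator B (\<sigma> * z $ k) * ennreal (\<Prod>i\<in>UNIV. std_normal_density (z $ i))"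
      by (simp add: prod_ennreal)
    also have "\<dots> = ennreal \<bar>det Q\<bar> * (?d (Q *v z) * indicator B (t \<bullet> (Q *v z)))"
      unfolding e[symmetric] Qz tQ by (subst ennreal_mult) (use dA0 in \<open>simp_all add: mult_ac\<close>)
    finally show "ennreal \<bar>det Q\<bar> * (?d (Q *v z) * indicator B (t \<bullet> (Q *v z))) = (\<Prod>i\<in>UNIV. h i (z $ i))" ..
  qed
  also have "\<dots> = (\<Prod>i\<in>UNIV. \<integral>\<^sup>+x. h i x \<partial>lborel)"
    by (rule nn_integral_lborel_vec_prod) measurable
  also have "\<dots> = (\<integral>\<^sup>+x. h k x \<partial>lborel) * (\<Prod>i\<in>UNIV - {k}. \<integral>\<^sup>+x. h i x \<partial>lborel)"
    by (rule prod.remove) auto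
  also have "(\<Prod>i\<in>UNIV - {k}. \<integral>\<^sup>+x. h i x \<partial>lborel) = 1"
  proof (rule prod.neutral, rule)
    fix i assume "i \<in> UNIV - {k}"
    interpret prob_space std_normal_distribution by (rule real_distribution.axioms(1)[OF real_dist_normal_dist])
    have "(\<integral>\<^sup>+x. ennreal (std_normal_density x) \<partial>lborel) = 1"
      using emeasure_space_1 by (simp add: emeasure_density)
    then show "(\<integral>\<^sup>+x. h i x \<partial>lborel) = 1"
      using \<open>i \<in> UNIV - {k}\<close> by (simp add: h_def)
  qed
  also have "(\<integral>\<^sup>+x. h k x \<partial>lborel) * 1 = emeasure (distr std_normal_distribution borel (\<lambda>z. \<sigma> * z)) B"
  proof -
    have [measurable]: "(\<lambda>z. \<sigma> * z) -` B \<in> sets borel"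
      using measurable_sets_borel[of "\<lambda>z. \<sigma> * z" borel B] by simp
    have "emeasure (distr std_normal_distribution borel (\<lambda>z. \<sigma> * z)) B = 
        (\<integral>\<^sup>+z. ennreal (std_normal_density z) * indicator ((\<lambda>z. \<sigma> * z) -` B) z \<partial>lborel)"
      by (subst emeasure_distr) (simp_all add: emeasure_density)
    also have "\<dots> = (\<integral>\<^sup>+x. h k x \<partial>lborel)"
      by (intro nn_integral_cong) (simp add: h_def indicator_def)
    finally show ?thesis by simp
  qed
  finally show "emeasure (distr (multivariate_normal 0 A) borel (\<lambda>x. t \<bullet> x)) B =
    emeasure (distr std_normal_distribution borel (\<lambda>z. sqrt (t \<bullet> (A *v t)) * z)) B"
    unfolding \<sigma>_def .
qed simp

text \<open>The image under an inner product is a normal law on the line, of total mass 1.\<close>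

lemma prob_space_multivariate_normal:
  fixes A :: "real^'n^'n::finite"
  assumes A: "positive_definite A"
  shows "prob_space (multivariate_normal 0 A)"
proof -
  obtain k :: 'n where True by auto
  have t: "axis k (1::real) \<noteq> 0" by (simp add: axis_eq_0_iff)
  interpret prob_space std_normal_distribution by (rule real_distribution.axioms(1)[OF real_dist_normal_dist])
  have "prob_space (distr (multivariate_normal 0 A) borel (\<lambda>x. axis k 1 \<bullet> x))"
    unfolding distr_multivariate_normal_inner[OF A t] by (intro prob_space_distr) simp
  then have "prob_space (distr (multivariate_normal 0 A) (borel::real measure) (\<lambda>x. axis k 1 \<bullet> x))" .
  moreover have "(\<lambda>x. axis k 1 \<bullet> x) \<in> measurable (multivariate_normal 0 A) (borel::real measure)"
    by (simp add: multivariate_normal_def)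
  ultimately show ?thesis by (rule prob_space_distrD[rotated])
qed

section \<open>Convergence in distribution from trigonometric moments\<close>

text \<open>Only linear combinations are generated, so that limits of integrals extend from the
  generators by induction; the product formulas for sine and cosine make the set an algebra.\<close>

inductive_set trig_polys :: "('a::euclidean_space \<Rightarrow> real) set" where
  cos: "(\<lambda>x. cos (t \<bullet> x)) \<in> trig_polys"
| sin: "(\<lambda>x. sin (t \<bullet> x)) \<in> trig_polys"
| add: "f \<in> trig_polys \<Longrightarrow> g \<in> trig_polys \<Longrightarrow> (\<lambda>x. f x + g x) \<in> trig_polys"
| scale: "f \<in> trig_polys \<Longrightarrow> (\<lambda>x. c * f x) \<in> trig_polys"

lemma trig_polys_const: "(\<lambda>_. c) \<in> trig_polys"
  using trig_polys.scale[OF trig_polys.cos[of 0], of c] by simp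

lemma trig_polys_mult:
  assumes "f \<in> trig_polys" "g \<in> trig_polys"
  shows "(\<lambda>x. f x * g x) \<in> trig_polys"
proof -
  have cs: "(\<lambda>x. c * (u x + v x)) \<in> trig_polys" if "u \<in> trig_polys" "v \<in> trig_polys" for u v :: "'a \<Rightarrow> real" and c
    by (intro trig_polys.intros that)
  have neg: "(\<lambda>x. - u x) \<in> trig_polys" if "u \<in> trig_polys" for u :: "'a \<Rightarrow> real"
    using trig_polys.scale[OF that, of "-1"] by simp
  have C: "(\<lambda>x. cos (t \<bullet> x) * g x) \<in> trig_polys" for t
    using assms(2)
  proof induction
    case (cos s)
    have "(\<lambda>x. (1/2) * (cos ((t - s) \<bullet> x) + cos ((t + s) \<bullet> x))) \<in> trig_polys"
      by (intro cs trig_polys.cos)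
    then show ?case by (simp add: cos_times_cos inner_diff_left inner_add_left)
  next
    case (sin s)
    have "(\<lambda>x. (1/2) * (sin ((t + s) \<bullet> x) + - sin ((t - s) \<bullet> x))) \<in> trig_polys"
      by (intro cs trig_polys.sin neg)
    then show ?case by (simp add: cos_times_sin inner_diff_left inner_add_left)
  next
    case (add u v)
    from trig_polys.add[OF add.IH] show ?case by (simp add: algebra_simps)
  next
    case (scale u c)
    from trig_polys.scale[OF scale.IH, of c] show ?case by (simp add: algebra_simps)
  qed
  have S: "(\<lambda>x. sin (t \<bullet> x) * g x) \<in> trig_polys" for t
    using assms(2)
  proof induction
    case (cos s)
    have "(\<lambda>x. (1/2) * (sin ((t + s) \<bullet> x) + sin ((t - s) \<bullet> x))) \<in> trig_polys"
      by (intro cs trig_polys.sin neg)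
    then show ?case by (simp add: sin_times_cos inner_diff_left inner_add_left)
  next
    case (sin s)
    have "(\<lambda>x. (1/2) * (cos ((t - s) \<bullet> x) + - cos ((t + s) \<bullet> x))) \<in> trig_polys"
      by (intro cs trig_polys.cos neg)
    then show ?case by (simp add: sin_times_sin inner_diff_left inner_add_left)
  next
    case (add u v)
    from trig_polys.add[OF add.IH] show ?case by (simp add: algebra_simps)
  next
    case (scale u c)
    from trig_polys.scale[OF scale.IH, of c] show ?case by (simp add: algebra_simps)
  qed
  from assms(1) show ?thesis
  proof induction
    case (add u v)
    from trig_polys.add[OF add.IH] show ?case by (simp add: algebra_simps)
  next
    case (scale u c)
    from trig_polys.scale[OF scale.IH, of c] show ?case by (simp add: algebra_simps)
  qed (fact C S)+
qed

lemma trig_polys_continuous: "f \<in> trig_polys \<Longrightarrow> continuous_on S f"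
  by (induction rule: trig_polys.induct) (auto intro!: continuous_intros)

lemma trig_polys_bounded: "f \<in> trig_polys \<Longrightarrow> \<exists>R. \<forall>x. \<bar>f x\<bar> \<le> R"
proof (induction rule: trig_polys.induct)
  case (add f g)
  then obtain R R' where "\<forall>x. \<bar>f x\<bar> \<le> R" "\<forall>x. \<bar>g x\<bar> \<le> R'" by auto
  then have "\<forall>x. \<bar>f x + g x\<bar> \<le> R + R'" by (meson abs_triangle_ineq add_mono order_trans)
  then show ?case by blast
next
  case (scale f c)
  then obtain R where "\<forall>x. \<bar>f x\<bar> \<le> R" by auto
  then have "\<forall>x. \<bar>c * f x\<bar> \<le> \<bar>c\<bar> * R" by (auto simp: abs_mult intro: mult_left_mono)
  then show ?case by blast
qed (intro exI[of _ 1]; simp add: abs_cos_le_one abs_sin_le_one)+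

lemma trig_polys_polynomial:
  fixes q :: "real \<Rightarrow> real"
  assumes "real_polynomial_function q" "f \<in> trig_polys"
  shows "(\<lambda>x. q (f x)) \<in> trig_polys"
  using assms(1)
proof induction
  case (linear q)
  have "q (f x) = q 1 * f x" for x
    using linear_simps(5)[OF linear, of "f x" 1] by simp
  then show ?case using trig_polys.scale[OF assms(2)] by simp
next
  case (const c) show ?case by (rule trig_polys_const)
next
  case (add u v) from trig_polys.add[OF add.IH] show ?case .
next
  case (mult u v) from trig_polys_mult[OF mult.IH] show ?case .
qed

lemma trig_polys_dense_compact:
  fixes h :: "'a::euclidean_space \<Rightarrow> real"
  assumes "compact S" "continuous_on S h" "0 < \<epsilon>"
  obtains p where "p \<in> trig_polys" "\<And>x. x \<in> S \<Longrightarrow> \<bar>h x - p x\<bar> < \<epsilon>"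
proof -
  interpret function_ring_on trig_polys S
  proof
    fix x y :: 'a assume "x \<noteq> y"
    \<comment> \<open>Frequency chosen such that the phases at x and y differ by exactly 1.\<close>
    define d where "d = (1 / (norm (x - y))\<^sup>2) *\<^sub>R (x - y)"
    have "d \<bullet> x - d \<bullet> y = 1"
      using \<open>x \<noteq> y\<close> unfolding inner_diff_right[symmetric] d_def by (simp add: power2_norm_eq_inner)
    then have xy: "d \<bullet> x = d \<bullet> y + 1" by simp
    \<comment> \<open>If both functions of frequency d agreed at x and y, then the cosine of the difference 1 would be 1.\<close>
    have "sin (d \<bullet> x) \<noteq> sin (d \<bullet> y) \<or> cos (d \<bullet> x) \<noteq> cos (d \<bullet> y)"
    proof (rule ccontr)
      assume "\<not> ?thesis"
      then have "sin (d \<bullet> x) = sin (d \<bullet> y)" "cos (d \<bullet> x) = cos (d \<bullet> y)" by auto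
      then have "cos (d \<bullet> x - d \<bullet> y) = 1"
        by (simp add: cos_diff)
      then have "cos (1::real) = cos 0" unfolding xy by simp
      moreover have "cos (1::real) < cos 0" using pi_gt3 by (intro cos_monotone_0_pi) auto
      ultimately show False by simp
    qed
    then show "\<exists>f\<in>trig_polys. f x \<noteq> f y"
      using bexI[OF _ trig_polys.sin[of d], of "\<lambda>f. f x \<noteq> f y"]
        bexI[OF _ trig_polys.cos[of d], of "\<lambda>f. f x \<noteq> f y"] by argo
  qed (use assms in \<open>auto intro: trig_polys_continuous trig_polys.add trig_polys_mult trig_polys_const\<close>)
  from Stone_Weierstrass_basic[OF assms(2,3)] show thesis using that by auto
qed

text \<open>Clamping the approximant with a polynomial keeps it a trigonometric polynomial, and bounds
  it outside the compact set as well.\<close>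

lemma trig_polys_dense_bounded:
  fixes h :: "'a::euclidean_space \<Rightarrow> real"
  assumes "compact S" "continuous_on S h" "0 < \<epsilon>" "\<And>x. \<bar>h x\<bar> \<le> B"
  obtains p where "p \<in> trig_polys" "\<And>x. x \<in> S \<Longrightarrow> \<bar>h x - p x\<bar> \<le> 2 * \<epsilon>" "\<And>x. \<bar>p x\<bar> \<le> B + \<epsilon>"
proof -
  from trig_polys_dense_compact[OF assms(1-3)] obtain p
    where p: "p \<in> trig_polys" "\<And>x. x \<in> S \<Longrightarrow> \<bar>h x - p x\<bar> < \<epsilon>" by blast
  from trig_polys_bounded[OF p(1)] obtain R where R: "\<And>x. \<bar>p x\<bar> \<le> R" by auto
  have B0: "B \<ge> 0" using assms(4)[of undefined] by linarith
  define clamp where "clamp u = max (- B) (min B u)" for u :: real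
  have "continuous_on {-R..R} clamp" unfolding clamp_def by (intro continuous_intros)
  from Stone_Weierstrass_real_polynomial_function[OF compact_Icc this assms(3)]
  obtain q where q: "real_polynomial_function q" "\<And>u. u \<in> {-R..R} \<Longrightarrow> \<bar>clamp u - q u\<bar> < \<epsilon>" by blast
  have qp: "\<bar>clamp (p x) - q (p x)\<bar> < \<epsilon>" for x
    using q(2)[of "p x"] R[of x] by (simp add: abs_le_iff)
  show thesis
  proof (rule that[of "\<lambda>x. q (p x)"])
    show "(\<lambda>x. q (p x)) \<in> trig_polys" by (rule trig_polys_polynomial[OF q(1) p(1)])
    show "\<bar>q (p x)\<bar> \<le> B + \<epsilon>" for x
      using qp[of x] B0 unfolding clamp_def by linarith
    show "\<bar>h x - q (p x)\<bar> \<le> 2 * \<epsilon>" if "x \<in> S" for x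
      using qp[of x] p(2)[OF that] assms(4)[of x] unfolding clamp_def by linarith
  qed
qed

text \<open>Outside the ball \<open>h\<close> and \<open>g\<close> need not be close; their bounds are paid for by the tail
  probability.\<close>

lemma (in prob_space) expectation_close_off_tail:
  fixes T :: "'a \<Rightarrow> 'b::euclidean_space"
  assumes [measurable]: "T \<in> borel_measurable M" "h \<in> borel_measurable borel" "g \<in> borel_measurable borel"
   and h: "\<And>x. \<bar>h x\<bar> \<le> B" and g: "\<And>x. \<bar>g x\<bar> \<le> B'"
   and c: "\<And>x. norm x \<le> K \<Longrightarrow> \<bar>h x - g x\<bar> \<le> \<delta>" and "0 \<le> \<delta>"
  shows "\<bar>(\<integral>\<omega>. h (T \<omega>) \<partial>M) - (\<integral>\<omega>. g (T \<omega>) \<partial>M)\<bar> \<le> \<delta> + (B + B') * prob {\<omega> \<in> space M. norm (T \<omega>) > K}"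
proof -
  have ih: "integrable M (\<lambda>\<omega>. h (T \<omega>))"
    by (rule integrable_const_bound[of _ B]) (auto simp: h)
  have ig: "integrable M (\<lambda>\<omega>. g (T \<omega>))"
    by (rule integrable_const_bound[of _ B']) (auto simp: g)
  define A where "A = {\<omega> \<in> space M. norm (T \<omega>) > K}"
  have A: "A \<in> sets M" unfolding A_def by measurable
  have iA: "integrable M (indicat_real A)"
    by (rule integrable_const_bound[of _ 1]) (use A in auto)
  have "\<bar>(\<integral>\<omega>. h (T \<omega>) \<partial>M) - (\<integral>\<omega>. g (T \<omega>) \<partial>M)\<bar> = \<bar>\<integral>\<omega>. h (T \<omega>) - g (T \<omega>) \<partial>M\<bar>"
    using ih ig by (simp add: Bochner_Integration.integral_diff)
  also have "\<dots> \<le> (\<integral>\<omega>. \<bar>h (T \<omega>) - g (T \<omega>)\<bar> \<partial>M)" by (rule integral_abs_bound)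
  also have "\<dots> \<le> (\<integral>\<omega>. \<delta> + (B + B') * indicator A \<omega> \<partial>M)"
  proof (rule integral_mono)
    fix \<omega> assume "\<omega> \<in> space M"
    have hg: "\<bar>h (T \<omega>) - g (T \<omega>)\<bar> \<le> B + B'"
      using h[of "T \<omega>"] g[of "T \<omega>"] by linarith
    show "\<bar>h (T \<omega>) - g (T \<omega>)\<bar> \<le> \<delta> + (B + B') * indicator A \<omega>"
    proof (cases "norm (T \<omega>) \<le> K")
      case True then show ?thesis using c[OF True] by (simp add: A_def)
    next
      case False then show ?thesis using hg \<open>0 \<le> \<delta>\<close> \<open>\<omega> \<in> space M\<close> by (simp add: A_def)
    qed
  next
    show "integrable M (\<lambda>\<omega>. \<bar>h (T \<omega>) - g (T \<omega>)\<bar>)"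
      by (intro integrable_abs Bochner_Integration.integrable_diff ih ig)
    show "integrable M (\<lambda>\<omega>. \<delta> + (B + B') * indicator A \<omega>)"
      by (intro Bochner_Integration.integrable_add integrable_mult_right iA) simp
  qed
  also have "\<dots> = \<delta> + (B + B') * prob A"
    using A by (subst Bochner_Integration.integral_add) (simp_all add: prob_space iA)
  finally show ?thesis unfolding A_def .
qed

lemma (in prob_space) tail_tendsto_0:
  fixes T :: "'a \<Rightarrow> 'b::euclidean_space"
  assumes [measurable]: "T \<in> borel_measurable M" and "0 < \<epsilon>"
  obtains K where "prob {\<omega> \<in> space M. norm (T \<omega>) > K} < \<epsilon>"
proof -
  have "(\<lambda>n. prob {\<omega> \<in> space M. norm (T \<omega>) > real n}) \<longlonglongrightarrow> prob (\<Inter>n. {\<omega> \<in> space M. norm (T \<omega>) > real n})"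
    by (intro finite_Lim_measure_decseq) (auto simp: decseq_def)
  also have "(\<Inter>n. {\<omega> \<in> space M. norm (T \<omega>) > real n}) = {}"
  proof (intro equals0I)
    fix x assume "x \<in> (\<Inter>n. {\<omega> \<in> space M. norm (T \<omega>) > real n})"
    then have "norm (T x) > real n" for n by auto
    then show False using reals_Archimedean2[of "norm (T x)"] less_asym by blast
  qed
  finally have "\<forall>\<^sub>F n in sequentially. prob {\<omega> \<in> space M. norm (T \<omega>) > real n} < \<epsilon>"
    using \<open>0 < \<epsilon>\<close> by (auto dest: order_tendstoD)
  then show thesis using that by (auto simp: eventually_sequentially)
qed

lemma borel_measurable_trig_polys: "u \<in> trig_polys \<Longrightarrow> u \<in> borel_measurable borel"
  using trig_polys_continuous by (rule borel_measurable_continuous_onI)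

lemma (in prob_space) integrable_trig_polys:
  assumes [measurable]: "T \<in> borel_measurable M" and u: "u \<in> trig_polys"
  shows "integrable M (\<lambda>\<omega>. u (T \<omega>))"
proof -
  from trig_polys_bounded[OF u] obtain R where "\<And>x. \<bar>u x\<bar> \<le> R" by auto
  then show ?thesis using borel_measurable_trig_polys[OF u] by (intro integrable_const_bound[of _ R]) auto
qed

text \<open>Tightness confines the sequence and its limit to one ball up to small mass. On this ball the
  test function is close to a trigonometric polynomial with a comparable global bound, and for
  trigonometric polynomials convergence follows from that of sines and cosines by linearity.\<close>

lemma converges_in_distribution_trig:
  fixes T :: "nat \<Rightarrow> 'a \<Rightarrow> 'b::euclidean_space"
  assumes M: "prob_space M" and T: "\<And>n. T n \<in> borel_measurable M"
    and N: "prob_space N" "sets N = sets borel"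
    and tight: "\<And>\<epsilon>. \<epsilon> > 0 \<Longrightarrow> \<exists>K. \<forall>\<^sub>F n in sequentially. measure M {\<omega> \<in> space M. norm (T n \<omega>) > K} \<le> \<epsilon>"
    and cos: "\<And>t. (\<lambda>n. \<integral>\<omega>. cos (t \<bullet> T n \<omega>) \<partial>M) \<longlonglongrightarrow> (\<integral>x. cos (t \<bullet> x) \<partial>N)"
    and sin: "\<And>t. (\<lambda>n. \<integral>\<omega>. sin (t \<bullet> T n \<omega>) \<partial>M) \<longlonglongrightarrow> (\<integral>x. sin (t \<bullet> x) \<partial>N)"
  shows "converges_in_distribution M T N"
  unfolding converges_in_distribution_def
proof (intro allI impI, elim conjE)
  interpret M: prob_space M by fact
  interpret N: prob_space N by fact
  have idN: "(\<lambda>x. x) \<in> borel_measurable N" using N(2) by (simp add: measurable_def sets_eq_imp_space_eq[OF N(2)])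
  fix h :: "'b \<Rightarrow> real" assume ch: "continuous_on UNIV h" and bh: "bounded (range h)"
  have hm: "h \<in> borel_measurable borel" using ch by (rule borel_measurable_continuous_onI)
  obtain B where B: "\<And>x. \<bar>h x\<bar> \<le> B" and "B > 0" using bh unfolding bounded_pos by auto
  have trig: "(\<lambda>n. \<integral>\<omega>. g (T n \<omega>) \<partial>M) \<longlonglongrightarrow> (\<integral>x. g x \<partial>N)" if "g \<in> trig_polys" for g
    using that
  proof induction
    case (add f g)
    note i = M.integrable_trig_polys[OF T] N.integrable_trig_polys[OF idN]
    show ?case
      using tendsto_add[OF add.IH] by (simp add: add.hyps i)
  next
    case (scale f c)
    then show ?case by (simp add: tendsto_mult_left)
  qed (fact cos sin)+
  show "(\<lambda>n. \<integral>\<omega>. h (T n \<omega>) \<partial>M) \<longlonglongrightarrow> (\<integral>x. h x \<partial>N)"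
  proof (rule LIMSEQ_I)
    fix r :: real assume "r > 0"
    \<comment> \<open>The test function is replaced twice, each time with error at most
      \<open>2 \<epsilon> + (2 B + \<epsilon>) \<epsilon> \<le> (3 + 2 B) \<epsilon>\<close>; together the errors stay below \<open>r / 4\<close>.\<close>
    define \<epsilon> where "\<epsilon> = min 1 (r / (8 * (3 + 2 * B)))"
    have \<epsilon>: "0 < \<epsilon>" "\<epsilon> \<le> 1" using \<open>r > 0\<close> \<open>B > 0\<close> by (auto simp: \<epsilon>_def)
    have "\<epsilon> * (8 * (3 + 2 * B)) \<le> r" using \<open>B > 0\<close> by (simp add: \<epsilon>_def pos_le_divide_eq[symmetric])
    moreover have "\<epsilon> * \<epsilon> \<le> \<epsilon>" using \<epsilon> by (simp add: mult_left_le)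
    ultimately have \<epsilon>r: "2 * (2 * \<epsilon> + (B + (B + \<epsilon>)) * \<epsilon>) \<le> r / 4" by (simp add: algebra_simps)
    define E where "E = 2 * \<epsilon> + (B + (B + \<epsilon>)) * \<epsilon>"
    from tight[OF \<epsilon>(1)] obtain K1 where K1: "\<forall>\<^sub>F n in sequentially. measure M {\<omega> \<in> space M. norm (T n \<omega>) > K1} \<le> \<epsilon>" ..
    from N.tail_tendsto_0[OF idN \<epsilon>(1)] obtain K2 where K2: "measure N {x\<in>space N. norm x > K2} < \<epsilon>" by blast
    define K where "K = max K1 K2"
    have "measure N {x\<in>space N. norm x > K} \<le> measure N {x\<in>space N. norm x > K2}"
      using idN by (intro N.finite_measure_mono) (auto simp: K_def)
    with K2 have KN: "measure N {x\<in>space N. norm x > K} \<le> \<epsilon>" by simp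
    have KM: "\<forall>\<^sub>F n in sequentially. measure M {\<omega> \<in> space M. norm (T n \<omega>) > K} \<le> \<epsilon>"
      using K1
    proof eventually_elim
      case (elim n)
      have "measure M {\<omega> \<in> space M. norm (T n \<omega>) > K} \<le> measure M {\<omega> \<in> space M. norm (T n \<omega>) > K1}"
        using T[of n] by (intro M.finite_measure_mono) (auto simp: K_def)
      then show ?case using elim by simp
    qed
    obtain g where g: "g \<in> trig_polys" "\<And>x. x \<in> cball 0 K \<Longrightarrow> \<bar>h x - g x\<bar> \<le> 2 * \<epsilon>" "\<And>x. \<bar>g x\<bar> \<le> B + \<epsilon>"
      using trig_polys_dense_bounded[OF compact_cball continuous_on_subset[OF ch subset_UNIV] \<epsilon>(1) B] by blast
    note gm = borel_measurable_trig_polys[OF g(1)]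
    have cl: "\<bar>h x - g x\<bar> \<le> 2 * \<epsilon>" if "norm x \<le> K" for x using g(2)[of x] that by simp
    have e0: "0 \<le> 2 * \<epsilon>" "0 \<le> B + (B + \<epsilon>)" using \<epsilon> \<open>B > 0\<close> by auto
    have "\<bar>(\<integral>x. h x \<partial>N) - (\<integral>x. g x \<partial>N)\<bar> \<le> 2 * \<epsilon> + (B + (B + \<epsilon>)) * measure N {x\<in>space N. norm x > K}"
      by (rule N.expectation_close_off_tail[OF idN hm gm B g(3) _ e0(1)]) (rule cl)
    also have "2 * \<epsilon> + (B + (B + \<epsilon>)) * measure N {x\<in>space N. norm x > K} \<le> 2 * \<epsilon> + (B + (B + \<epsilon>)) * \<epsilon>"
      by (intro add_left_mono mult_left_mono KN e0)
    finally have dN: "\<bar>(\<integral>x. h x \<partial>N) - (\<integral>x. g x \<partial>N)\<bar> \<le> 2 * \<epsilon> + (B + (B + \<epsilon>)) * \<epsilon>" .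
    have "\<forall>\<^sub>F n in sequentially. \<bar>(\<integral>\<omega>. g (T n \<omega>) \<partial>M) - (\<integral>x. g x \<partial>N)\<bar> < r / 4"
      using tendstoD[OF trig[OF g(1)], of "r/4"] \<open>r > 0\<close> by (simp add: dist_real_def)
    with KM have "\<forall>\<^sub>F n in sequentially. norm ((\<integral>\<omega>. h (T n \<omega>) \<partial>M) - (\<integral>x. h x \<partial>N)) < r"
    proof eventually_elim
      case (elim n)
      have "\<bar>(\<integral>\<omega>. h (T n \<omega>) \<partial>M) - (\<integral>\<omega>. g (T n \<omega>) \<partial>M)\<bar> \<le>
          2 * \<epsilon> + (B + (B + \<epsilon>)) * measure M {\<omega>\<in>space M. norm (T n \<omega>) > K}"
        by (rule M.expectation_close_off_tail[OF T[of n] hm gm B g(3) _ e0(1)]) (rule cl)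
      also have "2 * \<epsilon> + (B + (B + \<epsilon>)) * measure M {\<omega>\<in>space M. norm (T n \<omega>) > K} \<le> 2 * \<epsilon> + (B + (B + \<epsilon>)) * \<epsilon>"
        using elim by (intro add_left_mono mult_left_mono e0)
      finally have dM: "\<bar>(\<integral>\<omega>. h (T n \<omega>) \<partial>M) - (\<integral>\<omega>. g (T n \<omega>) \<partial>M)\<bar> \<le> E" unfolding E_def .
      have "\<bar>(\<integral>\<omega>. g (T n \<omega>) \<partial>M) - (\<integral>x. g x \<partial>N)\<bar> < r / 4" by (rule elim(2))
      then show ?case using dM dN[folded E_def] \<epsilon>r[folded E_def] \<open>r > 0\<close>
        unfolding real_norm_def abs_le_iff abs_less_iff by auto
    qed
    then show "\<exists>no. \<forall>n\<ge>no. norm ((\<integral>\<omega>. h (T n \<omega>) \<partial>M) - (\<integral>x. h x \<partial>N)) < r"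
      by (simp add: eventually_sequentially)
  qed
qed

section \<open>Laws of large numbers and the central limit theorem on the line\<close>

lemma (in prob_space) second_moment_sum_indep:
  fixes X :: "nat \<Rightarrow> 'a \<Rightarrow> real"
  assumes indep: "indep_vars (\<lambda>_. borel) X UNIV"
    and sq: "\<And>i. integrable M (\<lambda>\<omega>. (X i \<omega>)\<^sup>2)" and mean: "\<And>i. expectation (X i) = 0"
  shows "integrable M (\<lambda>\<omega>. (\<Sum>i<n. X i \<omega>)\<^sup>2) \<and>
    expectation (\<lambda>\<omega>. (\<Sum>i<n. X i \<omega>)\<^sup>2) = (\<Sum>i<n. expectation (\<lambda>\<omega>. (X i \<omega>)\<^sup>2))"
proof (induction n)
  case (Suc n)
  let ?S = "\<lambda>\<omega>. \<Sum>i<n. X i \<omega>"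
  have m: "X i \<in> borel_measurable M" for i using indep by (simp add: indep_vars_def2)
  have iX: "integrable M (X i)" for i by (rule square_integrable_imp_integrable[OF m sq])
  have iS: "integrable M ?S" using iX by simp
  have "indep_vars (\<lambda>_. borel) X (insert n {..<n})"
    using indep by (rule indep_vars_subset) auto
  then have ind: "indep_var borel (X n) borel ?S"
    by (intro indep_vars_sum) auto
  note iXS = indep_var_integrable[OF ind iX iS]
  have eq: "(\<Sum>i<Suc n. X i \<omega>)\<^sup>2 = (?S \<omega>)\<^sup>2 + 2 * (X n \<omega> * ?S \<omega>) + (X n \<omega>)\<^sup>2" for \<omega>
    by (simp add: power2_eq_square algebra_simps)
  have "expectation (\<lambda>\<omega>. X n \<omega> * ?S \<omega>) = 0"
    by (subst indep_var_lebesgue_integral[OF ind iX iS]) (simp add: mean)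
  with Suc iXS sq[of n] show ?case unfolding eq by simp
qed simp

lemma LIMSEQ_nonneg_0I:
  fixes a :: "nat \<Rightarrow> real"
  assumes "\<And>n. 0 \<le> a n" "\<And>\<eta>. \<eta> > 0 \<Longrightarrow> \<forall>\<^sub>F n in sequentially. a n < \<eta>"
  shows "a \<longlonglongrightarrow> 0"
proof (rule order_tendstoI)
  show "\<forall>\<^sub>F n in sequentially. e < a n" if "e < 0" for e
    using that assms(1) by (intro always_eventually allI) (rule less_le_trans)
qed (rule assms(2))

lemma (in prob_space) prob_union_le:
  assumes "A \<in> events" "B \<in> events" "C \<in> events" "A \<subseteq> B \<union> C"
  shows "prob A \<le> prob B + prob C"
  using finite_measure_mono[OF assms(4)] measure_Un_le[OF assms(2,3)] assms by auto

text \<open>Only a first moment is available, so the variables are truncated at a level \<open>K\<close>. The truncated and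
  centred variables are bounded and obey Chebyshev's inequality; the remainders have small mean
  absolute value and are controlled by Markov's inequality.\<close>

lemma (in prob_space) weak_law_of_large_numbers:
  fixes X :: "nat \<Rightarrow> 'a \<Rightarrow> real"
  assumes indep: "indep_vars (\<lambda>_. borel) X UNIV"
    and iid: "\<And>i. distr M borel (X i) = distr M borel (X 0)"
    and int: "integrable M (X 0)" and \<delta>: "\<delta> > 0"
  shows "(\<lambda>n. prob {\<omega> \<in> space M. \<bar>(\<Sum>i<n. X i \<omega>) / real n - expectation (X 0)\<bar> > \<delta>}) \<longlonglongrightarrow> 0"
proof (rule LIMSEQ_nonneg_0I[OF measure_nonneg])
  fix \<eta> :: real assume \<eta>: "\<eta> > 0"
  have m [measurable]: "X i \<in> borel_measurable M" for i using indep by (simp add: indep_vars_def2)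
  have transfer: "expectation (\<lambda>\<omega>. u (X i \<omega>)) = expectation (\<lambda>\<omega>. u (X 0 \<omega>))"
    if [measurable]: "u \<in> borel_measurable borel" for u :: "real \<Rightarrow> real" and i
    using integral_distr[OF m[of i] that] integral_distr[OF m[of 0] that] iid[of i] by simp
  have transfer_i: "integrable M (\<lambda>\<omega>. u (X i \<omega>)) \<longleftrightarrow> integrable M (\<lambda>\<omega>. u (X 0 \<omega>))"
    if [measurable]: "u \<in> borel_measurable borel" for u :: "real \<Rightarrow> real" and i
    using integrable_distr_eq[OF m[of i] that] integrable_distr_eq[OF m[of 0] that] iid[of i] by simp
  define tr where "tr K x = (if \<bar>x\<bar> \<le> K then x else 0)" for K x :: real
  have trm [measurable]: "tr K \<in> borel_measurable borel" for K unfolding tr_def by measurable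
  have tr_le: "\<bar>tr K x\<bar> \<le> \<bar>x\<bar>" "\<bar>x - tr K x\<bar> \<le> \<bar>x\<bar>" for K x by (auto simp: tr_def)
  have tr_K: "\<bar>tr (real n) x\<bar> \<le> real n" for n x by (auto simp: tr_def)
  have "(\<lambda>n. expectation (\<lambda>\<omega>. \<bar>X 0 \<omega> - tr (real n) (X 0 \<omega>)\<bar>)) \<longlonglongrightarrow> expectation (\<lambda>\<omega>. 0)"
  proof (rule integral_dominated_convergence[where w="\<lambda>\<omega>. \<bar>X 0 \<omega>\<bar>"])
    show "AE \<omega> in M. (\<lambda>n. \<bar>X 0 \<omega> - tr (real n) (X 0 \<omega>)\<bar>) \<longlonglongrightarrow> 0"
    proof (rule AE_I2)
      fix \<omega>
      obtain N where N: "real N > \<bar>X 0 \<omega>\<bar>" using reals_Archimedean2 by blast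
      have "\<forall>\<^sub>F n in sequentially. \<bar>X 0 \<omega> - tr (real n) (X 0 \<omega>)\<bar> = 0"
        using eventually_ge_at_top[of N]
      proof eventually_elim
        case (elim n) then have "\<bar>X 0 \<omega>\<bar> \<le> real n" using N by linarith
        then show ?case by (simp add: tr_def)
      qed
      then show "(\<lambda>n. \<bar>X 0 \<omega> - tr (real n) (X 0 \<omega>)\<bar>) \<longlonglongrightarrow> 0" by (rule tendsto_eventually)
    qed
  qed (use int tr_le in auto)
  \<comment> \<open>With mean absolute remainder below \<open>\<zeta>\<close> the truncated mean is off by at most
    \<open>\<delta> / 3\<close>, and Markov's inequality at level \<open>\<delta> / 3\<close> gives at most \<open>\<eta> / 3\<close>.\<close>
  moreover define \<zeta> where "\<zeta> = \<delta> / 3 * min 1 (\<eta> / 3)"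
  have \<zeta>: "\<zeta> > 0" "\<zeta> \<le> \<delta> / 3" "3 * \<zeta> / \<delta> \<le> \<eta> / 3"
    using \<delta> \<eta> by (auto simp: \<zeta>_def min_def field_simps)
  ultimately have "\<forall>\<^sub>F n in sequentially. expectation (\<lambda>\<omega>. \<bar>X 0 \<omega> - tr (real n) (X 0 \<omega>)\<bar>) < \<zeta>"
    by (auto dest: order_tendstoD)
  then obtain K where K: "expectation (\<lambda>\<omega>. \<bar>X 0 \<omega> - tr (real K) (X 0 \<omega>)\<bar>) < \<zeta>"
    by (auto simp: eventually_sequentially)
  define \<mu> where "\<mu> = expectation (\<lambda>\<omega>. tr (real K) (X 0 \<omega>))"
  have i_tr: "integrable M (\<lambda>\<omega>. tr (real K) (X i \<omega>))" for i
    by (rule integrable_const_bound[of _ "real K"]) (auto simp: tr_K)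
  have iX: "integrable M (X i)" for i using transfer_i[of "\<lambda>x. x" i] int by simp
  have "\<bar>expectation (X 0) - \<mu>\<bar> = \<bar>expectation (\<lambda>\<omega>. X 0 \<omega> - tr (real K) (X 0 \<omega>))\<bar>"
    using int i_tr unfolding \<mu>_def by simp
  also have "\<dots> \<le> expectation (\<lambda>\<omega>. \<bar>X 0 \<omega> - tr (real K) (X 0 \<omega>)\<bar>)" by (rule integral_abs_bound)
  finally have \<mu>: "\<bar>expectation (X 0) - \<mu>\<bar> < \<delta> / 3" using K \<zeta>(2) by linarith
  define Y where "Y i \<omega> = tr (real K) (X i \<omega>) - \<mu>" for i \<omega>
  have Yb: "\<bar>Y i \<omega>\<bar> \<le> real K + \<bar>\<mu>\<bar>" for i \<omega>
    using tr_K[of K "X i \<omega>"] unfolding Y_def by linarith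
  have Ym [measurable]: "Y i \<in> borel_measurable M" for i unfolding Y_def[abs_def] by measurable
  have Ysq_b: "(Y i \<omega>)\<^sup>2 \<le> (real K + \<bar>\<mu>\<bar>)\<^sup>2" for i \<omega>
    using Yb[of i \<omega>] by (metis abs_le_square_iff abs_of_nonneg abs_ge_zero add_nonneg_nonneg of_nat_0_le_iff)
  have Ysq: "integrable M (\<lambda>\<omega>. (Y i \<omega>)\<^sup>2)" for i
    by (rule integrable_const_bound[of _ "(real K + \<bar>\<mu>\<bar>)\<^sup>2"]) (use Ysq_b in auto)
  have Yind: "indep_vars (\<lambda>_. borel) Y UNIV"
    unfolding Y_def[abs_def] using indep by (rule indep_vars_compose2) measurable
  have Ymean: "expectation (Y i) = 0" for i
    unfolding Y_def[abs_def] using i_tr[of i] transfer[OF trm, of "real K" i] by (simp add: \<mu>_def prob_space)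
  note S2 = second_moment_sum_indep[OF Yind Ysq Ymean]
  have est: "prob {\<omega> \<in> space M. \<bar>(\<Sum>i<n. X i \<omega>) / real n - expectation (X 0)\<bar> > \<delta>} \<le>
      9 * (real K + \<bar>\<mu>\<bar>)\<^sup>2 / \<delta>\<^sup>2 / real n + \<eta> / 3" if "n > 0" for n
  proof -
    let ?A = "{\<omega> \<in> space M. \<bar>(\<Sum>i<n. X i \<omega>) / real n - expectation (X 0)\<bar> > \<delta>}"
    let ?B = "{\<omega> \<in> space M. (\<Sum>i<n. Y i \<omega>)\<^sup>2 \<ge> (real n * \<delta> / 3)\<^sup>2}"
    let ?C = "{\<omega> \<in> space M. (\<Sum>i<n. \<bar>X i \<omega> - tr (real K) (X i \<omega>)\<bar>) \<ge> real n * \<delta> / 3}"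
    have "?A \<subseteq> ?B \<union> ?C"
    proof (safe, rule ccontr)
      fix \<omega> assume \<omega>: "\<omega> \<in> space M" "\<delta> < \<bar>(\<Sum>i<n. X i \<omega>) / real n - expectation (X 0)\<bar>"
        and "\<not> (\<Sum>i<n. \<bar>X i \<omega> - tr (real K) (X i \<omega>)\<bar>) \<ge> real n * \<delta> / 3"
        and "\<not> (\<Sum>i<n. Y i \<omega>)\<^sup>2 \<ge> (real n * \<delta> / 3)\<^sup>2"
      then have c: "(\<Sum>i<n. \<bar>X i \<omega> - tr (real K) (X i \<omega>)\<bar>) < real n * \<delta> / 3"
        and b: "(\<Sum>i<n. Y i \<omega>)\<^sup>2 < (real n * \<delta> / 3)\<^sup>2" by auto
      have b': "\<bar>\<Sum>i<n. Y i \<omega>\<bar> < real n * \<delta> / 3"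
        using b \<delta> by (metis abs_le_square_iff abs_of_nonneg not_le divide_nonneg_nonneg
            mult_nonneg_nonneg of_nat_0_le_iff less_imp_le zero_le_numeral)
      have "\<bar>\<Sum>i<n. X i \<omega> - tr (real K) (X i \<omega>)\<bar> < real n * \<delta> / 3"
        using c sum_abs[of "\<lambda>i. X i \<omega> - tr (real K) (X i \<omega>)" "{..<n}"] by linarith
      moreover have "(\<Sum>i<n. X i \<omega>) = (\<Sum>i<n. X i \<omega> - tr (real K) (X i \<omega>)) + (\<Sum>i<n. Y i \<omega>) + real n * \<mu>"
        by (simp add: Y_def sum_subtractf)
      ultimately have "\<bar>(\<Sum>i<n. X i \<omega>) - real n * \<mu>\<bar> < real n * (2 * \<delta> / 3)"
        using b' by linarith
      then have "\<bar>(\<Sum>i<n. X i \<omega>) / real n - \<mu>\<bar> < 2 * \<delta> / 3"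
        using that by (simp add: field_simps abs_less_iff)
      then show False using \<omega>(2) \<mu> by linarith
    qed
    then have "prob ?A \<le> prob ?B + prob ?C" by (intro prob_union_le) auto
    also have "prob ?B \<le> expectation (\<lambda>\<omega>. (\<Sum>i<n. Y i \<omega>)\<^sup>2) / (real n * \<delta> / 3)\<^sup>2"
      using S2 that \<delta> by (intro integral_Markov_inequality_measure[where A="{}"]) auto
    also have "\<dots> \<le> (real n * (real K + \<bar>\<mu>\<bar>)\<^sup>2) / (real n * \<delta> / 3)\<^sup>2"
    proof (rule divide_right_mono)
      have "expectation (\<lambda>\<omega>. (Y i \<omega>)\<^sup>2) \<le> (real K + \<bar>\<mu>\<bar>)\<^sup>2" for i
        using integral_mono[OF Ysq[of i], of "\<lambda>_. (real K + \<bar>\<mu>\<bar>)\<^sup>2"] Ysq_b by (simp add: prob_space)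
      then have "(\<Sum>i<n. expectation (\<lambda>\<omega>. (Y i \<omega>)\<^sup>2)) \<le> (\<Sum>i<n. (real K + \<bar>\<mu>\<bar>)\<^sup>2)"
        by (intro sum_mono)
      then show "expectation (\<lambda>\<omega>. (\<Sum>i<n. Y i \<omega>)\<^sup>2) \<le> real n * (real K + \<bar>\<mu>\<bar>)\<^sup>2"
        using S2[of n] by simp
    qed simp
    also have "\<dots> = 9 * (real K + \<bar>\<mu>\<bar>)\<^sup>2 / \<delta>\<^sup>2 / real n"
      using that \<delta> by (simp add: power2_eq_square field_simps)
    also have "prob ?C \<le> expectation (\<lambda>\<omega>. \<Sum>i<n. \<bar>X i \<omega> - tr (real K) (X i \<omega>)\<bar>) / (real n * \<delta> / 3)"
      using that \<delta> iX i_tr by (intro integral_Markov_inequality_measure[where A="{}"]) (auto intro!: sum_nonneg)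
    also have "expectation (\<lambda>\<omega>. \<Sum>i<n. \<bar>X i \<omega> - tr (real K) (X i \<omega>)\<bar>) = 
        (\<Sum>i<n. expectation (\<lambda>\<omega>. \<bar>X i \<omega> - tr (real K) (X i \<omega>)\<bar>))"
      using iX i_tr by (intro Bochner_Integration.integral_sum) auto
    also have "\<dots> = (\<Sum>i<n. expectation (\<lambda>\<omega>. \<bar>X 0 \<omega> - tr (real K) (X 0 \<omega>)\<bar>))"
      by (intro sum.cong refl transfer[of "\<lambda>x. \<bar>x - tr (real K) x\<bar>"]) measurable
    also have "\<dots> / (real n * \<delta> / 3) \<le> 3 * \<zeta> / \<delta>"
      using K that \<delta> by (simp add: field_simps)
    also note \<zeta>(3)
    finally show ?thesis by simp
  qed
  have "(\<lambda>n. 9 * (real K + \<bar>\<mu>\<bar>)\<^sup>2 / \<delta>\<^sup>2 / real n) \<longlonglongrightarrow> 0"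
    by (rule lim_const_over_n)
  then have "\<forall>\<^sub>F n in sequentially. 9 * (real K + \<bar>\<mu>\<bar>)\<^sup>2 / \<delta>\<^sup>2 / real n < \<eta> / 3"
    by (rule order_tendstoD(2)) (use \<eta> in simp)
  then show "\<forall>\<^sub>F n in sequentially. prob {\<omega> \<in> space M. \<bar>(\<Sum>i<n. X i \<omega>) / real n - expectation (X 0)\<bar> > \<delta>} < \<eta>"
    using eventually_gt_at_top[of 0]
  proof eventually_elim
    case (elim n)
    then show ?case using est[of n] \<eta> by linarith
  qed
qed

text \<open>The standard deviation \<open>s\<close> moves into the test function, so that the limit needs no normal law
  other than the standard one.\<close>

lemma (in prob_space) central_limit_integral_tendsto:
  fixes \<xi> :: "nat \<Rightarrow> 'a \<Rightarrow> real"
  assumes indep: "indep_vars (\<lambda>_. borel) \<xi> UNIV"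
    and iid: "\<And>i. distr M borel (\<xi> i) = D" and mean: "\<And>i. expectation (\<xi> i) = 0"
    and sq: "\<And>i. integrable M (\<lambda>\<omega>. (\<xi> i \<omega>)\<^sup>2)" and var: "\<And>i. expectation (\<lambda>\<omega>. (\<xi> i \<omega>)\<^sup>2) = s\<^sup>2"
    and s: "s > 0" and h: "continuous_on UNIV h" "\<And>x. \<bar>h x\<bar> \<le> (B::real)"
  shows "(\<lambda>n. expectation (\<lambda>\<omega>. h ((\<Sum>i<n. \<xi> i \<omega>) / sqrt (real n)))) \<longlonglongrightarrow>
    (\<integral>z. h (s * z) \<partial>std_normal_distribution)"
proof -
  have m [measurable]: "\<xi> i \<in> borel_measurable M" for i using indep by (simp add: indep_vars_def2)
  have hm [measurable]: "h \<in> borel_measurable borel" using h(1) by (rule borel_measurable_continuous_onI)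
  let ?\<mu> = "\<lambda>n. distr M borel (\<lambda>\<omega>. (\<Sum>i<n. \<xi> i \<omega>) / sqrt (real n * s\<^sup>2))"
  have wc: "weak_conv_m ?\<mu> std_normal_distribution"
    by (rule central_limit_theorem_zero_mean[OF indep mean s sq _ iid]) (simp add: mean var)
  have c: "isCont (\<lambda>z. h (s * z)) x" for x
  proof (rule isCont_o2[where g=h])
    show "isCont (\<lambda>z. s * z) x" by (intro continuous_intros)
    show "isCont h (s * x)" using h(1) by (simp add: continuous_on_eq_continuous_at)
  qed
  have rd: "real_distribution (?\<mu> n)" for n
    by (intro real_distribution_distr) simp
  have "(\<lambda>n. \<integral>z. h (s * z) \<partial>?\<mu> n) \<longlonglongrightarrow> (\<integral>z. h (s * z) \<partial>std_normal_distribution)"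
    by (rule weak_conv_imp_integral_bdd_continuous_conv[OF rd real_dist_normal_dist wc c, of B]) (simp add: h(2))
  also have "(\<lambda>n. \<integral>z. h (s * z) \<partial>?\<mu> n) = (\<lambda>n. expectation (\<lambda>\<omega>. h ((\<Sum>i<n. \<xi> i \<omega>) / sqrt (real n))))"
    using s by (simp add: integral_distr real_sqrt_mult)
  finally show ?thesis .
qed

section \<open>Partial derivatives\<close>

lemma partial_differentiable_DERIV:
  assumes "partial_differentiable r g (\<theta> + u *\<^sub>R axis r 1)"
  shows "((\<lambda>t. g (\<theta> + t *\<^sub>R axis r 1)) has_real_derivative partial_deriv r g (\<theta> + u *\<^sub>R axis r 1)) (at u)"
proof -
  have "((\<lambda>t. g (\<theta> + u *\<^sub>R axis r 1 + t *\<^sub>R axis r 1)) has_real_derivative partial_deriv r g (\<theta> + u *\<^sub>R axis r 1)) (at 0)"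
    using assms unfolding partial_differentiable_def partial_deriv_def
    by (simp add: DERIV_deriv_iff_field_differentiable)
  moreover have "\<theta> + u *\<^sub>R axis r 1 + t *\<^sub>R axis r 1 = \<theta> + (t + u) *\<^sub>R axis r 1" for t :: real
    by (simp add: scaleR_add_left)
  ultimately show ?thesis
    using DERIV_shift[of "\<lambda>t. g (\<theta> + t *\<^sub>R axis r 1)" "partial_deriv r g (\<theta> + u *\<^sub>R axis r 1)" 0 u] by simp
qed

lemma partial_differentiable_DERIV0:
  assumes "partial_differentiable r g \<theta>"
  shows "((\<lambda>t. g (\<theta> + t *\<^sub>R axis r 1)) has_real_derivative partial_deriv r g \<theta>) (at 0)"
  using partial_differentiable_DERIV[of r g \<theta> 0] assms by simp

lemma partial_derivI:
  assumes "((\<lambda>t. g (\<theta> + t *\<^sub>R axis r 1)) has_real_derivative D) (at 0)"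
  shows "partial_differentiable r g \<theta>" "partial_deriv r g \<theta> = D"
  using assms unfolding partial_differentiable_def partial_deriv_def field_differentiable_def
  by (auto intro: DERIV_imp_deriv)

lemma partial_derivative_transform:
  assumes "open V" "\<theta> \<in> V" "\<And>\<theta>'. \<theta>' \<in> V \<Longrightarrow> g \<theta>' = g' \<theta>'" "partial_differentiable r g \<theta>"
  shows "partial_differentiable r g' \<theta> \<and> partial_deriv r g' \<theta> = partial_deriv r g \<theta>"
proof -
  have "open ((\<lambda>t::real. \<theta> + t *\<^sub>R axis r 1) -` V)"
    by (intro open_vimage assms continuous_intros)
  then have "((\<lambda>t. g' (\<theta> + t *\<^sub>R axis r 1)) has_real_derivative partial_deriv r g \<theta>) (at 0)"
    using assms by (intro has_field_derivative_transform_within_open[OF partial_differentiable_DERIV0[OF assms(4)]]) auto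
  from partial_derivI[OF this] show ?thesis by simp
qed

lemma partial_derivative_cong:
  assumes "open V" "\<theta> \<in> V" "\<And>\<theta>'. \<theta>' \<in> V \<Longrightarrow> g \<theta>' = g' \<theta>'"
  shows "partial_differentiable r g \<theta> \<longleftrightarrow> partial_differentiable r g' \<theta>" "partial_deriv r g \<theta> = partial_deriv r g' \<theta>"
proof -
  have "open ((\<lambda>t::real. \<theta> + t *\<^sub>R axis r 1) -` V)"
    by (intro open_vimage assms continuous_intros)
  then have "\<forall>\<^sub>F t in nhds 0. g (\<theta> + t *\<^sub>R axis r 1) = g' (\<theta> + t *\<^sub>R axis r 1)"
    unfolding eventually_nhds using assms by (intro exI[of _ "(\<lambda>t::real. \<theta> + t *\<^sub>R axis r 1) -` V"]) auto
  then show "partial_deriv r g \<theta> = partial_deriv r g' \<theta>" 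
    unfolding partial_deriv_def by (rule deriv_cong_ev) simp
  show "partial_differentiable r g \<theta> \<longleftrightarrow> partial_differentiable r g' \<theta>"
    using partial_derivative_transform[OF assms, where r=r]
      partial_derivative_transform[OF assms(1,2), where g=g' and g'=g and r=r] assms(3) by auto
qed

lemma partial_difference_quotient_tendsto:
  assumes "partial_differentiable r g \<theta>" "\<tau> > 0"
  shows "(\<lambda>n. (g (\<theta> + (\<tau> / real (Suc n)) *\<^sub>R axis r 1) - g \<theta>) / (\<tau> / real (Suc n))) \<longlonglongrightarrow> partial_deriv r g \<theta>"
proof -
  have t0: "(\<lambda>n. \<tau> / real (Suc n)) \<longlonglongrightarrow> 0"
    using LIMSEQ_Suc[OF lim_const_over_n[of \<tau>]] by simp
  have "filterlim (\<lambda>n. \<tau> / real (Suc n)) (at 0) sequentially"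
    using t0 assms(2) by (auto simp: filterlim_at)
  with partial_differentiable_DERIV0[OF assms(1)] show ?thesis
    unfolding has_field_derivative_iff by (auto dest: filterlim_compose)
qed

lemma axis_segment_in_open:
  assumes "open V" "\<theta> \<in> V"
  obtains \<tau> where "\<tau> > 0" "\<And>t. \<bar>t\<bar> \<le> \<tau> \<Longrightarrow> (\<theta>::real^'q::finite) + t *\<^sub>R axis r 1 \<in> V"
proof -
  obtain e where e: "e > 0" "cball \<theta> e \<subseteq> V" using assms open_contains_cball by blast
  show thesis by (rule that[of e]) (use e in \<open>auto intro!: subsetD[OF e(2)] simp: dist_norm norm_axis_1\<close>)
qed

text \<open>Walking from one point to the other along the coordinate directions, one after the other,
  the mean value theorem on each leg replaces total differentiability.\<close>

lemma increment_partial_derivs_bound: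
  fixes g :: "real^'q::finite \<Rightarrow> real"
  assumes diff: "\<And>r \<theta>'. \<theta>' \<in> ball \<theta> \<rho> \<Longrightarrow> partial_differentiable r g \<theta>'"
    and le: "\<And>r \<theta>'. \<theta>' \<in> ball \<theta> \<rho> \<Longrightarrow> \<bar>partial_deriv r g \<theta>' - D r\<bar> \<le> \<kappa>"
    and h: "norm h < \<rho>"
  shows "\<bar>g (\<theta> + h) - g \<theta> - (\<Sum>r\<in>UNIV. D r * h $ r)\<bar> \<le> \<kappa> * (\<Sum>r\<in>UNIV. \<bar>h $ r\<bar>)"
proof -
  define p where "p I = \<theta> + (\<chi> r. if r \<in> I then h $ r else 0)" for I
  have "\<bar>g (p I) - g \<theta> - (\<Sum>r\<in>I. D r * h $ r)\<bar> \<le> \<kappa> * (\<Sum>r\<in>I. \<bar>h $ r\<bar>)" for I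
  proof (induction I rule: finite_induct[OF finite])
    case 1
    have "(\<chi> r. 0) = (0::real^'q)" by (simp add: vec_eq_iff)
    then show ?case by (simp add: p_def)
  next
    case (2 r I)
    have ins: "p (insert r I) = p I + h $ r *\<^sub>R axis r 1"
      using 2 by (auto simp: p_def vec_eq_iff axis_def)
    define J where "J = closed_segment 0 (h $ r)"
    have inball: "p I + t *\<^sub>R axis r 1 \<in> ball \<theta> \<rho>" if "t \<in> J" for t
    proof -
      have t: "\<bar>t\<bar> \<le> \<bar>h $ r\<bar>" using that unfolding J_def by (auto simp: closed_segment_eq_real_ivl split: if_splits)
      have "norm ((\<chi> r. if r \<in> I then h $ r else 0) + t *\<^sub>R axis r 1) \<le> norm h"
        using t 2 by (intro norm_le_componentwise_cart) (auto simp: axis_def)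
      moreover have "\<theta> - (p I + t *\<^sub>R axis r 1) = - ((\<chi> r. if r \<in> I then h $ r else 0) + t *\<^sub>R axis r 1)"
        by (simp add: p_def)
      ultimately show ?thesis using h by (simp only: mem_ball dist_norm norm_minus_cancel)
    qed
    have d: "((\<lambda>t. g (p I + t *\<^sub>R axis r 1) - D r * t) has_real_derivative
        partial_deriv r g (p I + t *\<^sub>R axis r 1) - D r) (at t within J)" if "t \<in> J" for t
      using diff[OF inball[OF that]]
      by (auto intro!: derivative_eq_intros has_field_derivative_at_within[OF partial_differentiable_DERIV])
    have "norm ((g (p I + h $ r *\<^sub>R axis r 1) - D r * h $ r) - (g (p I + 0 *\<^sub>R axis r 1) - D r * 0)) \<le> \<kappa> * norm (h $ r - 0)"
      by (rule field_differentiable_bound[OF _ d]) (use le inball in \<open>auto simp: J_def\<close>)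
    then have "\<bar>g (p (insert r I)) - g (p I) - D r * h $ r\<bar> \<le> \<kappa> * \<bar>h $ r\<bar>"
      unfolding ins by (simp add: algebra_simps)
    moreover have "(\<Sum>r\<in>insert r I. D r * h $ r) = D r * h $ r + (\<Sum>r\<in>I. D r * h $ r)"
      "\<kappa> * (\<Sum>r\<in>insert r I. \<bar>h $ r\<bar>) = \<kappa> * \<bar>h $ r\<bar> + \<kappa> * (\<Sum>r\<in>I. \<bar>h $ r\<bar>)"
      using 2 by (simp_all add: distrib_left)
    ultimately show ?case using "2.IH" by linarith
  qed
  from this[of UNIV] show ?thesis by (simp add: p_def)
qed

text \<open>Difference quotients along one null sequence that stays in \<open>V\<close> converge for every \<open>w\<close> at once.\<close>

lemma borel_measurable_partial_deriv:
  assumes V: "open V" "\<theta> \<in> V" and m: "\<And>\<theta>'. \<theta>' \<in> V \<Longrightarrow> (\<lambda>w. g w \<theta>') \<in> borel_measurable Q"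
    and d: "\<And>w. w \<in> space Q \<Longrightarrow> partial_differentiable r (g w) \<theta>"
  shows "(\<lambda>w. partial_deriv r (g w) \<theta>) \<in> borel_measurable Q"
proof -
  obtain \<tau> where \<tau>: "\<tau> > 0" "\<And>t. \<bar>t\<bar> \<le> \<tau> \<Longrightarrow> \<theta> + t *\<^sub>R axis r 1 \<in> V"
    using axis_segment_in_open[OF V] by blast
  show ?thesis
  proof (rule borel_measurable_LIMSEQ_real)
    show "(\<lambda>n. (g w (\<theta> + (\<tau> / real (Suc n)) *\<^sub>R axis r 1) - g w \<theta>) / (\<tau> / real (Suc n))) \<longlonglongrightarrow> partial_deriv r (g w) \<theta>"
      if "w \<in> space Q" for w
      by (rule partial_difference_quotient_tendsto[OF d[OF that] \<tau>(1)])
    have "\<theta> + (\<tau> / real (Suc n)) *\<^sub>R axis r 1 \<in> V" for n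
    proof (rule \<tau>(2))
      show "\<bar>\<tau> / real (Suc n)\<bar> \<le> \<tau>" using \<tau>(1) by (simp add: divide_le_eq mult_left_le)
    qed
    then show "(\<lambda>w. (g w (\<theta> + (\<tau> / real (Suc n)) *\<^sub>R axis r 1) - g w \<theta>) / (\<tau> / real (Suc n))) \<in> borel_measurable Q" for n
      using m V(2) by (intro borel_measurable_divide borel_measurable_diff) auto
  qed
qed

text \<open>By continuity a countable dense subset of \<open>U\<close> gives the same supremum.\<close>

lemma borel_measurable_SUP_continuous:
  fixes h :: "'w \<Rightarrow> 'b::second_countable_topology \<Rightarrow> real"
  assumes U: "open U" and m: "\<And>\<theta>. \<theta> \<in> U \<Longrightarrow> (\<lambda>w. h w \<theta>) \<in> borel_measurable Q"
    and c: "\<And>w. w \<in> space Q \<Longrightarrow> continuous_on U (h w)"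
  shows "(\<lambda>w. SUP \<theta>\<in>U. ennreal \<bar>h w \<theta>\<bar>) \<in> borel_measurable Q"
proof -
  obtain D :: "'b set" where D: "countable D" "\<And>X. open X \<Longrightarrow> X \<noteq> {} \<Longrightarrow> \<exists>d\<in>D. d \<in> X"
    using countable_dense_exists by blast
  have "(SUP \<theta>\<in>U. ennreal \<bar>h w \<theta>\<bar>) = (SUP \<theta>\<in>U \<inter> D. ennreal \<bar>h w \<theta>\<bar>)" if w: "w \<in> space Q" for w
  proof (rule antisym)
    show "(SUP \<theta>\<in>U. ennreal \<bar>h w \<theta>\<bar>) \<le> (SUP \<theta>\<in>U \<inter> D. ennreal \<bar>h w \<theta>\<bar>)"
    proof (rule SUP_least, rule ccontr)
      fix \<theta> assume \<theta>: "\<theta> \<in> U" "\<not> ennreal \<bar>h w \<theta>\<bar> \<le> (SUP \<theta>\<in>U \<inter> D. ennreal \<bar>h w \<theta>\<bar>)"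
      have "continuous_on U (\<lambda>\<theta>. ennreal \<bar>h w \<theta>\<bar>)"
        using c[OF w] by (intro continuous_on_ennreal continuous_intros)
      then have "open ((\<lambda>\<theta>. ennreal \<bar>h w \<theta>\<bar>) -` {(SUP \<theta>\<in>U \<inter> D. ennreal \<bar>h w \<theta>\<bar>)<..} \<inter> U)"
        using U continuous_on_open_vimage[OF U] open_greaterThan by blast
      moreover have "\<theta> \<in> (\<lambda>\<theta>. ennreal \<bar>h w \<theta>\<bar>) -` {(SUP \<theta>\<in>U \<inter> D. ennreal \<bar>h w \<theta>\<bar>)<..} \<inter> U"
        using \<theta> by (auto simp: not_le)
      ultimately obtain d where "d \<in> D" "d \<in> U" "ennreal \<bar>h w d\<bar> > (SUP \<theta>\<in>U \<inter> D. ennreal \<bar>h w \<theta>\<bar>)"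
        using D(2) by blast
      then show False using SUP_upper[of d "U \<inter> D" "\<lambda>\<theta>. ennreal \<bar>h w \<theta>\<bar>"] by (simp add: not_le[symmetric])
    qed
  qed (rule SUP_subset_mono, auto)
  moreover have "(\<lambda>w. SUP \<theta>\<in>U \<inter> D. ennreal \<bar>h w \<theta>\<bar>) \<in> borel_measurable Q"
    using D(1) m by (intro borel_measurable_SUP) auto
  ultimately show ?thesis by (subst measurable_cong) auto
qed

lemma partial_deriv_sum:
  assumes "finite I" "\<And>i. i \<in> I \<Longrightarrow> partial_differentiable r (g i) \<theta>"
  shows "partial_differentiable r (\<lambda>\<theta>'. \<Sum>i\<in>I. g i \<theta>') \<theta> \<and>
    partial_deriv r (\<lambda>\<theta>'. \<Sum>i\<in>I. g i \<theta>') \<theta> = (\<Sum>i\<in>I. partial_deriv r (g i) \<theta>)"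
proof -
  have "((\<lambda>t. \<Sum>i\<in>I. g i (\<theta> + t *\<^sub>R axis r 1)) has_real_derivative (\<Sum>i\<in>I. partial_deriv r (g i) \<theta>)) (at 0)"
    by (intro DERIV_sum partial_differentiable_DERIV0 assms)
  from partial_derivI[OF this] show ?thesis by simp
qed

lemma partial_deriv_local_max:
  assumes V: "open V" "\<theta> \<in> V" and d: "partial_differentiable r g \<theta>" and mx: "\<And>\<theta>'. \<theta>' \<in> V \<Longrightarrow> g \<theta>' \<le> g \<theta>"
  shows "partial_deriv r g \<theta> = 0"
proof -
  obtain \<tau> where \<tau>: "\<tau> > 0" "\<And>t. \<bar>t\<bar> \<le> \<tau> \<Longrightarrow> \<theta> + t *\<^sub>R axis r 1 \<in> V"
    using axis_segment_in_open[OF V] by blast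
  show ?thesis
    by (rule DERIV_local_max[OF partial_differentiable_DERIV0[OF d] \<tau>(1)]) (use \<tau> mx in auto)
qed

text \<open>At the maximizer \<open>\<theta> + h\<close> the gradient of the sum vanishes; each summand of it is expanded at
  \<open>\<theta>\<close>. The error is linear in \<open>h\<close>, with the oscillation of the second derivatives as its coefficient.\<close>

lemma score_equation_linearized:
  fixes g :: "'i \<Rightarrow> real^'q::finite \<Rightarrow> real"
  assumes V: "open V" "ball \<theta> \<rho> \<subseteq> V" and I: "finite I"
    and smooth: "\<And>i. i \<in> I \<Longrightarrow> has_continuous_second_derivatives_on (g i) V"
    and k: "\<And>i r \<theta>'. i \<in> I \<Longrightarrow> \<theta>' \<in> ball \<theta> \<rho> \<Longrightarrow> \<bar>partial_deriv2 r s (g i) \<theta>' - partial_deriv2 r s (g i) \<theta>\<bar> \<le> k i"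
    and h: "norm h < \<rho>" and mx: "\<And>\<theta>'. \<theta>' \<in> V \<Longrightarrow> (\<Sum>i\<in>I. g i \<theta>') \<le> (\<Sum>i\<in>I. g i (\<theta> + h))"
  shows "\<bar>(\<Sum>i\<in>I. partial_deriv s (g i) \<theta>) + (\<Sum>r\<in>UNIV. (\<Sum>i\<in>I. partial_deriv2 r s (g i) \<theta>) * h $ r)\<bar>
    \<le> (\<Sum>i\<in>I. k i) * (\<Sum>r\<in>UNIV. \<bar>h $ r\<bar>)"
proof -
  have inV: "\<theta> + h \<in> V" using h V(2) by (auto simp: dist_norm)
  have d1: "partial_differentiable s (g i) \<theta>'" if "i \<in> I" "\<theta>' \<in> V" for i \<theta>'
    using smooth[OF that(1)] that(2) by (simp add: has_continuous_second_derivatives_on_def)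
  have d2: "partial_differentiable r (partial_deriv s (g i)) \<theta>'" if "i \<in> I" "\<theta>' \<in> V" for r i \<theta>'
    using smooth[OF that(1)] that(2) by (simp add: has_continuous_second_derivatives_on_def)
  have 0: "(\<Sum>i\<in>I. partial_deriv s (g i) (\<theta> + h)) = 0"
    using partial_deriv_local_max[OF V(1) inV, of s "\<lambda>\<theta>'. \<Sum>i\<in>I. g i \<theta>'"] partial_deriv_sum[OF I, of s g "\<theta> + h"] d1 inV mx
    by simp
  have "\<bar>\<Sum>i\<in>I. (partial_deriv s (g i) (\<theta> + h) - partial_deriv s (g i) \<theta> - (\<Sum>r\<in>UNIV. partial_deriv2 r s (g i) \<theta> * h $ r))\<bar>
      \<le> (\<Sum>i\<in>I. k i * (\<Sum>r\<in>UNIV. \<bar>h $ r\<bar>))"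
  proof (rule order_trans[OF sum_abs sum_mono])
    fix i assume "i \<in> I"
    then show "\<bar>partial_deriv s (g i) (\<theta> + h) - partial_deriv s (g i) \<theta> - (\<Sum>r\<in>UNIV. partial_deriv2 r s (g i) \<theta> * h $ r)\<bar>
       \<le> k i * (\<Sum>r\<in>UNIV. \<bar>h $ r\<bar>)"
      using V(2) d2 k h by (intro increment_partial_derivs_bound[where \<rho>=\<rho>]) auto
  qed
  moreover have "(\<Sum>i\<in>I. (partial_deriv s (g i) (\<theta> + h) - partial_deriv s (g i) \<theta> - (\<Sum>r\<in>UNIV. partial_deriv2 r s (g i) \<theta> * h $ r)))
    = - ((\<Sum>i\<in>I. partial_deriv s (g i) \<theta>) + (\<Sum>r\<in>UNIV. (\<Sum>i\<in>I. partial_deriv2 r s (g i) \<theta>) * h $ r))"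
    unfolding sum_subtractf 0 sum_distrib_right by (subst sum.swap) simp
  ultimately show ?thesis by (simp only: abs_minus_cancel sum_distrib_right)
qed

section \<open>Asymptotic normality of M-estimators\<close>

lemma positive_definite_invertible:
  fixes S :: "real^'n^'n::finite"
  assumes "positive_definite S" shows "invertible S"
proof -
  have "x = 0" if "S *v x = 0" for x
    using assms that unfolding positive_definite_def by (metis inner_zero_right less_irrefl)
  then show ?thesis unfolding invertible_left_inverse matrix_left_invertible_ker by blast
qed

lemma positive_definite_symmetric:
  assumes "positive_definite S" shows "S $ r $ s = S $ s $ r"
proof -
  have "transpose S = S" using assms by (simp add: positive_definite_def)
  then have "transpose S $ s $ r = S $ s $ r" by (rule arg_cong)
  then show ?thesis by (simp add: transpose_def)
qed

lemma positive_definite_inner_commute: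
  fixes S :: "real^'n^'n::finite"
  assumes "positive_definite S" shows "x \<bullet> (S *v y) = (S *v x) \<bullet> y"
proof -
  have "transpose S = S" using assms by (simp add: positive_definite_def)
  then have "S *v x = x v* S" using transpose_matrix_vector[of S x] by (simp only:)
  then show ?thesis by (simp add: dot_lmul_matrix)
qed

lemma positive_definite_matrix_inv:
  fixes S :: "real^'n^'n::finite"
  assumes S: "positive_definite S" shows "positive_definite (matrix_inv S)"
proof -
  let ?B = "matrix_inv S"
  note inv = positive_definite_invertible[OF S]
  have SB: "S ** ?B = mat 1" "?B ** S = mat 1"
    using matrix_inv_mult_left[OF inv] matrix_inv_mult_right[OF inv] by auto
  have "transpose ?B ** S = mat 1"
    using arg_cong[OF SB(1), of transpose] S by (simp add: matrix_transpose_mul positive_definite_def)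
  then have "transpose ?B = ?B" by (metis SB(1) matrix_mul_assoc matrix_mul_lid matrix_mul_rid)
  moreover have "v \<bullet> (?B *v v) > 0" if "v \<noteq> 0" for v
  proof -
    have v: "v = S *v (?B *v v)" by (simp add: matrix_vector_mul_assoc SB)
    with that have "?B *v v \<noteq> 0" by auto
    then have "(?B *v v) \<bullet> (S *v (?B *v v)) > 0" using S by (simp add: positive_definite_def)
    then show ?thesis using v by (simp add: inner_commute)
  qed
  ultimately show ?thesis by (simp add: positive_definite_def)
qed

text \<open>The matrix \<open>S\<close> is both the covariance of the gradient and minus the mean of the Hessian of the
  objective function at \<open>\<theta>\<^sub>0\<close>. This coincidence is what turns the limiting covariance
  \<open>S\<inverse> S S\<inverse>\<close> into \<open>S\<inverse>\<close>.\<close>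

locale m_estimation = prob_space M for M :: "'a measure" +
  fixes Ws :: "nat \<Rightarrow> 'a \<Rightarrow> 'w::topological_space"
    and g :: "'w \<Rightarrow> real^'q::finite \<Rightarrow> real"
    and V :: "(real^'q) set" and \<theta>\<^sub>0 :: "real^'q" and S :: "real^'q^'q"
    and \<theta>h :: "nat \<Rightarrow> 'a \<Rightarrow> real^'q"
    and Q :: "'w measure"
  assumes indep: "indep_vars (\<lambda>_. borel) Ws UNIV"
    and law: "\<And>i. distr M borel (Ws i) = Q"
    and open_V: "open V" and \<theta>\<^sub>0: "\<theta>\<^sub>0 \<in> V"
    and g_measurable: "\<And>\<theta>. \<theta> \<in> V \<Longrightarrow> (\<lambda>w. g w \<theta>) \<in> borel_measurable borel"
    and smooth: "\<And>w. has_continuous_second_derivatives_on (g w) V"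
    and dominated: "\<And>r s. (\<integral>\<^sup>+ w. (SUP \<theta>\<in>V. ennreal \<bar>partial_deriv2 r s (g w) \<theta>\<bar>) \<partial>Q) < \<infinity>"
    and score_mean: "\<And>r. (\<integral>w. partial_deriv r (g w) \<theta>\<^sub>0 \<partial>Q) = 0"
    and score_cov_integrable: "\<And>r s. integrable Q (\<lambda>w. partial_deriv r (g w) \<theta>\<^sub>0 * partial_deriv s (g w) \<theta>\<^sub>0)"
    and score_cov: "\<And>r s. (\<integral>w. partial_deriv r (g w) \<theta>\<^sub>0 * partial_deriv s (g w) \<theta>\<^sub>0 \<partial>Q) = S $ r $ s"
    and hessian_mean: "\<And>r s. (\<integral>w. partial_deriv2 r s (g w) \<theta>\<^sub>0 \<partial>Q) = - S $ r $ s"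
    and posdef: "positive_definite S"
    and estimator_measurable: "\<And>n. \<theta>h n \<in> borel_measurable M"
    and estimator_maximizes: "\<And>n. n \<ge> 1 \<Longrightarrow> AE \<omega> in M. \<forall>\<theta>\<in>V. (\<Sum>i<n. g (Ws i \<omega>) \<theta>) \<le> (\<Sum>i<n. g (Ws i \<omega>) (\<theta>h n \<omega>))"
    and consistent: "converges_in_probability M \<theta>h \<theta>\<^sub>0"
begin

lemma Ws_measurable [measurable]: "Ws i \<in> borel_measurable M"
  using indep by (simp add: indep_vars_def2)

lemma sets_Q [measurable_cong]: "sets Q = sets borel"
  using law[of 0] by (metis sets_distr)

sublocale Q: prob_space Q
  using prob_space_distr[OF Ws_measurable[of 0]] law[of 0] by simp

lemma g_partial_differentiable: "\<theta> \<in> V \<Longrightarrow> partial_differentiable s (g w) \<theta>"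
  and g_partial_differentiable2: "\<theta> \<in> V \<Longrightarrow> partial_differentiable r (partial_deriv s (g w)) \<theta>"
  and g_continuous2: "continuous_on V (partial_deriv2 r s (g w))"
  using smooth[of w] by (auto simp: has_continuous_second_derivatives_on_def)

lemma g_measurable1: "\<theta> \<in> V \<Longrightarrow> (\<lambda>w. partial_deriv s (g w) \<theta>) \<in> borel_measurable borel"
  by (rule borel_measurable_partial_deriv[OF open_V _ g_measurable g_partial_differentiable])

lemma g_measurable2: "\<theta> \<in> V \<Longrightarrow> (\<lambda>w. partial_deriv2 r s (g w) \<theta>) \<in> borel_measurable borel"
  by (rule borel_measurable_partial_deriv[OF open_V _ g_measurable1 g_partial_differentiable2])

definition score :: "'q \<Rightarrow> 'w \<Rightarrow> real" where "score s w = partial_deriv s (g w) \<theta>\<^sub>0"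
definition hess :: "'q \<Rightarrow> 'q \<Rightarrow> 'w \<Rightarrow> real" where "hess r s w = partial_deriv2 r s (g w) \<theta>\<^sub>0"
definition osc :: "'q \<Rightarrow> 'q \<Rightarrow> real \<Rightarrow> 'w \<Rightarrow> ennreal" where
  "osc r s \<rho> w = (SUP \<theta>\<in>ball \<theta>\<^sub>0 \<rho>. ennreal \<bar>partial_deriv2 r s (g w) \<theta> - partial_deriv2 r s (g w) \<theta>\<^sub>0\<bar>)"

lemma score_measurable [measurable]: "score s \<in> borel_measurable borel"
  unfolding score_def[abs_def] by (rule g_measurable1[OF \<theta>\<^sub>0])

lemma hess_measurable [measurable]: "hess r s \<in> borel_measurable borel"
  unfolding hess_def[abs_def] by (rule g_measurable2[OF \<theta>\<^sub>0])

lemma osc_measurable: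
  assumes "ball \<theta>\<^sub>0 \<rho> \<subseteq> V" shows "osc r s \<rho> \<in> borel_measurable borel"
  unfolding osc_def[abs_def]
proof (rule borel_measurable_SUP_continuous)
  show "(\<lambda>w. partial_deriv2 r s (g w) \<theta> - partial_deriv2 r s (g w) \<theta>\<^sub>0) \<in> borel_measurable borel"
    if "\<theta> \<in> ball \<theta>\<^sub>0 \<rho>" for \<theta>
    using g_measurable2 that assms \<theta>\<^sub>0 by (intro borel_measurable_diff) auto
  show "continuous_on (ball \<theta>\<^sub>0 \<rho>) (\<lambda>\<theta>. partial_deriv2 r s (g w) \<theta> - partial_deriv2 r s (g w) \<theta>\<^sub>0)" for w
    by (intro continuous_intros continuous_on_subset[OF g_continuous2 assms])
qed simp

lemma hess_integrable: "integrable Q (hess r s)"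
proof (rule integrableI_bounded)
  have "(\<integral>\<^sup>+ w. ennreal (norm (hess r s w)) \<partial>Q) \<le> (\<integral>\<^sup>+ w. (SUP \<theta>\<in>V. ennreal \<bar>partial_deriv2 r s (g w) \<theta>\<bar>) \<partial>Q)"
    unfolding hess_def by (intro nn_integral_mono) (auto intro: SUP_upper \<theta>\<^sub>0)
  then show "(\<integral>\<^sup>+ w. ennreal (norm (hess r s w)) \<partial>Q) < \<infinity>"
    using dominated[of r s] by (rule le_less_trans)
qed simp

text \<open>By continuity of the second derivatives the oscillation tends to 0 pointwise; twice their
  envelope dominates it.\<close>

lemma osc_integral_tendsto_0:
  "(\<lambda>n. \<integral>\<^sup>+ w. osc r s (\<rho> / real (Suc n)) w \<partial>Q) \<longlonglongrightarrow> 0" if \<rho>: "\<rho> > 0" "ball \<theta>\<^sub>0 \<rho> \<subseteq> V"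
proof -
  have sub: "ball \<theta>\<^sub>0 (\<rho> / real (Suc n)) \<subseteq> ball \<theta>\<^sub>0 \<rho>" for n
    using \<rho>(1) by (intro subset_ball) (simp add: divide_le_eq mult_left_le)
  let ?S = "\<lambda>w. SUP \<theta>\<in>ball \<theta>\<^sub>0 \<rho>. ennreal \<bar>partial_deriv2 r s (g w) \<theta>\<bar>"
  have Sm [measurable]: "?S \<in> borel_measurable borel"
    using \<rho>(2) g_measurable2 by (intro borel_measurable_SUP_continuous continuous_on_subset[OF g_continuous2]) auto
  have "(\<lambda>n. \<integral>\<^sup>+ w. osc r s (\<rho> / real (Suc n)) w \<partial>Q) \<longlonglongrightarrow> (\<integral>\<^sup>+ w. 0 \<partial>Q)"
  proof (rule nn_integral_dominated_convergence[where w="\<lambda>w. ?S w + ennreal \<bar>hess r s w\<bar>"])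
    show "osc r s (\<rho> / real (Suc n)) \<in> borel_measurable Q" for n
      using osc_measurable[of "\<rho> / real (Suc n)"] sub \<rho>(2) by (simp add: measurable_cong_sets[OF sets_Q refl]) blast
    show "AE w in Q. osc r s (\<rho> / real (Suc n)) w \<le> ?S w + ennreal \<bar>hess r s w\<bar>" for n
    proof (rule AE_I2, unfold osc_def, rule SUP_least)
      fix w \<theta> assume "\<theta> \<in> ball \<theta>\<^sub>0 (\<rho> / real (Suc n))"
      then have "\<theta> \<in> ball \<theta>\<^sub>0 \<rho>" using sub by blast
      then have "ennreal \<bar>partial_deriv2 r s (g w) \<theta>\<bar> \<le> ?S w" by (rule SUP_upper)
      moreover have "ennreal \<bar>partial_deriv2 r s (g w) \<theta> - partial_deriv2 r s (g w) \<theta>\<^sub>0\<bar> \<le> 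
          ennreal \<bar>partial_deriv2 r s (g w) \<theta>\<bar> + ennreal \<bar>hess r s w\<bar>"
      proof -
        have "\<bar>partial_deriv2 r s (g w) \<theta> - hess r s w\<bar> \<le> \<bar>partial_deriv2 r s (g w) \<theta>\<bar> + \<bar>hess r s w\<bar>"
          by (rule abs_triangle_ineq4)
        from ennreal_leI[OF this] show ?thesis unfolding hess_def by simp
      qed
      ultimately show "ennreal \<bar>partial_deriv2 r s (g w) \<theta> - partial_deriv2 r s (g w) \<theta>\<^sub>0\<bar> \<le> ?S w + ennreal \<bar>hess r s w\<bar>"
        by (meson add_right_mono order_trans)
    qed
    have "(\<integral>\<^sup>+ w. ?S w + ennreal \<bar>hess r s w\<bar> \<partial>Q) = (\<integral>\<^sup>+ w. ?S w \<partial>Q) + (\<integral>\<^sup>+ w. ennreal \<bar>hess r s w\<bar> \<partial>Q)"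
      by (intro nn_integral_add) measurable
    also have "\<dots> < \<infinity>"
    proof -
      have "(\<integral>\<^sup>+ w. ?S w \<partial>Q) \<le> (\<integral>\<^sup>+ w. (SUP \<theta>\<in>V. ennreal \<bar>partial_deriv2 r s (g w) \<theta>\<bar>) \<partial>Q)"
        using \<rho>(2) by (intro nn_integral_mono SUP_subset_mono) auto
      then have "(\<integral>\<^sup>+ w. ?S w \<partial>Q) < \<infinity>" using dominated[of r s] by (rule le_less_trans)
      moreover have "(\<integral>\<^sup>+ w. ennreal \<bar>hess r s w\<bar> \<partial>Q) < \<infinity>"
        using hess_integrable[of r s] by (simp add: integrable_iff_bounded)
      ultimately show ?thesis by simp
    qed
    finally show "(\<integral>\<^sup>+ w. ?S w + ennreal \<bar>hess r s w\<bar> \<partial>Q) < \<infinity>" .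
    show "AE w in Q. (\<lambda>n. osc r s (\<rho> / real (Suc n)) w) \<longlonglongrightarrow> 0"
    proof (rule AE_I2, rule order_tendstoI)
      fix w and a :: ennreal assume "0 < a"
      then obtain e where e: "e > 0" "ennreal e < a"
      proof (cases a)
        case (real x)
        then show ?thesis using that[of "x/2"] \<open>0 < a\<close> by (auto simp: ennreal_less_iff)
      next
        case top
        then show ?thesis using that[of 1] by simp
      qed
      have "isCont (partial_deriv2 r s (g w)) \<theta>\<^sub>0"
        using g_continuous2 open_V \<theta>\<^sub>0 by (simp add: continuous_on_eq_continuous_at)
      then obtain d where d: "d > 0" "\<And>\<theta>. dist \<theta> \<theta>\<^sub>0 < d \<Longrightarrow> dist (partial_deriv2 r s (g w) \<theta>) (partial_deriv2 r s (g w) \<theta>\<^sub>0) < e"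
        using e(1) unfolding continuous_at_eps_delta by blast
      have "(\<lambda>n. \<rho> / real (Suc n)) \<longlonglongrightarrow> 0" using LIMSEQ_Suc[OF lim_const_over_n[of \<rho>]] by simp
      then have "\<forall>\<^sub>F n in sequentially. \<rho> / real (Suc n) < d" using d(1) by (rule order_tendstoD)
      then show "\<forall>\<^sub>F n in sequentially. osc r s (\<rho> / real (Suc n)) w < a"
      proof eventually_elim
        case (elim n)
        have "osc r s (\<rho> / real (Suc n)) w \<le> ennreal e"
          unfolding osc_def
        proof (rule SUP_least)
          fix \<theta> assume "\<theta> \<in> ball \<theta>\<^sub>0 (\<rho> / real (Suc n))"
          then have "dist \<theta> \<theta>\<^sub>0 < d" using elim by (simp add: dist_commute)
          from d(2)[OF this] show "ennreal \<bar>partial_deriv2 r s (g w) \<theta> - partial_deriv2 r s (g w) \<theta>\<^sub>0\<bar> \<le> ennreal e"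
            by (intro ennreal_leI) (simp add: dist_real_def)
        qed
        then show ?case using e(2) by (rule le_less_trans)
      qed
    qed simp
  qed simp_all
  then show ?thesis by simp
qed

text \<open>One radius serves all pairs of indices, as there are finitely many.\<close>

lemma small_oscillation:
  assumes "\<kappa> > 0"
  obtains \<rho> where "\<rho> > 0" "ball \<theta>\<^sub>0 \<rho> \<subseteq> V" "\<And>r s. (\<integral>\<^sup>+ w. osc r s \<rho> w \<partial>Q) < ennreal \<kappa>"
proof -
  obtain \<rho> where \<rho>: "\<rho> > 0" "ball \<theta>\<^sub>0 \<rho> \<subseteq> V" using open_V \<theta>\<^sub>0 open_contains_ball by blast
  have "\<forall>\<^sub>F n in sequentially. \<forall>p\<in>(UNIV::('q\<times>'q) set). (\<integral>\<^sup>+ w. osc (fst p) (snd p) (\<rho> / real (Suc n)) w \<partial>Q) < ennreal \<kappa>"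
    by (subst eventually_ball_finite_distrib)
       (use order_tendstoD(2)[OF osc_integral_tendsto_0[OF \<rho>], of "ennreal \<kappa>"] assms in \<open>simp_all del: of_nat_Suc\<close>)
  then obtain n where n: "\<And>r s. (\<integral>\<^sup>+ w. osc r s (\<rho> / real (Suc n)) w \<partial>Q) < ennreal \<kappa>"
    by (auto simp: eventually_sequentially)
  show thesis
  proof (rule that[of "\<rho> / real (Suc n)"])
    have "ball \<theta>\<^sub>0 (\<rho> / real (Suc n)) \<subseteq> ball \<theta>\<^sub>0 \<rho>"
      using \<rho>(1) by (intro subset_ball) (simp add: divide_le_eq mult_left_le)
    then show "ball \<theta>\<^sub>0 (\<rho> / real (Suc n)) \<subseteq> V" using \<rho>(2) by blast
  qed (use \<rho> n in auto)
qed

text \<open>The normalized score and the normalized estimation error. The expansion of the score equation says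
  that \<open>U = S T\<close> up to a small multiple of \<open>|T|\<close>.\<close>

definition U :: "nat \<Rightarrow> 'a \<Rightarrow> real^'q" where
  "U n \<omega> = (1 / sqrt (real n)) *\<^sub>R (\<chi> s. \<Sum>i<n. score s (Ws i \<omega>))"

definition T :: "nat \<Rightarrow> 'a \<Rightarrow> real^'q" where
  "T n \<omega> = sqrt (real n) *\<^sub>R (\<theta>h n \<omega> - \<theta>\<^sub>0)"

lemma U_measurable [measurable]: "U n \<in> borel_measurable M"
  unfolding U_def[abs_def] by (intro borel_measurable_scaleR borel_measurable_vec_lambda) measurable

lemma T_measurable [measurable]: "T n \<in> borel_measurable M"
  unfolding T_def[abs_def] using estimator_measurable by measurable

text \<open>The expansion on a fixed sample, under conditions on the sample that will hold with probability close
  to 1. The averaged Hessian differs from \<open>- S\<close> by at most \<open>c\<close>, and its oscillation contributes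
  \<open>c\<close> again; passing from the norm of \<open>T\<close> to the sum of its components and from the components of the
  error to its norm costs a factor \<open>q\<close> each, where \<open>q\<close> is the dimension of the parameter.\<close>

lemma linearization_deterministic:
  assumes n: "n \<ge> 1" and \<rho>: "ball \<theta>\<^sub>0 \<rho> \<subseteq> V" and c: "c > 0"
    and mx: "\<forall>\<theta>\<in>V. (\<Sum>i<n. g (Ws i \<omega>) \<theta>) \<le> (\<Sum>i<n. g (Ws i \<omega>) (\<theta>h n \<omega>))"
    and fin: "\<And>i r s. osc r s \<rho> (Ws i \<omega>) < \<infinity>"
    and near: "dist (\<theta>h n \<omega>) \<theta>\<^sub>0 < \<rho>"
    and k: "(\<Sum>i<n. \<Sum>r\<in>UNIV. \<Sum>s\<in>UNIV. enn2real (osc r s \<rho> (Ws i \<omega>))) < real n * c"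
    and hs: "\<And>r s. \<bar>(\<Sum>i<n. hess r s (Ws i \<omega>)) / real n + S $ r $ s\<bar> \<le> c"
  shows "norm (U n \<omega> - S *v T n \<omega>) \<le> 2 * c * (real CARD('q))\<^sup>2 * norm (T n \<omega>)"
proof -
  let ?h = "\<theta>h n \<omega> - \<theta>\<^sub>0"
  let ?K = "\<lambda>w. \<Sum>r\<in>UNIV. \<Sum>s\<in>UNIV. enn2real (osc r s \<rho> w)"
  have sq: "sqrt (real n) > 0" "sqrt (real n) * sqrt (real n) = real n" using n by auto
  have L1: "(\<Sum>r\<in>UNIV. \<bar>x $ r\<bar>) \<le> real CARD('q) * norm x" for x :: "real^'q"
    using sum_bounded_above[of UNIV "\<lambda>r. \<bar>x $ r\<bar>" "norm x"] component_le_norm_cart[of x] by simp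
  have kb: "\<bar>partial_deriv2 r s (g w) \<theta>' - partial_deriv2 r s (g w) \<theta>\<^sub>0\<bar> \<le> ?K w"
    if "\<And>r s. osc r s \<rho> w < \<infinity>" "\<theta>' \<in> ball \<theta>\<^sub>0 \<rho>" for r s w \<theta>'
  proof -
    have "ennreal \<bar>partial_deriv2 r s (g w) \<theta>' - partial_deriv2 r s (g w) \<theta>\<^sub>0\<bar> \<le> osc r s \<rho> w"
      unfolding osc_def using that(2) by (rule SUP_upper)
    then have "\<bar>partial_deriv2 r s (g w) \<theta>' - partial_deriv2 r s (g w) \<theta>\<^sub>0\<bar> \<le> enn2real (osc r s \<rho> w)"
      using that(1)[of r s] by (metis enn2real_ennreal enn2real_mono abs_ge_zero infinity_ennreal_def)
    also have "\<dots> \<le> (\<Sum>s\<in>UNIV. enn2real (osc r s \<rho> w))"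
      by (rule member_le_sum) auto
    also have "\<dots> \<le> ?K w"
      by (rule member_le_sum[where f="\<lambda>r. \<Sum>s\<in>UNIV. enn2real (osc r s \<rho> w)"]) (auto intro: sum_nonneg)
    finally show ?thesis .
  qed
  have comp: "\<bar>(U n \<omega> - S *v T n \<omega>) $ s\<bar> \<le> 2 * c * (\<Sum>r\<in>UNIV. \<bar>T n \<omega> $ r\<bar>)" for s
  proof -
    have lin: "\<bar>(\<Sum>i<n. score s (Ws i \<omega>)) + (\<Sum>r\<in>UNIV. (\<Sum>i<n. hess r s (Ws i \<omega>)) * ?h $ r)\<bar>
        \<le> (\<Sum>i<n. ?K (Ws i \<omega>)) * (\<Sum>r\<in>UNIV. \<bar>?h $ r\<bar>)"
      unfolding score_def hess_def
      by (rule score_equation_linearized[where g="\<lambda>i. g (Ws i \<omega>)" and I="{..<n}", OF open_V \<rho> _ smooth kb])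
         (use fin near mx in \<open>auto simp: dist_norm\<close>)
    also have "\<dots> \<le> (real n * c) * (\<Sum>r\<in>UNIV. \<bar>?h $ r\<bar>)"
      using k by (intro mult_right_mono sum_nonneg) auto
    finally have lin': "\<bar>(\<Sum>i<n. score s (Ws i \<omega>)) + (\<Sum>r\<in>UNIV. (\<Sum>i<n. hess r s (Ws i \<omega>)) * ?h $ r)\<bar>
       \<le> real n * c * (\<Sum>r\<in>UNIV. \<bar>?h $ r\<bar>)" .
    have T1: "real n * (\<Sum>r\<in>UNIV. \<bar>?h $ r\<bar>) = sqrt (real n) * (\<Sum>r\<in>UNIV. \<bar>T n \<omega> $ r\<bar>)"
    proof -
      have "sqrt (real n) * (\<Sum>r\<in>UNIV. \<bar>T n \<omega> $ r\<bar>) = sqrt (real n) * (sqrt (real n) * (\<Sum>r\<in>UNIV. \<bar>?h $ r\<bar>))"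
        by (simp add: T_def abs_mult sum_distrib_left)
      then show ?thesis using sq(2) by (simp add: mult.assoc[symmetric])
    qed
    have U1: "(\<Sum>i<n. score s (Ws i \<omega>)) = sqrt (real n) * U n \<omega> $ s"
      using sq by (simp add: U_def)
    have "sqrt (real n) * (U n \<omega> - S *v T n \<omega>) $ s =
       ((\<Sum>i<n. score s (Ws i \<omega>)) + (\<Sum>r\<in>UNIV. (\<Sum>i<n. hess r s (Ws i \<omega>)) * ?h $ r))
        - (\<Sum>r\<in>UNIV. ((\<Sum>i<n. hess r s (Ws i \<omega>)) / real n + S $ r $ s) * (real n * ?h $ r))"
    proof -
      have "sqrt (real n) * (S *v T n \<omega>) $ s = (\<Sum>r\<in>UNIV. S $ r $ s * (real n * ?h $ r))"
      proof -
        have "sqrt (real n) * (S $ s $ r * T n \<omega> $ r) = S $ r $ s * (real n * ?h $ r)" for r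
        proof -
          have "sqrt (real n) * (S $ s $ r * T n \<omega> $ r) = S $ s $ r * ((sqrt (real n) * sqrt (real n)) * ?h $ r)"
            unfolding T_def vector_scaleR_component real_scaleR_def by (simp only: mult_ac)
          then show ?thesis unfolding sq(2) positive_definite_symmetric[OF posdef, of s r] .
        qed
        then show ?thesis by (simp add: matrix_vector_mult_def sum_distrib_left)
      qed
      moreover have "(\<Sum>r\<in>UNIV. ((\<Sum>i<n. hess r s (Ws i \<omega>)) / real n + S $ r $ s) * (real n * ?h $ r)) =
         (\<Sum>r\<in>UNIV. (\<Sum>i<n. hess r s (Ws i \<omega>)) * ?h $ r) + (\<Sum>r\<in>UNIV. S $ r $ s * (real n * ?h $ r))"
        using n unfolding sum.distrib[symmetric] by (intro sum.cong refl) (simp add: field_simps)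
      ultimately show ?thesis using U1 by (simp add: right_diff_distrib)
    qed
    also have "\<bar>\<dots>\<bar> \<le> real n * c * (\<Sum>r\<in>UNIV. \<bar>?h $ r\<bar>) + c * (real n * (\<Sum>r\<in>UNIV. \<bar>?h $ r\<bar>))"
    proof -
      have "\<bar>\<Sum>r\<in>UNIV. ((\<Sum>i<n. hess r s (Ws i \<omega>)) / real n + S $ r $ s) * (real n * ?h $ r)\<bar>
          \<le> (\<Sum>r\<in>UNIV. c * (real n * \<bar>?h $ r\<bar>))"
        by (rule order_trans[OF sum_abs sum_mono]) (use hs in \<open>auto simp: abs_mult intro!: mult_right_mono\<close>)
      then show ?thesis using lin' abs_triangle_ineq4 unfolding sum_distrib_left[symmetric]
        by (smt (verit))
    qed
    also have "\<dots> = sqrt (real n) * (2 * c * (\<Sum>r\<in>UNIV. \<bar>T n \<omega> $ r\<bar>))"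
      using T1 by (simp add: algebra_simps)
    finally show ?thesis using sq(1) by (simp add: abs_mult)
  qed
  have "norm (U n \<omega> - S *v T n \<omega>) \<le> (\<Sum>s\<in>UNIV. \<bar>(U n \<omega> - S *v T n \<omega>) $ s\<bar>)" by (rule norm_le_l1_cart)
  also have "\<dots> \<le> (\<Sum>s\<in>(UNIV::'q set). 2 * c * (real CARD('q) * norm (T n \<omega>)))"
    using comp L1[of "T n \<omega>"] c by (intro sum_mono) (meson mult_left_mono order_trans less_imp_le mult_nonneg_nonneg zero_le_numeral)
  finally show ?thesis by (simp add: power2_eq_square mult_ac)
qed

lemma law_distr:
  assumes [measurable]: "f \<in> borel_measurable borel"
  shows "distr M borel (\<lambda>\<omega>. f (Ws i \<omega>)) = distr Q borel f"
  unfolding law[of i, symmetric] by (subst distr_distr) (auto simp: comp_def)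

lemma law_integral:
  fixes f :: "'w \<Rightarrow> real"
  assumes [measurable]: "f \<in> borel_measurable borel"
  shows "expectation (\<lambda>\<omega>. f (Ws i \<omega>)) = (\<integral>w. f w \<partial>Q)"
  unfolding law[of i, symmetric] by (simp add: integral_distr)

lemma law_integrable:
  fixes f :: "'w \<Rightarrow> real"
  assumes [measurable]: "f \<in> borel_measurable borel"
  shows "integrable M (\<lambda>\<omega>. f (Ws i \<omega>)) \<longleftrightarrow> integrable Q f"
  unfolding law[of i, symmetric] by (simp add: integrable_distr_eq)

lemma law_AE:
  assumes "AE w in Q. P w" shows "AE \<omega> in M. P (Ws i \<omega>)"
  using assms unfolding law[of i, symmetric] by (rule AE_distrD[OF Ws_measurable])

lemma hessian_average_tendsto:
  assumes "c > 0"
  shows "(\<lambda>n. prob {\<omega> \<in> space M. \<bar>(\<Sum>i<n. hess r s (Ws i \<omega>)) / real n + S $ r $ s\<bar> > c}) \<longlonglongrightarrow> 0"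
proof -
  have E: "expectation (\<lambda>\<omega>. hess r s (Ws 0 \<omega>)) = - S $ r $ s"
    using hessian_mean[of r s] by (simp add: law_integral hess_def[abs_def, symmetric] hess_def[symmetric])
  have "(\<lambda>n. prob {\<omega> \<in> space M. \<bar>(\<Sum>i<n. hess r s (Ws i \<omega>)) / real n - expectation (\<lambda>\<omega>. hess r s (Ws 0 \<omega>))\<bar> > c}) \<longlonglongrightarrow> 0"
  proof (rule weak_law_of_large_numbers)
    show "indep_vars (\<lambda>_. borel) (\<lambda>i \<omega>. hess r s (Ws i \<omega>)) UNIV"
      using indep by (rule indep_vars_compose2) simp
    show "distr M borel (\<lambda>\<omega>. hess r s (Ws i \<omega>)) = distr M borel (\<lambda>\<omega>. hess r s (Ws 0 \<omega>))" for i
      by (simp add: law_distr)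
    show "integrable M (\<lambda>\<omega>. hess r s (Ws 0 \<omega>))" by (simp add: law_integrable hess_integrable)
  qed fact
  then show ?thesis unfolding E by simp
qed

text \<open>Outside three events the deterministic bound applies: the estimator is far from \<open>\<theta>\<^sub>0\<close>
  (consistency), the averaged oscillation is large (Markov's inequality), or an entry of the averaged
  Hessian is far from its mean (weak law of large numbers).\<close>

lemma linearization:
  assumes "\<delta> > 0"
  shows "(\<lambda>n. prob {\<omega> \<in> space M. norm (U n \<omega> - S *v T n \<omega>) > \<delta> * norm (T n \<omega>)}) \<longlonglongrightarrow> 0"
proof (rule LIMSEQ_nonneg_0I[OF measure_nonneg])
  fix \<eta> :: real assume \<eta>: "\<eta> > 0"
  define q where "q = real CARD('q)"
  have q: "q > 0" by (simp add: q_def)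
  \<comment> \<open>This makes the constant of the deterministic bound equal to \<open>\<delta>\<close>.\<close>
  define c where "c = \<delta> / (2 * q\<^sup>2)"
  have c: "c > 0" "2 * c * q\<^sup>2 = \<delta>" using \<open>\<delta> > 0\<close> q by (auto simp: c_def)
  \<comment> \<open>The \<open>q\<^sup>2\<close> oscillations have total mean at most \<open>q\<^sup>2 \<kappa>\<close>, so Markov's inequality at level
    \<open>c\<close> gives \<open>\<eta> / 3\<close>.\<close>
  define \<kappa> where "\<kappa> = c * \<eta> / (3 * q\<^sup>2)"
  have \<kappa>: "\<kappa> > 0" "q\<^sup>2 * \<kappa> / c = \<eta> / 3" using c(1) q \<eta> by (auto simp: \<kappa>_def)
  obtain \<rho> where \<rho>: "\<rho> > 0" "ball \<theta>\<^sub>0 \<rho> \<subseteq> V" and osc_small: "\<And>r s. (\<integral>\<^sup>+ w. osc r s \<rho> w \<partial>Q) < ennreal \<kappa>"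
    using small_oscillation[OF \<kappa>(1)] by blast
  note om [measurable] = osc_measurable[OF \<rho>(2)]
  define k where "k r s w = enn2real (osc r s \<rho> w)" for r s w
  have km [measurable]: "k r s \<in> borel_measurable borel" for r s unfolding k_def[abs_def] by measurable
  have k0: "k r s w \<ge> 0" for r s w by (simp add: k_def)
  have k_nn: "(\<integral>\<^sup>+ w. ennreal (k r s w) \<partial>Q) < ennreal \<kappa>" for r s
  proof -
    have "(\<integral>\<^sup>+ w. ennreal (k r s w) \<partial>Q) \<le> (\<integral>\<^sup>+ w. osc r s \<rho> w \<partial>Q)"
      unfolding k_def by (intro nn_integral_mono) (simp add: ennreal_enn2real_if)
    then show ?thesis using osc_small[of r s] by (rule le_less_trans)
  qed
  have k_int: "integrable Q (k r s)" for r s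
  proof (rule integrableI_bounded)
    have "(\<integral>\<^sup>+ w. ennreal (k r s w) \<partial>Q) < \<infinity>"
      using less_trans[OF k_nn[of r s] ennreal_less_top] by simp
    then show "(\<integral>\<^sup>+ w. ennreal (norm (k r s w)) \<partial>Q) < \<infinity>" using k0 by simp
  qed simp
  have k_E: "(\<integral>w. k r s w \<partial>Q) \<le> \<kappa>" for r s
  proof -
    have "ennreal (\<integral>w. k r s w \<partial>Q) < ennreal \<kappa>"
      using k_nn[of r s] nn_integral_eq_integral[OF k_int, of r s] k0 by simp
    then show ?thesis using \<kappa>(1) by (simp add: ennreal_less_iff integral_nonneg_AE k0)
  qed
  define K where "K w = (\<Sum>r\<in>UNIV. \<Sum>s\<in>UNIV. k r s w)" for w
  have Km [measurable]: "K \<in> borel_measurable borel" unfolding K_def[abs_def] by measurable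
  have K0: "K w \<ge> 0" for w unfolding K_def by (intro sum_nonneg k0)
  have K_int: "integrable Q K" unfolding K_def[abs_def] using k_int by simp
  have "(\<integral>w. K w \<partial>Q) = (\<Sum>r\<in>UNIV. \<Sum>s\<in>UNIV. \<integral>w. k r s w \<partial>Q)"
    unfolding K_def using k_int by simp
  also have "\<dots> \<le> (\<Sum>r\<in>(UNIV::'q set). \<Sum>s\<in>(UNIV::'q set). \<kappa>)" by (intro sum_mono k_E)
  also have "\<dots> = q\<^sup>2 * \<kappa>" by (simp add: q_def power2_eq_square)
  finally have K_E: "(\<integral>w. K w \<partial>Q) \<le> q\<^sup>2 * \<kappa>" .
  have "AE w in Q. \<forall>r s. osc r s \<rho> w < \<infinity>"
    unfolding AE_all_countable
  proof (intro allI)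
    fix r s
    have "(\<integral>\<^sup>+ w. osc r s \<rho> w \<partial>Q) \<noteq> \<infinity>"
      using osc_small[of r s] by auto
    then show "AE w in Q. osc r s \<rho> w < \<infinity>"
      using nn_integral_PInf_AE[of "osc r s \<rho>" Q] by (auto simp: top.not_eq_extremum)
  qed
  then have fin: "AE \<omega> in M. \<forall>i r s. osc r s \<rho> (Ws i \<omega>) < \<infinity>"
    unfolding AE_all_countable[where P="\<lambda>i \<omega>. \<forall>r s. osc r s \<rho> (Ws i \<omega>) < \<infinity>"] using law_AE by blast
  let ?bad = "\<lambda>n. {\<omega> \<in> space M. norm (U n \<omega> - S *v T n \<omega>) > \<delta> * norm (T n \<omega>)}"
  let ?far = "\<lambda>n. {\<omega> \<in> space M. dist (\<theta>h n \<omega>) \<theta>\<^sub>0 > \<rho> / 2}"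
  let ?osc = "\<lambda>n. {\<omega> \<in> space M. (\<Sum>i<n. K (Ws i \<omega>)) \<ge> real n * c}"
  let ?hs = "\<lambda>n p. {\<omega> \<in> space M. \<bar>(\<Sum>i<n. hess (fst p) (snd p) (Ws i \<omega>)) / real n + S $ fst p $ snd p\<bar> > c}"
  have [measurable]: "\<theta>h n \<in> borel_measurable M" for n by (rule estimator_measurable)
  have le: "prob (?bad n) \<le> prob (?far n) + \<eta> / 3 + (\<Sum>p\<in>UNIV. prob (?hs n p))" if n: "n \<ge> 1" for n
  proof -
    have sets: "?far n \<in> events" "?osc n \<in> events" "?hs n p \<in> events" for p by measurable
    have "prob (?bad n) \<le> prob (?far n \<union> (?osc n \<union> (\<Union>p\<in>UNIV. ?hs n p)))"
    proof (rule finite_measure_mono_AE)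
      show "AE \<omega> in M. \<omega> \<in> ?bad n \<longrightarrow> \<omega> \<in> ?far n \<union> (?osc n \<union> (\<Union>p\<in>UNIV. ?hs n p))"
        using estimator_maximizes[OF n] fin
      proof eventually_elim
        case (elim \<omega>)
        show ?case
        proof (rule impI, rule ccontr)
          assume bad: "\<omega> \<in> ?bad n" and "\<omega> \<notin> ?far n \<union> (?osc n \<union> (\<Union>p\<in>UNIV. ?hs n p))"
          then have far: "\<not> dist (\<theta>h n \<omega>) \<theta>\<^sub>0 > \<rho> / 2" and o: "\<not> (\<Sum>i<n. K (Ws i \<omega>)) \<ge> real n * c"
            and hs: "\<And>r s. \<not> \<bar>(\<Sum>i<n. hess r s (Ws i \<omega>)) / real n + S $ r $ s\<bar> > c" by auto
          have "norm (U n \<omega> - S *v T n \<omega>) \<le> 2 * c * (real CARD('q))\<^sup>2 * norm (T n \<omega>)"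
          proof (rule linearization_deterministic[OF n \<rho>(2) c(1) elim(1)])
            show "osc r s \<rho> (Ws i \<omega>) < \<infinity>" for i r s using elim(2) by blast
            show "dist (\<theta>h n \<omega>) \<theta>\<^sub>0 < \<rho>" using far \<rho>(1) by linarith
            show "(\<Sum>i<n. \<Sum>r\<in>UNIV. \<Sum>s\<in>UNIV. enn2real (osc r s \<rho> (Ws i \<omega>))) < real n * c"
              using o by (simp add: K_def k_def)
            show "\<bar>(\<Sum>i<n. hess r s (Ws i \<omega>)) / real n + S $ r $ s\<bar> \<le> c" for r s using hs[of r s] by simp
          qed
          then show False using bad unfolding q_def[symmetric] c(2) by simp
        qed
      qed
      show "?far n \<union> (?osc n \<union> (\<Union>p\<in>UNIV. ?hs n p)) \<in> events"
        using sets by auto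
    qed
    also have "\<dots> \<le> prob (?far n) + (prob (?osc n) + prob (\<Union>p\<in>UNIV. ?hs n p))"
      using sets by (intro order_trans[OF measure_Un_le] add_left_mono measure_Un_le) auto
    also have "prob (\<Union>p\<in>UNIV. ?hs n p) \<le> (\<Sum>p\<in>UNIV. prob (?hs n p))"
      using sets by (intro measure_UNION_le) auto
    also have "prob (?osc n) \<le> \<eta> / 3"
    proof -
      have iK: "integrable M (\<lambda>\<omega>. K (Ws i \<omega>))" for i using K_int by (simp add: law_integrable)
      have "prob (?osc n) \<le> expectation (\<lambda>\<omega>. \<Sum>i<n. K (Ws i \<omega>)) / (real n * c)"
        using iK n c(1) K0 by (intro integral_Markov_inequality_measure[where A="{}"]) (auto intro!: sum_nonneg)
      also have "expectation (\<lambda>\<omega>. \<Sum>i<n. K (Ws i \<omega>)) = real n * (\<integral>w. K w \<partial>Q)"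
        using iK by (simp add: law_integral)
      also have "real n * (\<integral>w. K w \<partial>Q) / (real n * c) \<le> q\<^sup>2 * \<kappa> / c"
        using K_E n c(1) by (simp add: divide_right_mono)
      finally show ?thesis unfolding \<kappa>(2) .
    qed
    finally show ?thesis by simp
  qed
  have "(\<lambda>n. prob (?far n) + (\<Sum>p\<in>UNIV. prob (?hs n p))) \<longlonglongrightarrow> 0 + (\<Sum>p\<in>(UNIV::('q\<times>'q) set). 0)"
  proof (intro tendsto_add tendsto_sum hessian_average_tendsto c)
    have "\<rho> / 2 > 0" using \<rho>(1) by simp
    then show "(\<lambda>n. prob (?far n)) \<longlonglongrightarrow> 0"
      using consistent unfolding converges_in_probability_def by blast
  qed
  then have "(\<lambda>n. prob (?far n) + (\<Sum>p\<in>UNIV. prob (?hs n p))) \<longlonglongrightarrow> 0" by simp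
  then have "\<forall>\<^sub>F n in sequentially. prob (?far n) + (\<Sum>p\<in>UNIV. prob (?hs n p)) < \<eta> / 3"
    by (rule order_tendstoD(2)) (use \<eta> in simp)
  then show "\<forall>\<^sub>F n in sequentially. prob (?bad n) < \<eta>"
    using eventually_ge_at_top[of 1]
  proof eventually_elim
    case (elim n)
    then show ?case using le[OF elim(2)] \<eta> by linarith
  qed
qed

lemma score_sq_integrable: "integrable Q (\<lambda>w. (score s w)\<^sup>2)"
  using score_cov_integrable[of s s] by (simp add: score_def power2_eq_square)

lemma inner_score_moments:
  defines "A w \<equiv> (\<chi> s. score s w)"
  shows "(\<integral>w. a \<bullet> A w \<partial>Q) = 0" "integrable Q (\<lambda>w. (a \<bullet> A w)\<^sup>2)" "(\<integral>w. (a \<bullet> A w)\<^sup>2 \<partial>Q) = a \<bullet> (S *v a)"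
proof -
  have i1: "integrable Q (score s)" for s
    by (rule Q.square_integrable_imp_integrable[OF _ score_sq_integrable]) simp
  have i2: "integrable Q (\<lambda>w. score r w * score s w)" for r s
    using score_cov_integrable[of r s] by (simp add: score_def)
  have aA: "a \<bullet> A w = (\<Sum>s\<in>UNIV. a $ s * score s w)" for w by (simp add: A_def inner_vec_def)
  have "(\<integral>w. score s w \<partial>Q) = 0" for s using score_mean[of s] by (simp add: score_def)
  then show "(\<integral>w. a \<bullet> A w \<partial>Q) = 0" unfolding aA using i1 by simp
  have sq: "(a \<bullet> A w)\<^sup>2 = (\<Sum>r\<in>UNIV. \<Sum>s\<in>UNIV. a $ r * a $ s * (score r w * score s w))" for w
    unfolding aA power2_eq_square sum_product by (intro sum.cong refl) (simp add: mult_ac)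
  show "integrable Q (\<lambda>w. (a \<bullet> A w)\<^sup>2)" unfolding sq using i2 by simp
  have "(\<integral>w. (a \<bullet> A w)\<^sup>2 \<partial>Q) = (\<Sum>r\<in>UNIV. \<Sum>s\<in>UNIV. a $ r * a $ s * S $ r $ s)"
    unfolding sq using i2 score_cov by (simp add: score_def)
  also have "\<dots> = a \<bullet> (S *v a)"
    by (simp add: inner_vec_def matrix_vector_mult_def sum_distrib_left mult_ac)
  finally show "(\<integral>w. (a \<bullet> A w)\<^sup>2 \<partial>Q) = a \<bullet> (S *v a)" .
qed

lemma inner_U: "a \<bullet> U n \<omega> = (\<Sum>i<n. a \<bullet> (\<chi> s. score s (Ws i \<omega>))) / sqrt (real n)"
proof -
  have "a \<bullet> (\<chi> s. \<Sum>i<n. score s (Ws i \<omega>)) = (\<Sum>i<n. a \<bullet> (\<chi> s. score s (Ws i \<omega>)))"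
    unfolding inner_sum_right[symmetric] by (rule arg_cong[where f="inner a"]) (simp add: vec_eq_iff)
  then show ?thesis by (simp add: U_def)
qed

lemma score_vec_measurable [measurable]: "(\<lambda>w. a \<bullet> (\<chi> s. score s w)) \<in> borel_measurable borel"
  by (intro borel_measurable_inner borel_measurable_vec_lambda) simp_all

lemma inner_score_indep: "indep_vars (\<lambda>_. borel) (\<lambda>i \<omega>. a \<bullet> (\<chi> s. score s (Ws i \<omega>))) UNIV"
  using indep by (rule indep_vars_compose2) measurable

lemma U_second_moment:
  assumes "n \<ge> 1"
  shows "integrable M (\<lambda>\<omega>. (a \<bullet> U n \<omega>)\<^sup>2)" "expectation (\<lambda>\<omega>. (a \<bullet> U n \<omega>)\<^sup>2) = a \<bullet> (S *v a)"
proof -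
  have 1: "integrable M (\<lambda>\<omega>. (a \<bullet> (\<chi> s. score s (Ws i \<omega>)))\<^sup>2)" for i
    using inner_score_moments(2)[of a] by (subst law_integrable[where f="\<lambda>w. (a \<bullet> (\<chi> s. score s w))\<^sup>2"]) measurable
  have 2: "expectation (\<lambda>\<omega>. a \<bullet> (\<chi> s. score s (Ws i \<omega>))) = 0" for i
    using inner_score_moments(1)[of a] by (subst law_integral[where f="\<lambda>w. a \<bullet> (\<chi> s. score s w)"]) measurable
  have 3: "expectation (\<lambda>\<omega>. (a \<bullet> (\<chi> s. score s (Ws i \<omega>)))\<^sup>2) = a \<bullet> (S *v a)" for i
    using inner_score_moments(3)[of a] by (subst law_integral[where f="\<lambda>w. (a \<bullet> (\<chi> s. score s w))\<^sup>2"]) measurable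
  note mm = second_moment_sum_indep[OF inner_score_indep, of a, OF 1 2, of n]
  show "integrable M (\<lambda>\<omega>. (a \<bullet> U n \<omega>)\<^sup>2)" unfolding inner_U power_divide using mm by simp
  show "expectation (\<lambda>\<omega>. (a \<bullet> U n \<omega>)\<^sup>2) = a \<bullet> (S *v a)"
    unfolding inner_U power_divide using mm assms by (simp add: 3)
qed

text \<open>Chebyshev's inequality; the second moment of \<open>|U|\<close> is the trace of \<open>S\<close>.\<close>

lemma U_tail:
  assumes "n \<ge> 1" "K > 0"
  shows "prob {\<omega> \<in> space M. norm (U n \<omega>) > K} \<le> (\<Sum>s\<in>UNIV. S $ s $ s) / K\<^sup>2"
proof -
  have nU: "(norm (U n \<omega>))\<^sup>2 = (\<Sum>s\<in>UNIV. (axis s 1 \<bullet> U n \<omega>)\<^sup>2)" for \<omega>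
    unfolding power2_norm_eq_inner by (simp add: inner_vec_def[of "U n \<omega>"] inner_axis' power2_eq_square)
  have i: "integrable M (\<lambda>\<omega>. (norm (U n \<omega>))\<^sup>2)" unfolding nU using U_second_moment(1)[OF assms(1)] by simp
  have "prob {\<omega> \<in> space M. norm (U n \<omega>) > K} \<le> prob {\<omega> \<in> space M. (norm (U n \<omega>))\<^sup>2 \<ge> K\<^sup>2}"
    using assms(2) by (intro finite_measure_mono) (auto intro: power_mono)
  also have "\<dots> \<le> expectation (\<lambda>\<omega>. (norm (U n \<omega>))\<^sup>2) / K\<^sup>2"
    using assms(2) i by (intro integral_Markov_inequality_measure[where A="{}"]) auto
  also have "expectation (\<lambda>\<omega>. (norm (U n \<omega>))\<^sup>2) = (\<Sum>s\<in>UNIV. axis s 1 \<bullet> (S *v axis s 1))"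
    unfolding nU using U_second_moment[OF assms(1)] by simp
  also have "\<dots> = (\<Sum>s\<in>UNIV. S $ s $ s)"
    by (simp add: inner_axis' matrix_vector_mult_basis column_def)
  finally show ?thesis .
qed

text \<open>Since \<open>T - S\<inverse> U = - S\<inverse> (U - S T)\<close>, the linearization bounds this difference by a small multiple
  of \<open>|T|\<close>. If the multiple is at most \<open>1 / 2\<close>, then \<open>|T| \<le> 2 |S\<inverse> U|\<close>, which is bounded in
  probability.\<close>

lemma estimator_close_to_linear:
  fixes \<epsilon> :: real
  defines "L \<equiv> \<lambda>n \<omega>. matrix_inv S *v U n \<omega>"
  assumes \<epsilon>: "\<epsilon> > 0"
  shows "(\<lambda>n. prob {\<omega> \<in> space M. norm (T n \<omega> - L n \<omega>) > \<epsilon>}) \<longlonglongrightarrow> 0"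
proof (rule LIMSEQ_nonneg_0I[OF measure_nonneg])
  fix \<eta> :: real assume \<eta>: "\<eta> > 0"
  note borel_measurable_matrix_vector_mult [measurable]
  obtain c where c: "c > 0" "\<And>x. norm (matrix_inv S *v x) \<le> norm x * c"
    using bounded_linear.pos_bounded[OF matrix_vector_mul_bounded_linear[of "matrix_inv S"]] by blast
  define \<tau> where "\<tau> = (\<Sum>s\<in>UNIV. S $ s $ s)"
  \<comment> \<open>The root makes the tail of \<open>U\<close> at most \<open>\<eta> / 3\<close>; the summand 1 keeps \<open>K\<close> positive.\<close>
  define K where "K = sqrt (3 * \<bar>\<tau>\<bar> / \<eta>) + 1"
  have K: "K > 0" using \<eta> by (simp add: K_def add_nonneg_pos)
  have "3 * \<bar>\<tau>\<bar> / \<eta> \<le> K\<^sup>2"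
  proof -
    have "(sqrt (3 * \<bar>\<tau>\<bar> / \<eta>))\<^sup>2 \<le> K\<^sup>2" unfolding K_def using \<eta> by (intro power_mono) auto
    then show ?thesis using \<eta> by simp
  qed
  then have \<tau>K: "\<tau> / K\<^sup>2 \<le> \<eta> / 3" using K \<eta> by (simp add: field_simps abs_le_iff)
  \<comment> \<open>The first bound lets \<open>|T|\<close> be absorbed; the second one makes the remaining error at most
    \<open>\<epsilon>\<close>, as \<open>|T| \<le> 2 c K\<close>.\<close>
  define \<delta> where "\<delta> = min (1 / (2 * c)) (\<epsilon> / (2 * c\<^sup>2 * K))"
  have \<delta>: "\<delta> > 0" "\<delta> * c \<le> 1 / 2" "2 * c\<^sup>2 * \<delta> * K \<le> \<epsilon>"
  proof -
    show "\<delta> > 0" using c(1) \<epsilon> K by (simp add: \<delta>_def)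
    have "\<delta> \<le> 1 / (2 * c)" "\<delta> \<le> \<epsilon> / (2 * c\<^sup>2 * K)" by (simp_all add: \<delta>_def)
    then show "\<delta> * c \<le> 1 / 2" "2 * c\<^sup>2 * \<delta> * K \<le> \<epsilon>" using c(1) K by (simp_all add: field_simps)
  qed
  have SB: "matrix_inv S ** S = mat 1" by (rule matrix_inv_mult_left[OF positive_definite_invertible[OF posdef]])
  have pt: "norm (T n \<omega> - L n \<omega>) \<le> \<epsilon>" if b: "norm (U n \<omega> - S *v T n \<omega>) \<le> \<delta> * norm (T n \<omega>)" and u: "norm (U n \<omega>) \<le> K" for n \<omega>
  proof -
    have "T n \<omega> - L n \<omega> = - (matrix_inv S *v (U n \<omega> - S *v T n \<omega>))"
      by (simp add: L_def matrix_vector_mult_diff_distrib matrix_vector_mul_assoc SB)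
    then have "norm (T n \<omega> - L n \<omega>) \<le> norm (U n \<omega> - S *v T n \<omega>) * c" using c(2) by simp
    also have "\<dots> \<le> (\<delta> * norm (T n \<omega>)) * c" using b c(1) by (intro mult_right_mono) auto
    finally have 1: "norm (T n \<omega> - L n \<omega>) \<le> (\<delta> * c) * norm (T n \<omega>)" by (simp add: mult_ac)
    also have "\<dots> \<le> 1 / 2 * norm (T n \<omega>)" using \<delta>(2) by (rule mult_right_mono) simp
    finally have "norm (T n \<omega>) \<le> 2 * norm (L n \<omega>)"
      using norm_triangle_sub[of "T n \<omega>" "L n \<omega>"] by linarith
    also have "norm (L n \<omega>) \<le> norm (U n \<omega>) * c" unfolding L_def by (rule c(2))
    also have "\<dots> \<le> K * c" using u c(1) by (intro mult_right_mono) auto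
    finally have "(\<delta> * c) * norm (T n \<omega>) \<le> (\<delta> * c) * (2 * (K * c))"
      using \<delta>(1) c(1) by (intro mult_left_mono) auto
    also have "\<dots> = 2 * c\<^sup>2 * \<delta> * K" by (simp add: power2_eq_square)
    finally show ?thesis using 1 \<delta>(3) by linarith
  qed
  let ?bad = "\<lambda>n. {\<omega> \<in> space M. norm (U n \<omega> - S *v T n \<omega>) > \<delta> * norm (T n \<omega>)}"
  let ?A = "\<lambda>n. {\<omega> \<in> space M. norm (T n \<omega> - L n \<omega>) > \<epsilon>}"
  have "\<forall>\<^sub>F n in sequentially. prob (?bad n) < \<eta> / 3"
    by (rule order_tendstoD(2)[OF linearization[OF \<delta>(1)]]) (use \<eta> in simp)
  then show "\<forall>\<^sub>F n in sequentially. prob (?A n) < \<eta>"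
    using eventually_ge_at_top[of 1]
  proof eventually_elim
    case (elim n)
    have "prob (?A n) \<le> prob (?bad n) + prob {\<omega> \<in> space M. norm (U n \<omega>) > K}"
    proof (rule prob_union_le)
      show "?A n \<subseteq> ?bad n \<union> {\<omega> \<in> space M. norm (U n \<omega>) > K}" using pt by (auto simp: not_le[symmetric])
    qed (unfold L_def, measurable)
    also have "prob {\<omega> \<in> space M. norm (U n \<omega>) > K} \<le> \<eta> / 3"
      using U_tail[OF elim(2) K] \<tau>K unfolding \<tau>_def by linarith
    finally show ?case using elim(1) \<eta> by linarith
  qed
qed

text \<open>By symmetry \<open>t \<bullet> S\<inverse> U = a \<bullet> U\<close> with \<open>a = S\<inverse> t\<close>, a normalized sum of independent real
  variables of variance \<open>a \<bullet> S a = t \<bullet> S\<inverse> t\<close>. The degenerate case \<open>t = 0\<close> is treated apart.\<close>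

lemma linear_part_limit:
  fixes \<phi> :: "real \<Rightarrow> real"
  assumes \<phi>: "continuous_on UNIV \<phi>" "\<And>x. \<bar>\<phi> x\<bar> \<le> 1"
  shows "(\<lambda>n. expectation (\<lambda>\<omega>. \<phi> (t \<bullet> (matrix_inv S *v U n \<omega>)))) \<longlonglongrightarrow>
    (\<integral>x. \<phi> (t \<bullet> x) \<partial>multivariate_normal 0 (matrix_inv S))"
proof (cases "t = 0")
  case True
  interpret N: prob_space "multivariate_normal 0 (matrix_inv S)"
    by (rule prob_space_multivariate_normal[OF positive_definite_matrix_inv[OF posdef]])
  show ?thesis using True by (simp add: prob_space N.prob_space)
next
  case False
  let ?B = "matrix_inv S"
  note B = positive_definite_matrix_inv[OF posdef]
  have SB: "S ** ?B = mat 1" by (rule matrix_inv_mult_right[OF positive_definite_invertible[OF posdef]])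
  define a where "a = ?B *v t"
  define \<sigma> where "\<sigma> = sqrt (t \<bullet> (?B *v t))"
  have pos: "t \<bullet> (?B *v t) > 0" using B False by (simp add: positive_definite_def)
  have aS: "a \<bullet> (S *v a) = \<sigma>\<^sup>2"
    using pos by (simp add: a_def \<sigma>_def matrix_vector_mul_assoc matrix_mul_assoc SB inner_commute)
  have tU: "t \<bullet> (?B *v U n \<omega>) = (\<Sum>i<n. a \<bullet> (\<chi> s. score s (Ws i \<omega>))) / sqrt (real n)" for n \<omega>
    unfolding positive_definite_inner_commute[OF B] a_def[symmetric] by (rule inner_U)
  let ?f = "\<lambda>w. a \<bullet> (\<chi> s. score s w)"
  have "(\<lambda>n. expectation (\<lambda>\<omega>. \<phi> ((\<Sum>i<n. ?f (Ws i \<omega>)) / sqrt (real n)))) \<longlonglongrightarrow> (\<integral>z. \<phi> (\<sigma> * z) \<partial>std_normal_distribution)"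
  proof (rule central_limit_integral_tendsto[OF inner_score_indep _ _ _ _ _ \<phi>])
    show "distr M borel (\<lambda>\<omega>. ?f (Ws i \<omega>)) = distr Q borel ?f" for i by (rule law_distr) measurable
    show "expectation (\<lambda>\<omega>. ?f (Ws i \<omega>)) = 0" for i
      using inner_score_moments(1)[of a] by (subst law_integral[where f="?f"]) measurable
    show "integrable M (\<lambda>\<omega>. (?f (Ws i \<omega>))\<^sup>2)" for i
      using inner_score_moments(2)[of a] by (subst law_integrable[where f="\<lambda>w. (?f w)\<^sup>2"]) measurable
    show "expectation (\<lambda>\<omega>. (?f (Ws i \<omega>))\<^sup>2) = \<sigma>\<^sup>2" for i
      using inner_score_moments(3)[of a] unfolding aS by (subst law_integral[where f="\<lambda>w. (?f w)\<^sup>2"]) measurable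
    show "\<sigma> > 0" using pos by (simp add: \<sigma>_def)
  qed
  also have "(\<integral>z. \<phi> (\<sigma> * z) \<partial>std_normal_distribution) = (\<integral>x. \<phi> (t \<bullet> x) \<partial>multivariate_normal 0 ?B)"
  proof -
    have [measurable]: "\<phi> \<in> borel_measurable borel" using \<phi>(1) by (rule borel_measurable_continuous_onI)
    have tm: "(\<lambda>x. t \<bullet> x) \<in> borel_measurable (multivariate_normal 0 ?B)" by (simp add: multivariate_normal_def)
    have sm: "(\<lambda>z. \<sigma> * z) \<in> borel_measurable std_normal_distribution" by simp
    show ?thesis
      using integral_distr[OF sm, of \<phi>] integral_distr[OF tm, of \<phi>]
      unfolding distr_multivariate_normal_inner[OF B False] \<sigma>_def[symmetric] by simp
  qed
  finally show ?thesis unfolding tU .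
qed

text \<open>Stated for \<open>\<phi>\<close> bounded by 1 with Lipschitz constant 1, to cover sine and cosine together; the
  Lipschitz property transfers the limit from \<open>S\<inverse> U\<close> to \<open>T\<close>.\<close>

lemma estimator_trig_limit:
  fixes \<phi> :: "real \<Rightarrow> real"
  assumes \<phi>: "continuous_on UNIV \<phi>" "\<And>x. \<bar>\<phi> x\<bar> \<le> 1" and lip: "\<And>x y. \<bar>\<phi> x - \<phi> y\<bar> \<le> \<bar>x - y\<bar>"
  shows "(\<lambda>n. expectation (\<lambda>\<omega>. \<phi> (t \<bullet> T n \<omega>))) \<longlonglongrightarrow> (\<integral>x. \<phi> (t \<bullet> x) \<partial>multivariate_normal 0 (matrix_inv S))"
proof -
  note borel_measurable_matrix_vector_mult [measurable]
  have [measurable]: "\<phi> \<in> borel_measurable borel" using \<phi>(1) by (rule borel_measurable_continuous_onI)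
  let ?L = "\<lambda>n \<omega>. matrix_inv S *v U n \<omega>"
  have iT: "integrable M (\<lambda>\<omega>. \<phi> (t \<bullet> T n \<omega>))" for n
    by (rule integrable_const_bound[of _ 1]) (auto simp: \<phi>(2))
  have iL: "integrable M (\<lambda>\<omega>. \<phi> (t \<bullet> ?L n \<omega>))" for n
    by (rule integrable_const_bound[of _ 1]) (auto simp: \<phi>(2))
  have "(\<lambda>n. expectation (\<lambda>\<omega>. \<phi> (t \<bullet> T n \<omega>)) - expectation (\<lambda>\<omega>. \<phi> (t \<bullet> ?L n \<omega>))) \<longlonglongrightarrow> 0"
  proof (rule LIMSEQ_I)
    fix \<eta> :: real assume \<eta>: "\<eta> > 0"
    \<comment> \<open>The summand 1 covers \<open>t = 0\<close>.\<close>
    define \<epsilon> where "\<epsilon> = \<eta> / (2 * (norm t + 1))"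
    have \<epsilon>: "\<epsilon> > 0" "norm t * \<epsilon> \<le> \<eta> / 2"
    proof -
      show "\<epsilon> > 0" using \<eta> by (simp add: \<epsilon>_def add_nonneg_pos)
      have "norm t + 1 > 0" by (simp add: add_nonneg_pos)
      then have "(norm t + 1) * \<epsilon> = \<eta> / 2" by (simp add: \<epsilon>_def field_simps)
      then show "norm t * \<epsilon> \<le> \<eta> / 2" using \<open>\<epsilon> > 0\<close> by (simp add: distrib_right)
    qed
    let ?A = "\<lambda>n. {\<omega> \<in> space M. norm (T n \<omega> - ?L n \<omega>) > \<epsilon>}"
    have est: "\<bar>expectation (\<lambda>\<omega>. \<phi> (t \<bullet> T n \<omega>)) - expectation (\<lambda>\<omega>. \<phi> (t \<bullet> ?L n \<omega>))\<bar> \<le> norm t * \<epsilon> + 2 * prob (?A n)" for n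
    proof -
      have Am: "?A n \<in> events" by measurable
      have iA: "integrable M (indicat_real (?A n))"
        by (rule integrable_const_bound[of _ 1]) (use Am in auto)
      have "\<bar>expectation (\<lambda>\<omega>. \<phi> (t \<bullet> T n \<omega>)) - expectation (\<lambda>\<omega>. \<phi> (t \<bullet> ?L n \<omega>))\<bar> =
         \<bar>expectation (\<lambda>\<omega>. \<phi> (t \<bullet> T n \<omega>) - \<phi> (t \<bullet> ?L n \<omega>))\<bar>"
        using iT iL by simp
      also have "\<dots> \<le> expectation (\<lambda>\<omega>. \<bar>\<phi> (t \<bullet> T n \<omega>) - \<phi> (t \<bullet> ?L n \<omega>)\<bar>)" by (rule integral_abs_bound)
      also have "\<dots> \<le> expectation (\<lambda>\<omega>. norm t * \<epsilon> + 2 * indicator (?A n) \<omega>)"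
      proof (rule integral_mono)
        show "integrable M (\<lambda>\<omega>. \<bar>\<phi> (t \<bullet> T n \<omega>) - \<phi> (t \<bullet> ?L n \<omega>)\<bar>)"
          by (intro integrable_abs Bochner_Integration.integrable_diff iT iL)
        show "integrable M (\<lambda>\<omega>. norm t * \<epsilon> + 2 * indicator (?A n) \<omega>)"
          by (intro Bochner_Integration.integrable_add integrable_mult_right iA) simp
        fix \<omega> assume \<omega>: "\<omega> \<in> space M"
        show "\<bar>\<phi> (t \<bullet> T n \<omega>) - \<phi> (t \<bullet> ?L n \<omega>)\<bar> \<le> norm t * \<epsilon> + 2 * indicator (?A n) \<omega>"
        proof (cases "norm (T n \<omega> - ?L n \<omega>) > \<epsilon>")
          case True
          have "\<bar>\<phi> (t \<bullet> T n \<omega>) - \<phi> (t \<bullet> ?L n \<omega>)\<bar> \<le> 2"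
            using \<phi>(2)[of "t \<bullet> T n \<omega>"] \<phi>(2)[of "t \<bullet> ?L n \<omega>"] by linarith
          then show ?thesis using True \<omega> \<epsilon>(1) by (simp add: add_increasing)
        next
          case False
          have "\<bar>\<phi> (t \<bullet> T n \<omega>) - \<phi> (t \<bullet> ?L n \<omega>)\<bar> \<le> \<bar>t \<bullet> (T n \<omega> - ?L n \<omega>)\<bar>"
            using lip by (simp add: inner_diff_right)
          also have "\<dots> \<le> norm t * norm (T n \<omega> - ?L n \<omega>)" by (rule Cauchy_Schwarz_ineq2)
          also have "\<dots> \<le> norm t * \<epsilon>" using False by (intro mult_left_mono) auto
          finally show ?thesis by (simp add: add_increasing2)
        qed
      qed
      also have "\<dots> = norm t * \<epsilon> + 2 * prob (?A n)"
        using Am by (subst Bochner_Integration.integral_add) (simp_all add: prob_space iA)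
      finally show ?thesis .
    qed
    have "\<forall>\<^sub>F n in sequentially. prob (?A n) < \<eta> / 4"
      by (rule order_tendstoD(2)[OF estimator_close_to_linear[OF \<epsilon>(1)]]) (use \<eta> in simp)
    then have "\<forall>\<^sub>F n in sequentially. norm (expectation (\<lambda>\<omega>. \<phi> (t \<bullet> T n \<omega>)) - expectation (\<lambda>\<omega>. \<phi> (t \<bullet> ?L n \<omega>)) - 0) < \<eta>"
    proof eventually_elim
      case (elim n)
      then show ?case using est[of n] \<epsilon>(2) unfolding real_norm_def diff_zero by linarith
    qed
    then show "\<exists>no. \<forall>n\<ge>no. norm (expectation (\<lambda>\<omega>. \<phi> (t \<bullet> T n \<omega>)) - expectation (\<lambda>\<omega>. \<phi> (t \<bullet> ?L n \<omega>)) - 0) < \<eta>"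
      by (simp add: eventually_sequentially)
  qed
  from tendsto_add[OF this linear_part_limit[OF \<phi>, of t]] show ?thesis by simp
qed

theorem asymptotic_normality:
  "converges_in_distribution M (\<lambda>n \<omega>. sqrt (real n) *\<^sub>R (\<theta>h n \<omega> - \<theta>\<^sub>0)) (multivariate_normal 0 (matrix_inv S))"
  unfolding T_def[symmetric]
proof (rule converges_in_distribution_trig)
  note borel_measurable_matrix_vector_mult [measurable]
  show "prob_space M" by unfold_locales
  show "prob_space (multivariate_normal 0 (matrix_inv S))"
    by (rule prob_space_multivariate_normal[OF positive_definite_matrix_inv[OF posdef]])
  show "sets (multivariate_normal 0 (matrix_inv S)) = sets borel" by (simp add: multivariate_normal_def)
  have lip: "\<bar>h x - h y\<bar> \<le> \<bar>x - y\<bar>" if "\<And>x. (h has_real_derivative h' x) (at x)" "\<And>x. \<bar>h' x\<bar> \<le> 1" for h h' :: "real \<Rightarrow> real" and x y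
    using field_differentiable_bound[of UNIV h h' 1 y x] that by simp
  show "(\<lambda>n. expectation (\<lambda>\<omega>. cos (t \<bullet> T n \<omega>))) \<longlonglongrightarrow> (\<integral>x. cos (t \<bullet> x) \<partial>multivariate_normal 0 (matrix_inv S))" for t
    by (rule estimator_trig_limit[OF _ abs_cos_le_one lip[of cos "\<lambda>x. - sin x"]])
       (auto intro!: continuous_intros derivative_eq_intros)
  show "(\<lambda>n. expectation (\<lambda>\<omega>. sin (t \<bullet> T n \<omega>))) \<longlonglongrightarrow> (\<integral>x. sin (t \<bullet> x) \<partial>multivariate_normal 0 (matrix_inv S))" for t
    by (rule estimator_trig_limit[OF _ abs_sin_le_one lip[of sin cos]])
       (auto intro!: continuous_intros derivative_eq_intros)
  fix \<epsilon> :: real assume \<epsilon>: "\<epsilon> > 0"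
  obtain c where c: "c > 0" "\<And>x. norm (matrix_inv S *v x) \<le> norm x * c"
    using bounded_linear.pos_bounded[OF matrix_vector_mul_bounded_linear[of "matrix_inv S"]] by blast
  let ?L = "\<lambda>n \<omega>. matrix_inv S *v U n \<omega>"
  \<comment> \<open>The sequence is tight, as \<open>|T| \<le> |T - S\<inverse> U| + c |U|\<close>, where for large \<open>n\<close> the first summand exceeds
    1, and the norm of \<open>U\<close> exceeds \<open>k\<close>, with probability at most \<open>\<epsilon> / 2\<close> each.\<close>
  have "(\<lambda>k. (\<Sum>s\<in>UNIV. S $ s $ s) / (real k)\<^sup>2) \<longlonglongrightarrow> 0"
    by (rule tendsto_divide_0[OF tendsto_const]) (auto intro!: filterlim_at_top_imp_at_infinity filterlim_pow_at_top filterlim_real_sequentially)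
  then have "\<forall>\<^sub>F k in sequentially. (\<Sum>s\<in>UNIV. S $ s $ s) / (real k)\<^sup>2 < \<epsilon> / 2"
    by (rule order_tendstoD(2)) (use \<epsilon> in simp)
  with eventually_gt_at_top[of 0] obtain k :: nat where k: "k > 0" "(\<Sum>s\<in>UNIV. S $ s $ s) / (real k)\<^sup>2 < \<epsilon> / 2"
    by (metis (mono_tags, lifting) eventually_conj eventually_happens' sequentially_bot)
  have "\<forall>\<^sub>F n in sequentially. prob {\<omega> \<in> space M. norm (T n \<omega> - ?L n \<omega>) > 1} < \<epsilon> / 2"
    by (rule order_tendstoD(2)[OF estimator_close_to_linear]) (use \<epsilon> in auto)
  then have "\<forall>\<^sub>F n in sequentially. prob {\<omega> \<in> space M. norm (T n \<omega>) > real k * c + 1} \<le> \<epsilon>"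
    using eventually_ge_at_top[of 1]
  proof eventually_elim
    case (elim n)
    have "prob {\<omega> \<in> space M. norm (T n \<omega>) > real k * c + 1} \<le>
      prob {\<omega> \<in> space M. norm (T n \<omega> - ?L n \<omega>) > 1} + prob {\<omega> \<in> space M. norm (U n \<omega>) > real k}"
    proof (rule prob_union_le)
      show "{\<omega> \<in> space M. norm (T n \<omega>) > real k * c + 1} \<subseteq> 
        {\<omega> \<in> space M. norm (T n \<omega> - ?L n \<omega>) > 1} \<union> {\<omega> \<in> space M. norm (U n \<omega>) > real k}"
      proof (safe, rule ccontr)
        fix \<omega> assume "real k * c + 1 < norm (T n \<omega>)" "\<not> real k < norm (U n \<omega>)" "\<not> 1 < norm (T n \<omega> - ?L n \<omega>)"
        moreover have "norm (U n \<omega>) * c \<le> real k * c" if "norm (U n \<omega>) \<le> real k"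
          using that c(1) by (intro mult_right_mono) auto
        ultimately show False
          using c(2)[of "U n \<omega>"] norm_triangle_sub[of "T n \<omega>" "?L n \<omega>"] by linarith
      qed
    qed measurable
    also have "prob {\<omega> \<in> space M. norm (U n \<omega>) > real k} \<le> \<epsilon> / 2"
      using order_trans[OF U_tail[OF elim(2), of "real k"] less_imp_le[OF k(2)]] k(1) by simp
    finally show ?case using elim(1) by simp
  qed
  then show "\<exists>K. \<forall>\<^sub>F n in sequentially. prob {\<omega> \<in> space M. norm (T n \<omega>) > K} \<le> \<epsilon>" by blast
qed measurable

end

section \<open>The joint law of covariate, censoring time and response\<close>

text \<open>Rectangles are closed under intersection and generate the product.\<close>

lemma finite_measure_eqI_rectangles:
  assumes "finite_measure \<mu>" and sets: "sets \<mu> = sets (A \<Otimes>\<^sub>M B)" "sets \<mu>' = sets (A \<Otimes>\<^sub>M B)"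
    and eq: "\<And>a b. a \<in> sets A \<Longrightarrow> b \<in> sets B \<Longrightarrow> emeasure \<mu> (a \<times> b) = emeasure \<mu>' (a \<times> b)"
  shows "\<mu> = \<mu>'"
proof -
  interpret finite_measure \<mu> by fact
  let ?E = "{a \<times> b | a b. a \<in> sets A \<and> b \<in> sets B}"
  show ?thesis
  proof (rule measure_eqI_generator_eq[where E="?E" and \<Omega>="space A \<times> space B" and A="\<lambda>_. space A \<times> space B"])
    show "Int_stable ?E" by (rule Int_stable_pair_measure_generator)
    show "?E \<subseteq> Pow (space A \<times> space B)" by (rule pair_measure_closed)
    show "\<And>R. R \<in> ?E \<Longrightarrow> emeasure \<mu> R = emeasure \<mu>' R" using eq by auto
    show "sets \<mu> = sigma_sets (space A \<times> space B) ?E" "sets \<mu>' = sigma_sets (space A \<times> space B) ?E"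
      unfolding sets by (rule sets_pair_measure)+
  qed (auto simp: emeasure_eq_measure)
qed

lemma sigma_generated_subalgebra:
  assumes "T \<in> borel_measurable M"
  shows "subalgebra M (sigma_generated M T)"
  unfolding subalgebra_def sigma_generated_def
  using assms by (auto simp: sets_vimage_algebra2 measurable_def)

lemma (in prob_space) sigma_finite_subalgebra_generated:
  assumes "T \<in> borel_measurable M"
  shows "sigma_finite_subalgebra M (sigma_generated M T)"
proof -
  interpret finite_measure_subalgebra M "sigma_generated M T"
    by unfold_locales (rule sigma_generated_subalgebra[OF assms])
  show ?thesis by unfold_locales
qed

lemma measurable_sigma_generated:
  assumes "T \<in> borel_measurable M" "u \<in> borel_measurable borel"
  shows "(\<lambda>\<omega>. u (T \<omega>)) \<in> borel_measurable (sigma_generated M T)"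
  unfolding sigma_generated_def
  by (rule measurable_compose[OF measurable_vimage_algebra1 assms(2)]) (use assms(1) in \<open>auto simp: measurable_def\<close>)

abbreviation borel2 :: "('b::topological_space \<times> real) measure" where
  "borel2 \<equiv> borel \<Otimes>\<^sub>M borel"

abbreviation borel3 :: "(('b::topological_space \<times> real) \<times> real) measure" where
  "borel3 \<equiv> borel2 \<Otimes>\<^sub>M borel"

text \<open>The law of \<open>(X, C, Y)\<close> at the true parameter, without reference to the family; \<open>k x\<close> is the
  conditional density of \<open>Y\<close> given \<open>X = x\<close>.\<close>

locale conditional_model = prob_space M for M :: "'a measure" +
  fixes X :: "'a \<Rightarrow> 'b::second_countable_topology" and Y C :: "'a \<Rightarrow> real"
    and \<nu> :: "real measure" and k :: "'b \<Rightarrow> real \<Rightarrow> real" and G :: "'b \<Rightarrow> real measure"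
  assumes rv [measurable]: "X \<in> borel_measurable M" "Y \<in> borel_measurable M" "C \<in> borel_measurable M"
    and sigma_finite: "sigma_finite_measure \<nu>" and sets_\<nu> [measurable_cong]: "sets \<nu> = sets borel"
    and \<nu>_neg: "emeasure \<nu> {..<0} = 0"
    and k_measurable: "(\<lambda>(x, y). k x y) \<in> borel_measurable borel"
    and k_pos: "\<And>x y. y \<ge> 0 \<Longrightarrow> k x y > 0"
    and k_prob: "\<And>x. (\<integral>y. k x y \<partial>\<nu>) = 1"
    and independent: "cond_independent M X Y C"
    and density_Y: "has_cond_density M X Y \<nu> k"
    and cdf_C: "has_cond_cdf M X C G"
begin

sublocale \<nu>: sigma_finite_measure \<nu> by (rule sigma_finite)

lemma k_pair [measurable]: "(\<lambda>(x, y). k x y) \<in> borel_measurable borel2"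
  using k_measurable by (simp add: borel_prod)

lemma k_comp [measurable (raw)]:
  assumes "u \<in> borel_measurable L" "v \<in> borel_measurable L"
  shows "(\<lambda>l. k (u l) (v l)) \<in> borel_measurable L"
  using measurable_compose[OF measurable_Pair[OF assms] k_pair] by simp

lemma AE_\<nu>_nonneg: "AE y in \<nu>. 0 \<le> y"
  by (rule AE_I[of _ _ "{..<0}"]) (use \<nu>_neg in \<open>auto simp: sets_eq_imp_space_eq[OF sets_\<nu>] sets_\<nu>\<close>)

lemma AE_k_pos: "AE y in \<nu>. 0 < k x y"
  using AE_\<nu>_nonneg by eventually_elim (rule k_pos)

lemma k_integrable: "integrable \<nu> (k x)"
  using k_prob[of x] not_integrable_integral_eq[of \<nu> "k x"] by fastforce

lemma k_set_integrable: "A \<in> sets borel \<Longrightarrow> integrable \<nu> (\<lambda>y. indicator A y * k x y)"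
  using integrable_mult_indicator[OF _ k_integrable[of x], of A] sets_\<nu> by simp

text \<open>The conditional probability of \<open>Y \<in> A\<close> given \<open>X = x\<close>.\<close>

definition pY :: "real set \<Rightarrow> 'b \<Rightarrow> real" where "pY A x = (LINT y:A|\<nu>. k x y)"

lemma pY_eq: "pY A x = (\<integral>y. indicator A y * k x y \<partial>\<nu>)"
  by (simp add: pY_def set_lebesgue_integral_def)

lemma pY_measurable: "A \<in> sets borel \<Longrightarrow> pY A \<in> borel_measurable borel"
  unfolding pY_eq[abs_def] by (intro \<nu>.borel_measurable_lebesgue_integral) (simp add: split_beta')

lemma nn_integral_pY: "A \<in> sets borel \<Longrightarrow> (\<integral>\<^sup>+y. indicator A y * ennreal (k x y) \<partial>\<nu>) = ennreal (pY A x)"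
proof -
  assume A: "A \<in> sets borel"
  have "(\<integral>\<^sup>+y. indicator A y * ennreal (k x y) \<partial>\<nu>) = (\<integral>\<^sup>+y. ennreal (indicator A y * k x y) \<partial>\<nu>)"
    by (intro nn_integral_cong) (simp add: indicator_def)
  also have "\<dots> = ennreal (pY A x)"
    unfolding pY_eq using AE_k_pos[of x] by (intro nn_integral_eq_integral k_set_integrable[OF A]) auto
  finally show ?thesis .
qed

lemma pY_bounds: "A \<in> sets borel \<Longrightarrow> 0 \<le> pY A x \<and> pY A x \<le> 1"
proof
  assume A: "A \<in> sets borel"
  show "0 \<le> pY A x" unfolding pY_eq using AE_k_pos[of x] by (intro integral_nonneg_AE) auto
  have "pY A x \<le> (\<integral>y. k x y \<partial>\<nu>)"
    unfolding pY_eq using AE_k_pos[of x] k_set_integrable[OF A] k_integrable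
    by (intro integral_mono_AE) (auto simp: indicator_def)
  then show "pY A x \<le> 1" by (simp add: k_prob)
qed

abbreviation XC :: "'a \<Rightarrow> 'b \<times> real" where "XC \<omega> \<equiv> (X \<omega>, C \<omega>)"

definition PXC :: "('b \<times> real) measure" where "PXC = distr M borel2 XC"

lemma sets_PXC [measurable_cong]: "sets PXC = sets borel2" by (simp add: PXC_def)

lemma XC_measurable [measurable]: "XC \<in> M \<rightarrow>\<^sub>M borel2" by measurable

sublocale PXC: prob_space PXC unfolding PXC_def by (rule prob_space_distr) measurable

sublocale PXC_\<nu>: pair_sigma_finite PXC \<nu> by unfold_locales

text \<open>Conditioning on \<open>X\<close> turns the product of the two indicators into the product of their
  conditional expectations, by conditional independence. The first one is \<open>pY A (X)\<close>, a function of
  \<open>X\<close>, so the conditioning can be undone in the second.\<close>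

lemma rectangle_expectation:
  assumes [measurable]: "A \<in> sets borel" "B \<in> sets borel" "D \<in> sets borel"
  shows "expectation (\<lambda>\<omega>. indicator D (X \<omega>) * (indicator A (Y \<omega>) * indicator B (C \<omega>))) =
    expectation (\<lambda>\<omega>. indicator D (X \<omega>) * pY A (X \<omega>) * indicator B (C \<omega>))"
proof -
  let ?F = "sigma_generated M X"
  interpret F: sigma_finite_subalgebra M ?F by (rule sigma_finite_subalgebra_generated) simp
  have pYm [measurable]: "pY A \<in> borel_measurable borel" by (rule pY_measurable) simp
  have mD: "(\<lambda>\<omega>. indicat_real D (X \<omega>)) \<in> borel_measurable ?F"
    by (rule measurable_sigma_generated) simp_all
  have mDk: "(\<lambda>\<omega>. indicat_real D (X \<omega>) * pY A (X \<omega>)) \<in> borel_measurable ?F"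
    by (rule measurable_sigma_generated[where u="\<lambda>x. indicat_real D x * pY A x"]) simp_all
  have i1: "integrable M (\<lambda>\<omega>. indicat_real D (X \<omega>) * (indicator A (Y \<omega>) * indicator B (C \<omega>)))"
    by (rule integrable_const_bound[of _ 1]) (auto simp: indicator_def)
  have i2: "integrable M (\<lambda>\<omega>. (indicat_real D (X \<omega>) * pY A (X \<omega>)) * indicat_real B (C \<omega>))"
    by (rule integrable_const_bound[of _ 1]) (use pY_bounds[of A] in \<open>auto simp: indicator_def\<close>)
  let ?ceA = "cond_exp_given M X (\<lambda>\<omega>. indicat_real A (Y \<omega>))"
  let ?ceB = "cond_exp_given M X (\<lambda>\<omega>. indicat_real B (C \<omega>))"
  let ?ceAB = "cond_exp_given M X (\<lambda>\<omega>. indicat_real A (Y \<omega>) * indicat_real B (C \<omega>))"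
  have "expectation (\<lambda>\<omega>. indicator D (X \<omega>) * (indicator A (Y \<omega>) * indicator B (C \<omega>))) =
      expectation (\<lambda>\<omega>. indicat_real D (X \<omega>) * ?ceAB \<omega>)"
    unfolding cond_exp_given_def by (rule F.real_cond_exp_intg(2)[OF i1 mD, symmetric]) measurable
  also have "\<dots> = expectation (\<lambda>\<omega>. (indicat_real D (X \<omega>) * pY A (X \<omega>)) * ?ceB \<omega>)"
  proof (rule integral_cong_AE)
    have "AE \<omega> in M. ?ceAB \<omega> = ?ceA \<omega> * ?ceB \<omega>"
      using independent assms unfolding cond_independent_def by blast
    moreover have "AE \<omega> in M. ?ceA \<omega> = pY A (X \<omega>)"
      using density_Y assms unfolding has_cond_density_def pY_def by blast
    ultimately show "AE \<omega> in M. indicat_real D (X \<omega>) * ?ceAB \<omega> = (indicat_real D (X \<omega>) * pY A (X \<omega>)) * ?ceB \<omega>"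
      by eventually_elim simp
  qed (unfold cond_exp_given_def, measurable)
  also have "\<dots> = expectation (\<lambda>\<omega>. (indicat_real D (X \<omega>) * pY A (X \<omega>)) * indicat_real B (C \<omega>))"
    unfolding cond_exp_given_def by (rule F.real_cond_exp_intg(2)[OF i2 mDk]) measurable
  finally show ?thesis .
qed

text \<open>The rectangles of the previous lemma determine the law of \<open>(X, C)\<close> on the event \<open>Y \<in> A\<close>.\<close>

lemma joint_law_slice:
  assumes A [measurable]: "A \<in> sets borel"
  shows "distr (density M (\<lambda>\<omega>. indicator A (Y \<omega>))) borel2 XC = density PXC (\<lambda>p. ennreal (pY A (fst p)))"
proof (rule finite_measure_eqI_rectangles[where A=borel and B=borel])
  have [measurable]: "pY A \<in> borel_measurable borel" by (rule pY_measurable) simp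
  let ?\<mu> = "distr (density M (\<lambda>\<omega>. indicator A (Y \<omega>))) borel2 XC"
  show "finite_measure ?\<mu>"
  proof (intro finite_measure.finite_measure_distr finite_measureI)
    have "(\<integral>\<^sup>+\<omega>. indicator A (Y \<omega>) * indicator (space M) \<omega> \<partial>M) \<le> (\<integral>\<^sup>+\<omega>. 1 \<partial>M)"
      by (intro nn_integral_mono) (simp add: indicator_def)
    also have "\<dots> = 1" by (simp add: emeasure_space_1)
    finally have "(\<integral>\<^sup>+\<omega>. indicator A (Y \<omega>) * indicator (space M) \<omega> \<partial>M) \<noteq> \<infinity>"
      by (auto simp: top_unique)
    then show "emeasure (density M (\<lambda>\<omega>. indicator A (Y \<omega>))) (space (density M (\<lambda>\<omega>. indicator A (Y \<omega>)))) \<noteq> \<infinity>"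
      by (subst emeasure_density) simp_all
  qed simp
  fix D :: "'b set" and B :: "real set" assume [measurable]: "D \<in> sets borel" "B \<in> sets borel"
  have i1: "integrable M (\<lambda>\<omega>. indicat_real D (X \<omega>) * (indicator A (Y \<omega>) * indicator B (C \<omega>)))"
    by (rule integrable_const_bound[of _ 1]) (auto simp: indicator_def)
  have i2: "integrable M (\<lambda>\<omega>. indicat_real D (X \<omega>) * pY A (X \<omega>) * indicat_real B (C \<omega>))"
    by (rule integrable_const_bound[of _ 1]) (use pY_bounds[of A] in \<open>auto simp: indicator_def\<close>)
  have "emeasure ?\<mu> (D \<times> B) = (\<integral>\<^sup>+\<omega>. ennreal (indicat_real D (X \<omega>) * (indicator A (Y \<omega>) * indicator B (C \<omega>))) \<partial>M)"
  proof -
    have Rm: "XC -` (D \<times> B) \<inter> space M \<in> events" by (rule measurable_sets[OF XC_measurable]) simp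
    have "emeasure ?\<mu> (D \<times> B) = (\<integral>\<^sup>+\<omega>. indicator A (Y \<omega>) * indicator (XC -` (D \<times> B) \<inter> space M) \<omega> \<partial>M)"
      using Rm by (subst emeasure_distr) (simp_all add: emeasure_density)
    also have "\<dots> = (\<integral>\<^sup>+\<omega>. ennreal (indicat_real D (X \<omega>) * (indicator A (Y \<omega>) * indicator B (C \<omega>))) \<partial>M)"
      by (intro nn_integral_cong) (simp add: indicator_def)
    finally show ?thesis .
  qed
  also have "\<dots> = (\<integral>\<^sup>+\<omega>. ennreal (indicat_real D (X \<omega>) * pY A (X \<omega>) * indicat_real B (C \<omega>)) \<partial>M)"
    using rectangle_expectation[of A B D] pY_bounds[of A]
    by (subst nn_integral_eq_integral[OF i1], simp, subst nn_integral_eq_integral[OF i2]) simp_all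
  also have "\<dots> = emeasure (density PXC (\<lambda>p. ennreal (pY A (fst p)))) (D \<times> B)"
  proof -
    have "emeasure (density PXC (\<lambda>p. ennreal (pY A (fst p)))) (D \<times> B) = (\<integral>\<^sup>+p. ennreal (pY A (fst p)) * indicator (D \<times> B) p \<partial>PXC)"
      by (rule emeasure_density) measurable
    also have "\<dots> = (\<integral>\<^sup>+\<omega>. ennreal (pY A (X \<omega>)) * indicator (D \<times> B) (XC \<omega>) \<partial>M)"
      unfolding PXC_def by (subst nn_integral_distr) simp_all
    finally show ?thesis by (simp only:) (intro nn_integral_cong, simp add: indicator_def)
  qed
  finally show "emeasure ?\<mu> (D \<times> B) = emeasure (density PXC (\<lambda>p. ennreal (pY A (fst p)))) (D \<times> B)" .
qed (simp_all add: sets_PXC)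

text \<open>Conditioning on \<open>C\<close> in addition to \<open>X\<close> does not change the density of \<open>Y\<close>.\<close>

lemma joint_law:
  "distr M borel3 (\<lambda>\<omega>. (XC \<omega>, Y \<omega>)) =
     density (PXC \<Otimes>\<^sub>M \<nu>) (\<lambda>z. ennreal (k (fst (fst z)) (snd z)))"
proof (rule finite_measure_eqI_rectangles[where A="borel2" and B=borel])
  show "finite_measure (distr M borel3 (\<lambda>\<omega>. (XC \<omega>, Y \<omega>)))"
    by (rule finite_measure_distr) measurable
  show "sets (density (PXC \<Otimes>\<^sub>M \<nu>) (\<lambda>z. ennreal (k (fst (fst z)) (snd z)))) = sets borel3"
    by (simp cong: sets_pair_measure_cong add: sets_PXC sets_\<nu>)
  fix R :: "('b \<times> real) set" and A :: "real set"
  assume R [measurable]: "R \<in> sets borel2" and A [measurable]: "A \<in> sets borel"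
  have [measurable]: "pY A \<in> borel_measurable borel" by (rule pY_measurable) simp
  have "emeasure (distr M borel3 (\<lambda>\<omega>. (XC \<omega>, Y \<omega>))) (R \<times> A) =
      emeasure (distr (density M (\<lambda>\<omega>. indicator A (Y \<omega>))) borel2 XC) R"
  proof -
    have Rm: "XC -` R \<inter> space M \<in> events" by (rule measurable_sets[OF XC_measurable R])
    have "emeasure (distr M borel3 (\<lambda>\<omega>. (XC \<omega>, Y \<omega>))) (R \<times> A) =
      emeasure M ((\<lambda>\<omega>. (XC \<omega>, Y \<omega>)) -` (R \<times> A) \<inter> space M)"
      by (rule emeasure_distr) measurable
    also have "\<dots> = (\<integral>\<^sup>+\<omega>. indicator ((\<lambda>\<omega>. (XC \<omega>, Y \<omega>)) -` (R \<times> A) \<inter> space M) \<omega> \<partial>M)"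
      by (rule nn_integral_indicator[symmetric]) measurable
    also have "\<dots> = (\<integral>\<^sup>+\<omega>. indicator A (Y \<omega>) * indicator (XC -` R \<inter> space M) \<omega> \<partial>M)"
      by (intro nn_integral_cong) (auto simp: indicator_def)
    also have "\<dots> = emeasure (distr (density M (\<lambda>\<omega>. indicator A (Y \<omega>))) borel2 XC) R"
      using Rm by (subst emeasure_distr) (simp_all add: emeasure_density)
    finally show ?thesis .
  qed
  also have "\<dots> = (\<integral>\<^sup>+p. ennreal (pY A (fst p)) * indicator R p \<partial>PXC)"
    unfolding joint_law_slice[OF A] by (simp add: emeasure_density)
  also have "\<dots> = (\<integral>\<^sup>+p. (\<integral>\<^sup>+y. ennreal (k (fst p) y) * indicator (R \<times> A) (p, y) \<partial>\<nu>) \<partial>PXC)"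
  proof (rule nn_integral_cong)
    fix p
    have "(\<integral>\<^sup>+y. ennreal (k (fst p) y) * indicator (R \<times> A) (p, y) \<partial>\<nu>) = (\<integral>\<^sup>+y. indicator R p * (indicator A y * ennreal (k (fst p) y)) \<partial>\<nu>)"
      by (intro nn_integral_cong) (simp add: indicator_def)
    also have "\<dots> = indicator R p * ennreal (pY A (fst p))"
      by (subst nn_integral_cmult) (simp_all add: nn_integral_pY)
    finally show "ennreal (pY A (fst p)) * indicator R p = (\<integral>\<^sup>+y. ennreal (k (fst p) y) * indicator (R \<times> A) (p, y) \<partial>\<nu>)"
      by (simp add: mult.commute)
  qed
  also have "\<dots> = (\<integral>\<^sup>+z. ennreal (k (fst (fst z)) (snd z)) * indicator (R \<times> A) z \<partial>(PXC \<Otimes>\<^sub>M \<nu>))"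
    by (subst \<nu>.nn_integral_fst[symmetric]) auto
  also have "\<dots> = emeasure (density (PXC \<Otimes>\<^sub>M \<nu>) (\<lambda>z. ennreal (k (fst (fst z)) (snd z)))) (R \<times> A)"
    by (subst emeasure_density) auto
  finally show "emeasure (distr M borel3 (\<lambda>\<omega>. (XC \<omega>, Y \<omega>))) (R \<times> A) =
     emeasure (density (PXC \<Otimes>\<^sub>M \<nu>) (\<lambda>z. ennreal (k (fst (fst z)) (snd z)))) (R \<times> A)" .
qed simp

lemma joint_measurable [measurable]: "(\<lambda>\<omega>. (XC \<omega>, Y \<omega>)) \<in> M \<rightarrow>\<^sub>M borel3"
  by measurable

lemma sets_PXC_\<nu> [measurable_cong]: "sets (PXC \<Otimes>\<^sub>M \<nu>) = sets borel3"
  by (rule sets_pair_measure_cong[OF sets_PXC sets_\<nu>])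

lemma AE_k_pos_pair: "AE z in PXC \<Otimes>\<^sub>M \<nu>. 0 < k (fst (fst z)) (snd z)"
proof (rule PXC_\<nu>.AE_pair_measure)
  show "{z \<in> space (PXC \<Otimes>\<^sub>M \<nu>). 0 < k (fst (fst z)) (snd z)} \<in> sets (PXC \<Otimes>\<^sub>M \<nu>)" by measurable
qed (simp add: AE_k_pos)

lemma nn_integral_joint:
  assumes [measurable]: "\<phi> \<in> borel_measurable borel3"
  shows "(\<integral>\<^sup>+\<omega>. \<phi> (XC \<omega>, Y \<omega>) \<partial>M) = (\<integral>\<^sup>+p. (\<integral>\<^sup>+y. ennreal (k (fst p) y) * \<phi> (p, y) \<partial>\<nu>) \<partial>PXC)"
proof -
  have "(\<integral>\<^sup>+\<omega>. \<phi> (XC \<omega>, Y \<omega>) \<partial>M) = (\<integral>\<^sup>+z. \<phi> z \<partial>distr M borel3 (\<lambda>\<omega>. (XC \<omega>, Y \<omega>)))"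
    by (subst nn_integral_distr) simp_all
  also have "\<dots> = (\<integral>\<^sup>+z. ennreal (k (fst (fst z)) (snd z)) * \<phi> z \<partial>(PXC \<Otimes>\<^sub>M \<nu>))"
    unfolding joint_law by (rule nn_integral_density) measurable
  also have "\<dots> = (\<integral>\<^sup>+p. (\<integral>\<^sup>+y. ennreal (k (fst p) y) * \<phi> (p, y) \<partial>\<nu>) \<partial>PXC)"
    by (subst \<nu>.nn_integral_fst[symmetric]) auto
  finally show ?thesis .
qed

text \<open>Positivity of the density makes null sets of the joint law null sets of the product measure.\<close>

lemma AE_joint:
  assumes [measurable]: "Measurable.pred borel3 P"
    and AE: "AE \<omega> in M. P (XC \<omega>, Y \<omega>)"
  shows "AE p in PXC. AE y in \<nu>. P (p, y)"
proof -
  have "AE z in distr M borel3 (\<lambda>\<omega>. (XC \<omega>, Y \<omega>)). P z"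
    using AE by (subst AE_distr_iff) auto
  then have "AE z in PXC \<Otimes>\<^sub>M \<nu>. 0 < ennreal (k (fst (fst z)) (snd z)) \<longrightarrow> P z"
    unfolding joint_law by (subst (asm) AE_density) auto
  with AE_k_pos_pair have "AE z in PXC \<Otimes>\<^sub>M \<nu>. P z" by eventually_elim simp
  then show ?thesis by (rule PXC_\<nu>.AE_pair)
qed

lemma integral_joint:
  fixes \<phi> :: "('b \<times> real) \<times> real \<Rightarrow> real"
  assumes [measurable]: "\<phi> \<in> borel_measurable borel3"
    and int: "integrable M (\<lambda>\<omega>. \<phi> (XC \<omega>, Y \<omega>))"
  shows "expectation (\<lambda>\<omega>. \<phi> (XC \<omega>, Y \<omega>)) = (\<integral>p. (\<integral>y. k (fst p) y * \<phi> (p, y) \<partial>\<nu>) \<partial>PXC)"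
    and "integrable PXC (\<lambda>p. \<integral>y. k (fst p) y * \<phi> (p, y) \<partial>\<nu>)"
    and "AE p in PXC. integrable \<nu> (\<lambda>y. k (fst p) y * \<phi> (p, y))"
proof -
  let ?J = "distr M borel3 (\<lambda>\<omega>. (XC \<omega>, Y \<omega>))"
  have pos: "AE z in PXC \<Otimes>\<^sub>M \<nu>. 0 \<le> k (fst (fst z)) (snd z)" using AE_k_pos_pair by eventually_elim simp
  have "integrable ?J \<phi>" using int by (subst integrable_distr_eq) auto
  then have i: "integrable (PXC \<Otimes>\<^sub>M \<nu>) (\<lambda>z. k (fst (fst z)) (snd z) * \<phi> z)"
    unfolding joint_law using pos by (subst (asm) integrable_density) auto
  have "expectation (\<lambda>\<omega>. \<phi> (XC \<omega>, Y \<omega>)) = (\<integral>z. \<phi> z \<partial>?J)"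
    by (rule integral_distr[symmetric]) auto
  also have "\<dots> = (\<integral>z. k (fst (fst z)) (snd z) * \<phi> z \<partial>(PXC \<Otimes>\<^sub>M \<nu>))"
    unfolding joint_law using pos by (subst integral_density) auto
  also have "\<dots> = (\<integral>p. (\<integral>y. k (fst p) y * \<phi> (p, y) \<partial>\<nu>) \<partial>PXC)"
    using PXC_\<nu>.integral_fst'[OF i] by simp
  finally show "expectation (\<lambda>\<omega>. \<phi> (XC \<omega>, Y \<omega>)) = (\<integral>p. (\<integral>y. k (fst p) y * \<phi> (p, y) \<partial>\<nu>) \<partial>PXC)" .
  show "integrable PXC (\<lambda>p. \<integral>y. k (fst p) y * \<phi> (p, y) \<partial>\<nu>)"
    using PXC_\<nu>.integrable_fst'[OF i] by simp
  show "AE p in PXC. integrable \<nu> (\<lambda>y. k (fst p) y * \<phi> (p, y))"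
    using PXC_\<nu>.AE_integrable_fst'[OF i] by simp
qed

definition H :: "'b measure" where "H = distr M borel X"

lemma sets_H [measurable_cong]: "sets H = sets borel" by (simp add: H_def)

sublocale H: prob_space H unfolding H_def by (rule prob_space_distr) simp

lemma G_kernel [measurable]: "G \<in> borel \<rightarrow>\<^sub>M subprob_algebra borel"
  using cdf_C by (auto simp: has_cond_cdf_def intro: measurable_prob_algebraD)

lemma G_prob: "prob_space (G x)" and sets_G [measurable_cong]: "sets (G x) = sets borel"
proof -
  have "G x \<in> space (prob_algebra borel)"
    using cdf_C measurable_space[of G borel "prob_algebra borel" x] by (simp add: has_cond_cdf_def)
  then show "prob_space (G x)" "sets (G x) = sets borel" by (auto simp: space_prob_algebra)
qed

lemma G_emeasure_measurable: "B \<in> sets borel \<Longrightarrow> (\<lambda>x. emeasure (G x) B) \<in> borel_measurable borel"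
  by (rule measurable_emeasure_kernel[OF G_kernel])

text \<open>The kernel \<open>G\<close> is given through conditional distribution functions only, that is, for each half-line
  up to a null set of its own. Two finite measures on the line that agree on half-lines agree.\<close>

lemma PXC_slice:
  assumes D [measurable]: "D \<in> sets borel" and B: "B \<in> sets borel"
  shows "emeasure PXC (D \<times> B) = (\<integral>\<^sup>+x. indicator D x * emeasure (G x) B \<partial>H)"
proof -
  note G_emeasure_measurable [measurable]
  define m1 where "m1 = distr (density M (\<lambda>\<omega>. indicator D (X \<omega>))) borel C"
  define m2 where "m2 = density H (indicator D) \<bind> G"
  have G': "G \<in> density H (indicator D) \<rightarrow>\<^sub>M subprob_algebra borel" by measurable
  have sp: "space (density H (indicator D)) \<noteq> {}" by (simp add: H_def)
  have m1: "emeasure m1 B = (\<integral>\<^sup>+\<omega>. indicator D (X \<omega>) * indicator B (C \<omega>) \<partial>M)" if [measurable]: "B \<in> sets borel" for B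
  proof -
    have "C -` B \<inter> space M \<in> events" by measurable
    then have "emeasure m1 B = (\<integral>\<^sup>+\<omega>. indicator D (X \<omega>) * indicator (C -` B \<inter> space M) \<omega> \<partial>M)"
      unfolding m1_def by (subst emeasure_distr) (simp_all add: emeasure_density)
    also have "\<dots> = (\<integral>\<^sup>+\<omega>. indicator D (X \<omega>) * indicator B (C \<omega>) \<partial>M)"
      by (intro nn_integral_cong) (auto simp: indicator_def)
    finally show ?thesis .
  qed
  have m2: "emeasure m2 B = (\<integral>\<^sup>+x. indicator D x * emeasure (G x) B \<partial>H)" if [measurable]: "B \<in> sets borel" for B
    unfolding m2_def by (subst emeasure_bind[OF sp G' that]) (subst nn_integral_density, auto)
  have "m1 = m2"
  proof (rule measure_eqI_lessThan)
    show "sets m1 = sets borel" by (simp add: m1_def)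
    show "sets m2 = sets borel" unfolding m2_def by (rule sets_bind[OF _ sp]) (simp add: sets_G)
    fix c :: real
    have "(\<integral>\<^sup>+\<omega>. indicator D (X \<omega>) * indicator {c<..} (C \<omega>) \<partial>M) \<le> (\<integral>\<^sup>+\<omega>. 1 \<partial>M)"
      by (intro nn_integral_mono) (simp add: indicator_def)
    then have "emeasure m1 {c<..} \<le> (\<integral>\<^sup>+\<omega>. 1 \<partial>M)" by (subst m1) simp_all
    then show "emeasure m1 {c<..} < \<infinity>" by (simp add: emeasure_space_1 le_less_trans)
    let ?F = "sigma_generated M X"
    interpret F: sigma_finite_subalgebra M ?F by (rule sigma_finite_subalgebra_generated) simp
    have mD: "(\<lambda>\<omega>. indicat_real D (X \<omega>)) \<in> borel_measurable ?F"
      by (rule measurable_sigma_generated) simp_all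
    have iD: "integrable M (\<lambda>\<omega>. indicat_real D (X \<omega>))"
      by (rule integrable_const_bound[of _ 1]) (auto simp: indicator_def)
    have i1: "integrable M (\<lambda>\<omega>. indicat_real D (X \<omega>) * indicat_real {..c} (C \<omega>))"
      by (rule integrable_const_bound[of _ 1]) (auto simp: indicator_def)
    let ?ce = "cond_exp_given M X (\<lambda>\<omega>. indicat_real {..c} (C \<omega>))"
    have ce: "AE \<omega> in M. ?ce \<omega> = cdf (G (X \<omega>)) c"
      using cdf_C unfolding has_cond_cdf_def by blast
    have cm: "(\<lambda>x. cdf (G x) c) \<in> borel_measurable borel"
    proof -
      have "(\<lambda>x. enn2real (emeasure (G x) {..c})) \<in> borel_measurable borel" by measurable
      then show ?thesis by (simp add: cdf_def measure_def)
    qed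
    note cm [measurable]
    have cb: "0 \<le> cdf (G x) c \<and> cdf (G x) c \<le> 1" for x
      using prob_space.prob_le_1[OF G_prob] by (simp add: cdf_def)
    have i2: "integrable M (\<lambda>\<omega>. indicat_real D (X \<omega>) * cdf (G (X \<omega>)) c)"
      by (rule integrable_const_bound[of _ 1]) (use cb in \<open>auto simp: indicator_def\<close>)
    have "expectation (\<lambda>\<omega>. indicat_real D (X \<omega>) * indicat_real {..c} (C \<omega>)) = expectation (\<lambda>\<omega>. indicat_real D (X \<omega>) * ?ce \<omega>)"
      unfolding cond_exp_given_def by (rule F.real_cond_exp_intg(2)[OF i1 mD, symmetric]) measurable
    also have "\<dots> = expectation (\<lambda>\<omega>. indicat_real D (X \<omega>) * cdf (G (X \<omega>)) c)"
    proof (rule integral_cong_AE)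
      show "AE \<omega> in M. indicat_real D (X \<omega>) * ?ce \<omega> = indicat_real D (X \<omega>) * cdf (G (X \<omega>)) c"
        using ce by eventually_elim simp
    qed (unfold cond_exp_given_def, measurable)
    finally have eq: "expectation (\<lambda>\<omega>. indicat_real D (X \<omega>) * indicat_real {..c} (C \<omega>)) = expectation (\<lambda>\<omega>. indicat_real D (X \<omega>) * cdf (G (X \<omega>)) c)" .
    have "emeasure m1 {c<..} = (\<integral>\<^sup>+\<omega>. ennreal (indicat_real D (X \<omega>) - indicat_real D (X \<omega>) * indicat_real {..c} (C \<omega>)) \<partial>M)"
      by (subst m1) (auto simp: indicator_def intro!: nn_integral_cong)
    also have "\<dots> = ennreal (expectation (\<lambda>\<omega>. indicat_real D (X \<omega>) - indicat_real D (X \<omega>) * indicat_real {..c} (C \<omega>)))"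
      using iD i1 by (intro nn_integral_eq_integral Bochner_Integration.integrable_diff) (auto simp: indicator_def)
    also have "\<dots> = ennreal (expectation (\<lambda>\<omega>. indicat_real D (X \<omega>) - indicat_real D (X \<omega>) * cdf (G (X \<omega>)) c))"
      using iD i1 i2 eq by simp
    also have "\<dots> = (\<integral>\<^sup>+\<omega>. ennreal (indicat_real D (X \<omega>) - indicat_real D (X \<omega>) * cdf (G (X \<omega>)) c) \<partial>M)"
      using iD i2 cb by (intro nn_integral_eq_integral[symmetric] Bochner_Integration.integrable_diff) (auto simp: indicator_def)
    also have "\<dots> = (\<integral>\<^sup>+\<omega>. indicator D (X \<omega>) * emeasure (G (X \<omega>)) {c<..} \<partial>M)"
    proof (intro nn_integral_cong)
      fix \<omega>
      interpret g: prob_space "G (X \<omega>)" by (rule G_prob)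
      have "{c<..} = space (G (X \<omega>)) - {..c}" using sets_eq_imp_space_eq[OF sets_G] by auto
      then have "g.prob {c<..} = 1 - cdf (G (X \<omega>)) c" 
        using g.prob_compl[of "{..c}"] by (simp add: cdf_def sets_G)
      then show "ennreal (indicat_real D (X \<omega>) - indicat_real D (X \<omega>) * cdf (G (X \<omega>)) c) = indicator D (X \<omega>) * emeasure (G (X \<omega>)) {c<..}"
        by (simp add: indicator_def g.emeasure_eq_measure)
    qed
    also have "\<dots> = (\<integral>\<^sup>+x. indicator D x * emeasure (G x) {c<..} \<partial>H)"
      unfolding H_def by (subst nn_integral_distr) auto
    finally show "emeasure m1 {c<..} = emeasure m2 {c<..}" by (subst m2) auto
  qed
  have "emeasure PXC (D \<times> B) = emeasure m1 B"
  proof -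
    have "emeasure PXC (D \<times> B) = emeasure M (XC -` (D \<times> B) \<inter> space M)"
      unfolding PXC_def by (rule emeasure_distr[OF XC_measurable pair_measureI[OF D B]])
    also have "\<dots> = (\<integral>\<^sup>+\<omega>. indicator (XC -` (D \<times> B) \<inter> space M) \<omega> \<partial>M)"
      by (rule nn_integral_indicator[symmetric, OF measurable_sets[OF XC_measurable pair_measureI[OF D B]]])
    also have "\<dots> = emeasure m1 B"
      unfolding m1[OF B] by (intro nn_integral_cong) (auto simp: indicator_def)
    finally show ?thesis .
  qed
  then show ?thesis unfolding \<open>m1 = m2\<close> m2[OF B] .
qed

text \<open>The conditional law of \<open>(X, C)\<close> given \<open>X = x\<close>.\<close>

definition XC_kernel :: "'b \<Rightarrow> ('b \<times> real) measure" where "XC_kernel x = distr (G x) borel2 (Pair x)"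

lemma XC_kernel_measurable: "XC_kernel \<in> H \<rightarrow>\<^sub>M subprob_algebra borel2"
  unfolding XC_kernel_def[abs_def] by (rule measurable_distr2[where M=borel]) measurable

lemma PXC_eq_bind: "PXC = H \<bind> XC_kernel"
proof (rule finite_measure_eqI_rectangles[where A=borel and B=borel])
  show "finite_measure PXC" by unfold_locales
  have sp: "space H \<noteq> {}" by (simp add: H_def)
  show "sets (H \<bind> XC_kernel) = sets borel2" by (rule sets_bind[OF _ sp]) (simp add: XC_kernel_def)
  fix D :: "'b set" and B :: "real set" assume [measurable]: "D \<in> sets borel" "B \<in> sets borel"
  have "emeasure (H \<bind> XC_kernel) (D \<times> B) = (\<integral>\<^sup>+x. emeasure (XC_kernel x) (D \<times> B) \<partial>H)"
    by (rule emeasure_bind[OF sp XC_kernel_measurable]) measurable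
  also have "\<dots> = (\<integral>\<^sup>+x. indicator D x * emeasure (G x) B \<partial>H)"
  proof (intro nn_integral_cong)
    fix x
    have "emeasure (XC_kernel x) (D \<times> B) = emeasure (G x) (Pair x -` (D \<times> B) \<inter> space (G x))"
      unfolding XC_kernel_def by (rule emeasure_distr) measurable
    also have "Pair x -` (D \<times> B) \<inter> space (G x) = (if x \<in> D then B else {})"
      using sets_eq_imp_space_eq[OF sets_G[of x]] by auto
    finally show "emeasure (XC_kernel x) (D \<times> B) = indicator D x * emeasure (G x) B" by simp
  qed
  finally show "emeasure PXC (D \<times> B) = emeasure (H \<bind> XC_kernel) (D \<times> B)" by (simp add: PXC_slice)
qed (rule sets_PXC)

lemma nn_integral_PXC:
  assumes [measurable]: "\<phi> \<in> borel_measurable borel2"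
  shows "(\<integral>\<^sup>+p. \<phi> p \<partial>PXC) = (\<integral>\<^sup>+x. (\<integral>\<^sup>+c. \<phi> (x, c) \<partial>G x) \<partial>H)"
proof -
  have "(\<integral>\<^sup>+p. \<phi> p \<partial>PXC) = (\<integral>\<^sup>+x. (\<integral>\<^sup>+p. \<phi> p \<partial>XC_kernel x) \<partial>H)"
    unfolding PXC_eq_bind by (rule nn_integral_bind[OF _ XC_kernel_measurable]) measurable
  also have "\<dots> = (\<integral>\<^sup>+x. (\<integral>\<^sup>+c. \<phi> (x, c) \<partial>G x) \<partial>H)"
    unfolding XC_kernel_def by (intro nn_integral_cong nn_integral_distr) measurable
  finally show ?thesis .
qed

lemma AE_PXC:
  assumes [measurable]: "Measurable.pred borel2 P" and AE: "AE p in PXC. P p"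
  shows "AE x in H. AE c in G x. P (x, c)"
proof -
  have "AE x in H. AE p in XC_kernel x. P p"
    using AE unfolding PXC_eq_bind by (subst (asm) AE_bind[OF XC_kernel_measurable]) auto
  then show ?thesis
  proof eventually_elim
    case (elim x)
    then show ?case unfolding XC_kernel_def by (subst (asm) AE_distr_iff) auto
  qed
qed

lemma kernel_integral_measurable:
  fixes \<phi> :: "'b \<times> real \<Rightarrow> real"
  assumes m [measurable]: "\<phi> \<in> borel_measurable borel2"
  shows "(\<lambda>x. \<integral>c. \<phi> (x, c) \<partial>G x) \<in> borel_measurable H"
proof -
  have "(\<lambda>x. \<integral>p. \<phi> p \<partial>XC_kernel x) \<in> borel_measurable H"
    by (rule measurable_compose[OF XC_kernel_measurable integral_measurable_subprob_algebra[OF m]])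
  moreover have "(\<integral>p. \<phi> p \<partial>XC_kernel x) = (\<integral>c. \<phi> (x, c) \<partial>G x)" for x
    unfolding XC_kernel_def by (rule integral_distr) measurable
  ultimately show ?thesis by simp
qed

text \<open>The inner integral need not exist for every \<open>x\<close>. Its positive and negative parts are therefore
  integrated separately; both are finite for almost every \<open>x\<close>.\<close>

lemma integral_PXC:
  fixes \<phi> :: "'b \<times> real \<Rightarrow> real"
  assumes m [measurable]: "\<phi> \<in> borel_measurable borel2" and int: "integrable PXC \<phi>"
  shows "(\<integral>p. \<phi> p \<partial>PXC) = (\<integral>x. (\<integral>c. \<phi> (x, c) \<partial>G x) \<partial>H)"
proof -
  define A where "A s x = (\<integral>\<^sup>+c. ennreal (s * \<phi> (x, c)) \<partial>G x)" for s :: real and x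
  have Am: "A s \<in> borel_measurable borel" for s
    unfolding A_def by (rule nn_integral_measurable_subprob_algebra2[OF _ G_kernel]) measurable
  have PA: "(\<integral>\<^sup>+p. ennreal (s * \<phi> p) \<partial>PXC) = (\<integral>\<^sup>+x. A s x \<partial>H)" for s
    unfolding A_def by (rule nn_integral_PXC) measurable
  have fin: "(\<integral>\<^sup>+x. A s x \<partial>H) < \<infinity>" for s
  proof -
    have "integrable PXC (\<lambda>p. s * \<phi> p)" using int by simp
    then have "(\<integral>\<^sup>+p. ennreal (norm (s * \<phi> p)) \<partial>PXC) < \<infinity>"
      by (rule integrable_iff_bounded[THEN iffD1, THEN conjunct2])
    moreover have "(\<integral>\<^sup>+p. ennreal (s * \<phi> p) \<partial>PXC) \<le> (\<integral>\<^sup>+p. ennreal (norm (s * \<phi> p)) \<partial>PXC)"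
      by (intro nn_integral_mono ennreal_leI) simp
    ultimately show ?thesis unfolding PA by (rule le_less_trans[rotated])
  qed
  have Am' [measurable]: "A s \<in> borel_measurable H" for s using Am[of s] by (simp cong: measurable_cong_sets add: sets_H)
  have AEfin: "AE x in H. A s x < \<infinity>" for s
    using nn_integral_PInf_AE[OF Am'[of s]] fin[of s] by (auto simp: top.not_eq_extremum)
  have nn: "(\<integral>\<^sup>+x. ennreal (enn2real (A s x)) \<partial>H) = (\<integral>\<^sup>+x. A s x \<partial>H)" for s
    by (rule nn_integral_cong_AE) (use AEfin[of s] in \<open>auto elim!: eventually_mono\<close>)
  have Ai: "integrable H (\<lambda>x. enn2real (A s x))" for s
    by (rule integrableI_bounded) (use nn[of s] fin[of s] in simp_all)
  have AI: "(\<integral>x. enn2real (A s x) \<partial>H) = enn2real (\<integral>\<^sup>+x. A s x \<partial>H)" for s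
    by (subst integral_eq_nn_integral) (simp_all add: nn)
  have "(\<integral>p. \<phi> p \<partial>PXC) = enn2real (\<integral>\<^sup>+x. A 1 x \<partial>H) - enn2real (\<integral>\<^sup>+x. A (-1) x \<partial>H)"
    using PA[of 1] PA[of "-1"] by (simp add: real_lebesgue_integral_def[OF int])
  also have "\<dots> = (\<integral>x. enn2real (A 1 x) - enn2real (A (-1) x) \<partial>H)"
    by (simp add: AI Ai)
  also have "\<dots> = (\<integral>x. (\<integral>c. \<phi> (x, c) \<partial>G x) \<partial>H)"
  proof (rule integral_cong_AE)
    show "(\<lambda>x. \<integral>c. \<phi> (x, c) \<partial>G x) \<in> borel_measurable H"
      by (rule kernel_integral_measurable[OF m])
    show "AE x in H. enn2real (A 1 x) - enn2real (A (-1) x) = (\<integral>c. \<phi> (x, c) \<partial>G x)"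
      using AEfin[of 1] AEfin[of "-1"]
    proof eventually_elim
      case (elim x)
      have "(\<integral>\<^sup>+c. ennreal (norm (\<phi> (x, c))) \<partial>G x) = (\<integral>\<^sup>+c. ennreal (1 * \<phi> (x, c)) + ennreal (-1 * \<phi> (x, c)) \<partial>G x)"
        by (intro nn_integral_cong) (auto simp: abs_if ennreal_neg)
      also have "\<dots> = A 1 x + A (-1) x"
        unfolding A_def by (rule nn_integral_add) measurable
      also have "\<dots> < \<infinity>" using elim by simp
      finally have "integrable (G x) (\<lambda>c. \<phi> (x, c))" by (intro integrableI_bounded) measurable
      then show ?case by (simp add: real_lebesgue_integral_def A_def)
    qed
  qed (use Am' in measurable)
  finally show ?thesis .
qed

section \<open>Uncensored observations\<close>

text \<open>The factor \<open>1 - G(y-|x)\<close> is the conditional probability of observing \<open>y\<close> uncensored.\<close>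

definition Gtail :: "'b \<Rightarrow> real \<Rightarrow> real" where "Gtail x y = 1 - cdf_left (G x) y"

lemma Gtail_eq: "Gtail x y = measure (G x) {y..}"
proof -
  interpret g: prob_space "G x" by (rule G_prob)
  interpret g: real_distribution "G x"
    by unfold_locales (use sets_eq_imp_space_eq[OF sets_G[of x]] in \<open>simp_all add: sets_G\<close>)
  have "cdf_left (G x) y = g.prob {..<y}"
    unfolding cdf_left_def by (rule tendsto_Lim[OF _ g.cdf_at_left]) simp
  moreover have "{y..} = space (G x) - {..<y}" using sets_eq_imp_space_eq[OF sets_G[of x]] by auto
  then have "g.prob {y..} = 1 - g.prob {..<y}" using g.prob_compl[of "{..<y}"] by (simp add: sets_G)
  ultimately show ?thesis by (simp add: Gtail_def)
qed

lemma Gtail_nonneg: "0 \<le> Gtail x y" by (simp add: Gtail_eq)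

lemma ennreal_Gtail: "ennreal (Gtail x y) = emeasure (G x) {y..}"
  using prob_space.finite_measure[OF G_prob] by (simp add: Gtail_eq finite_measure.emeasure_eq_measure)

lemma Gtail_measurable: "(\<lambda>z. Gtail (fst z) (snd z)) \<in> borel_measurable borel2"
proof -
  have "(\<lambda>z. \<integral>\<^sup>+c. indicator {snd z..} c \<partial>G (fst z)) \<in> borel_measurable borel2"
  proof (rule nn_integral_measurable_subprob_algebra2[where N=borel])
    have "(\<lambda>(z, c). indicator {snd z..} c) = (\<lambda>w::(('b \<times> real) \<times> real). if snd (fst w) \<le> snd w then 1 else 0 :: ennreal)"
      by (auto simp: indicator_def fun_eq_iff)
    also have "\<dots> \<in> borel_measurable borel3" by measurable
    finally show "(\<lambda>(z, c). indicator {snd z..} c :: ennreal) \<in> borel_measurable (((borel :: 'b measure) \<Otimes>\<^sub>M (borel :: real measure)) \<Otimes>\<^sub>M borel)" .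
  qed measurable
  also have "(\<lambda>z. \<integral>\<^sup>+c. indicator {snd z..} c \<partial>G (fst z)) = (\<lambda>z. ennreal (Gtail (fst z) (snd z)))"
    by (simp add: ennreal_Gtail sets_G)
  finally have "(\<lambda>z. enn2real (ennreal (Gtail (fst z) (snd z)))) \<in> borel_measurable borel2" by measurable
  then show ?thesis by (simp add: Gtail_nonneg)
qed

text \<open>Given \<open>X = x\<close>, the variable \<open>C\<close> is integrated out first, which replaces the indicator of
  \<open>y \<le> C\<close> by its probability.\<close>

lemma nn_integral_uncensored:
  assumes [measurable]: "\<psi> \<in> borel_measurable borel2"
  shows "(\<integral>\<^sup>+\<omega>. of_bool (Y \<omega> \<le> C \<omega>) * \<psi> (X \<omega>, Y \<omega>) \<partial>M) = (\<integral>\<^sup>+\<omega>. ennreal (Gtail (X \<omega>) (Y \<omega>)) * \<psi> (X \<omega>, Y \<omega>) \<partial>M)"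
proof -
  note Gtail_measurable [measurable]
  have Gt [measurable]: "(\<lambda>l. Gtail (u l) (v l)) \<in> borel_measurable L"
    if "u \<in> borel_measurable L" "v \<in> borel_measurable L" for u v and L :: "'l measure"
    using measurable_compose[OF measurable_Pair[OF that] Gtail_measurable] by simp
  have A: "(\<integral>\<^sup>+\<omega>. of_bool (Y \<omega> \<le> C \<omega>) * \<psi> (X \<omega>, Y \<omega>) \<partial>M) =
    (\<integral>\<^sup>+x. (\<integral>\<^sup>+c. (\<integral>\<^sup>+y. ennreal (k x y) * (of_bool (y \<le> c) * \<psi> (x, y)) \<partial>\<nu>) \<partial>G x) \<partial>H)"
    using nn_integral_joint[of "\<lambda>z. of_bool (snd z \<le> snd (fst z)) * \<psi> (fst (fst z), snd z)"]
    by (simp, subst (asm) nn_integral_PXC) (auto simp: of_bool_def)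
  have B: "(\<integral>\<^sup>+\<omega>. ennreal (Gtail (X \<omega>) (Y \<omega>)) * \<psi> (X \<omega>, Y \<omega>) \<partial>M) =
    (\<integral>\<^sup>+x. (\<integral>\<^sup>+c. (\<integral>\<^sup>+y. ennreal (k x y) * (ennreal (Gtail x y) * \<psi> (x, y)) \<partial>\<nu>) \<partial>G x) \<partial>H)"
    using nn_integral_joint[of "\<lambda>z. ennreal (Gtail (fst (fst z)) (snd z)) * \<psi> (fst (fst z), snd z)"]
    by (simp, subst (asm) nn_integral_PXC) auto
  have "(\<integral>\<^sup>+c. (\<integral>\<^sup>+y. ennreal (k x y) * (of_bool (y \<le> c) * \<psi> (x, y)) \<partial>\<nu>) \<partial>G x) =
    (\<integral>\<^sup>+c. (\<integral>\<^sup>+y. ennreal (k x y) * (ennreal (Gtail x y) * \<psi> (x, y)) \<partial>\<nu>) \<partial>G x)" for x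
  proof -
    interpret g: prob_space "G x" by (rule G_prob)
    interpret gn: pair_sigma_finite "G x" \<nu> by unfold_locales
    have "(\<integral>\<^sup>+c. (\<integral>\<^sup>+y. ennreal (k x y) * (of_bool (y \<le> c) * \<psi> (x, y)) \<partial>\<nu>) \<partial>G x) =
      (\<integral>\<^sup>+y. (\<integral>\<^sup>+c. ennreal (k x y) * (of_bool (y \<le> c) * \<psi> (x, y)) \<partial>G x) \<partial>\<nu>)"
      by (rule gn.Fubini'[symmetric]) (simp add: of_bool_def split_beta')
    also have "\<dots> = (\<integral>\<^sup>+y. ennreal (k x y) * (ennreal (Gtail x y) * \<psi> (x, y)) \<partial>\<nu>)"
    proof (intro nn_integral_cong)
      fix y
      have "(\<integral>\<^sup>+c. ennreal (k x y) * (of_bool (y \<le> c) * \<psi> (x, y)) \<partial>G x) = (\<integral>\<^sup>+c. (ennreal (k x y) * \<psi> (x, y)) * indicator {y..} c \<partial>G x)"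
        by (intro nn_integral_cong) (simp add: indicator_def)
      also have "\<dots> = ennreal (k x y) * \<psi> (x, y) * emeasure (G x) {y..}"
        by (subst nn_integral_cmult_indicator) (simp_all add: sets_G)
      finally show "(\<integral>\<^sup>+c. ennreal (k x y) * (of_bool (y \<le> c) * \<psi> (x, y)) \<partial>G x) = ennreal (k x y) * (ennreal (Gtail x y) * \<psi> (x, y))"
        by (simp add: ennreal_Gtail mult_ac)
    qed
    finally show ?thesis by (simp add: g.emeasure_space_1)
  qed
  then show ?thesis unfolding A B by simp
qed

lemma uncensored_law:
  "distr (density M (\<lambda>\<omega>. of_bool (Y \<omega> \<le> C \<omega>))) borel2 (\<lambda>\<omega>. (X \<omega>, Y \<omega>)) =
   distr (density M (\<lambda>\<omega>. ennreal (Gtail (X \<omega>) (Y \<omega>)))) borel2 (\<lambda>\<omega>. (X \<omega>, Y \<omega>))" (is "?l = ?r")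
proof (rule measure_eqI)
  fix R assume "R \<in> sets ?l"
  then have R [measurable]: "R \<in> sets borel2" by simp
  have [measurable]: "(\<lambda>\<omega>. Gtail (X \<omega>) (Y \<omega>)) \<in> borel_measurable M"
    using measurable_compose[OF measurable_Pair[OF rv(1,2)] Gtail_measurable] by simp
  have Rm: "(\<lambda>\<omega>. (X \<omega>, Y \<omega>)) -` R \<inter> space M \<in> events" by (rule measurable_sets[OF _ R]) measurable
  have e: "emeasure (distr (density M d) borel2 (\<lambda>\<omega>. (X \<omega>, Y \<omega>))) R = (\<integral>\<^sup>+\<omega>. d \<omega> * indicator R (X \<omega>, Y \<omega>) \<partial>M)"
    if [measurable]: "d \<in> borel_measurable M" for d :: "'a \<Rightarrow> ennreal"
  proof -
    have "emeasure (distr (density M d) borel2 (\<lambda>\<omega>. (X \<omega>, Y \<omega>))) R = (\<integral>\<^sup>+\<omega>. d \<omega> * indicator ((\<lambda>\<omega>. (X \<omega>, Y \<omega>)) -` R \<inter> space M) \<omega> \<partial>M)"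
      using Rm by (subst emeasure_distr) (simp_all add: emeasure_density)
    also have "\<dots> = (\<integral>\<^sup>+\<omega>. d \<omega> * indicator R (X \<omega>, Y \<omega>) \<partial>M)"
      by (intro nn_integral_cong) (auto simp: indicator_def)
    finally show ?thesis .
  qed
  have "(\<lambda>\<omega>. of_bool (Y \<omega> \<le> C \<omega>) :: ennreal) \<in> borel_measurable M" unfolding of_bool_def by measurable
  then show "emeasure ?l R = emeasure ?r R"
    using nn_integral_uncensored[of "indicator R"] by (simp add: e)
qed simp

lemma integral_uncensored:
  fixes \<psi> :: "'b \<times> real \<Rightarrow> real"
  assumes [measurable]: "\<psi> \<in> borel_measurable borel2"
  shows "integrable M (\<lambda>\<omega>. of_bool (Y \<omega> \<le> C \<omega>) * \<psi> (X \<omega>, Y \<omega>)) \<longleftrightarrow> integrable M (\<lambda>\<omega>. Gtail (X \<omega>) (Y \<omega>) * \<psi> (X \<omega>, Y \<omega>))"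
    and "expectation (\<lambda>\<omega>. of_bool (Y \<omega> \<le> C \<omega>) * \<psi> (X \<omega>, Y \<omega>)) = expectation (\<lambda>\<omega>. Gtail (X \<omega>) (Y \<omega>) * \<psi> (X \<omega>, Y \<omega>))"
proof -
  have [measurable]: "(\<lambda>\<omega>. Gtail (X \<omega>) (Y \<omega>)) \<in> borel_measurable M"
    using measurable_compose[OF measurable_Pair[OF rv(1,2)] Gtail_measurable] by simp
  have [measurable]: "(\<lambda>\<omega>. of_bool (Y \<omega> \<le> C \<omega>) :: real) \<in> borel_measurable M" unfolding of_bool_def by measurable
  have ob: "(\<lambda>\<omega>. ennreal (of_bool (Y \<omega> \<le> C \<omega>))) = (\<lambda>\<omega>. of_bool (Y \<omega> \<le> C \<omega>))" by (auto simp: fun_eq_iff)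
  have int: "integrable (distr (density M (\<lambda>\<omega>. ennreal (d \<omega>))) borel2 (\<lambda>\<omega>. (X \<omega>, Y \<omega>))) \<psi> \<longleftrightarrow> integrable M (\<lambda>\<omega>. d \<omega> * \<psi> (X \<omega>, Y \<omega>))"
    and I: "(\<integral>z. \<psi> z \<partial>distr (density M (\<lambda>\<omega>. ennreal (d \<omega>))) borel2 (\<lambda>\<omega>. (X \<omega>, Y \<omega>))) = (\<integral>\<omega>. d \<omega> * \<psi> (X \<omega>, Y \<omega>) \<partial>M)"
    if [measurable]: "d \<in> borel_measurable M" and "\<And>\<omega>. 0 \<le> d \<omega>" for d :: "'a \<Rightarrow> real"
    using that(2) by (simp_all add: integrable_distr_eq integrable_density integral_distr integral_density)
  show "integrable M (\<lambda>\<omega>. of_bool (Y \<omega> \<le> C \<omega>) * \<psi> (X \<omega>, Y \<omega>)) \<longleftrightarrow> integrable M (\<lambda>\<omega>. Gtail (X \<omega>) (Y \<omega>) * \<psi> (X \<omega>, Y \<omega>))"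
    using int[of "\<lambda>\<omega>. of_bool (Y \<omega> \<le> C \<omega>)"] int[of "\<lambda>\<omega>. Gtail (X \<omega>) (Y \<omega>)"] uncensored_law
    by (simp add: ob Gtail_nonneg)
  show "expectation (\<lambda>\<omega>. of_bool (Y \<omega> \<le> C \<omega>) * \<psi> (X \<omega>, Y \<omega>)) = expectation (\<lambda>\<omega>. Gtail (X \<omega>) (Y \<omega>) * \<psi> (X \<omega>, Y \<omega>))"
    using I[of "\<lambda>\<omega>. of_bool (Y \<omega> \<le> C \<omega>)"] I[of "\<lambda>\<omega>. Gtail (X \<omega>) (Y \<omega>)"] uncensored_law
    by (simp add: ob Gtail_nonneg)
qed

text \<open>What holds at almost every uncensored observation holds at almost every value of \<open>Y\<close> that has a chance
  to be observed.\<close>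

lemma AE_uncensored:
  assumes [measurable]: "Measurable.pred borel2 P"
    and AE: "AE \<omega> in M. Y \<omega> \<le> C \<omega> \<longrightarrow> P (X \<omega>, Y \<omega>)"
  shows "AE \<omega> in M. Gtail (X \<omega>) (Y \<omega>) \<noteq> 0 \<longrightarrow> P (X \<omega>, Y \<omega>)"
proof -
  have [measurable]: "(\<lambda>\<omega>. Gtail (X \<omega>) (Y \<omega>)) \<in> borel_measurable M"
    using measurable_compose[OF measurable_Pair[OF rv(1,2)] Gtail_measurable] by simp
  have "(\<integral>\<^sup>+\<omega>. of_bool (Y \<omega> \<le> C \<omega>) * of_bool (\<not> P (X \<omega>, Y \<omega>)) \<partial>M) = (\<integral>\<^sup>+\<omega>. 0 \<partial>M)"
    by (rule nn_integral_cong_AE) (use AE in \<open>auto elim!: eventually_mono\<close>)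
  then have "(\<integral>\<^sup>+\<omega>. ennreal (Gtail (X \<omega>) (Y \<omega>)) * of_bool (\<not> P (X \<omega>, Y \<omega>)) \<partial>M) = 0"
    using nn_integral_uncensored[of "\<lambda>z. of_bool (\<not> P z)"] by (simp add: of_bool_def)
  then have "AE \<omega> in M. ennreal (Gtail (X \<omega>) (Y \<omega>)) * of_bool (\<not> P (X \<omega>, Y \<omega>)) = 0"
    by (subst (asm) nn_integral_0_iff_AE) (simp_all add: of_bool_def)
  then show ?thesis
    using Gtail_nonneg by (auto elim!: eventually_mono simp: ennreal_eq_0_iff order_antisym)
qed

end

section \<open>Score and information of the censored model\<close>

text \<open>Used with \<open>g\<close> a log-likelihood and \<open>u\<close> either \<open>f = exp g\<close> or \<open>F = 1 - exp g\<close>. The second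
  derivative is the source of the combination \<open>D\<^sub>r\<^sub>s g + D\<^sub>r g D\<^sub>s g\<close>.\<close>

lemma partial_derivs_affine_exp:
  fixes g u :: "real^'q::finite \<Rightarrow> real"
  assumes V: "open V" "\<theta> \<in> V" and g: "has_continuous_second_derivatives_on g V"
    and u: "\<And>\<theta>'. \<theta>' \<in> V \<Longrightarrow> u \<theta>' = a + b * exp (g \<theta>')"
  shows "partial_differentiable s u \<theta>"
    and "partial_deriv s u \<theta> = b * exp (g \<theta>) * partial_deriv s g \<theta>"
    and "partial_deriv2 r s u \<theta> = b * exp (g \<theta>) * (partial_deriv2 r s g \<theta> + partial_deriv r g \<theta> * partial_deriv s g \<theta>)"
proof -
  have 1: "partial_differentiable s u \<theta>' \<and> partial_deriv s u \<theta>' = b * exp (g \<theta>') * partial_deriv s g \<theta>'"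
    if "\<theta>' \<in> V" for \<theta>' s
  proof -
    have "partial_differentiable s g \<theta>'" using g that by (simp add: has_continuous_second_derivatives_on_def)
    note d = partial_differentiable_DERIV0[OF this]
    have "((\<lambda>t. a + b * exp (g (\<theta>' + t *\<^sub>R axis s 1))) has_real_derivative b * exp (g \<theta>') * partial_deriv s g \<theta>') (at 0)"
      by (rule derivative_eq_intros d refl | simp)+
    from partial_derivI[OF this] partial_derivative_cong[OF V(1) that u] show ?thesis by simp
  qed
  from 1[OF V(2)] show "partial_differentiable s u \<theta>" "partial_deriv s u \<theta> = b * exp (g \<theta>) * partial_deriv s g \<theta>" by auto
  have d1: "partial_differentiable r g \<theta>" and d2: "partial_differentiable r (partial_deriv s g) \<theta>"
    using g V by (auto simp: has_continuous_second_derivatives_on_def)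
  note d = partial_differentiable_DERIV0[OF d1] partial_differentiable_DERIV0[OF d2]
  have "((\<lambda>t. b * exp (g (\<theta> + t *\<^sub>R axis r 1)) * partial_deriv s g (\<theta> + t *\<^sub>R axis r 1)) has_real_derivative
      b * exp (g \<theta>) * (partial_deriv2 r s g \<theta> + partial_deriv r g \<theta> * partial_deriv s g \<theta>)) (at 0)"
    by (rule derivative_eq_intros d refl | simp add: algebra_simps)+
  from partial_derivI(2)[OF this] partial_derivative_cong(2)[OF V, of "partial_deriv s u"] 1
  show "partial_deriv2 r s u \<theta> = b * exp (g \<theta>) * (partial_deriv2 r s g \<theta> + partial_deriv r g \<theta> * partial_deriv s g \<theta>)"
    by simp
qed

lemma has_continuous_second_derivatives_on_zero:
  "has_continuous_second_derivatives_on (\<lambda>_::real^'q::finite. 0) V"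
proof -
  have 1: "partial_differentiable s (\<lambda>_. 0) \<theta> \<and> partial_deriv s (\<lambda>_. 0) \<theta> = 0" for s and \<theta> :: "real^'q"
    using partial_derivI[of "\<lambda>_. 0" \<theta> s 0] by simp
  then have "partial_deriv s (\<lambda>_::real^'q. 0) = (\<lambda>_. 0)" for s by (simp add: fun_eq_iff)
  with 1 show ?thesis by (simp add: has_continuous_second_derivatives_on_def)
qed

text \<open>Dominated convergence for the difference quotients along one null sequence. The supremum of the derivatives
  over \<open>V\<close> need not be measurable, so it cannot dominate directly; but by the mean value theorem it bounds
  the countable supremum \<open>w\<close> of the quotients, which is measurable and serves instead. The function \<open>D\<close> is a
  measurable version of the derivative at \<open>\<theta>\<close>.\<close>

lemma partial_deriv_integral:
  fixes h :: "real^'q::finite \<Rightarrow> real \<Rightarrow> real"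
  assumes V: "open V" "\<theta> \<in> V" and int: "\<And>\<theta>'. \<theta>' \<in> V \<Longrightarrow> integrable \<nu> (h \<theta>')"
    and diff: "AE y in \<nu>. \<forall>\<theta>'\<in>V. partial_differentiable s (\<lambda>\<theta>'. h \<theta>' y) \<theta>'"
    and dom: "(\<integral>\<^sup>+ y. (SUP \<theta>'\<in>V. ennreal \<bar>partial_deriv s (\<lambda>\<theta>'. h \<theta>' y) \<theta>'\<bar>) \<partial>\<nu>) < \<infinity>"
    and D: "D \<in> borel_measurable \<nu>" "AE y in \<nu>. D y = partial_deriv s (\<lambda>\<theta>'. h \<theta>' y) \<theta>"
    and F: "partial_differentiable s (\<lambda>\<theta>'. \<integral>y. h \<theta>' y \<partial>\<nu>) \<theta>"
  shows "integrable \<nu> D" and "(\<integral>y. D y \<partial>\<nu>) = partial_deriv s (\<lambda>\<theta>'. \<integral>y. h \<theta>' y \<partial>\<nu>) \<theta>"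
proof -
  obtain \<tau> where \<tau>: "\<tau> > 0" "\<And>t. \<bar>t\<bar> \<le> \<tau> \<Longrightarrow> \<theta> + t *\<^sub>R axis s 1 \<in> V"
    using axis_segment_in_open[OF V] by blast
  define t where "t n = \<tau> / real (Suc n)" for n
  have t: "0 < t n" "t n \<le> \<tau>" for n using \<tau>(1) by (simp_all add: t_def divide_le_eq mult_left_le)
  have tV: "\<theta> + t n *\<^sub>R axis s 1 \<in> V" for n using t[of n] by (intro \<tau>(2)) simp
  define q where "q n y = (h (\<theta> + t n *\<^sub>R axis s 1) y - h \<theta> y) / t n" for n y
  have qi: "integrable \<nu> (q n)" for n unfolding q_def[abs_def] using int[OF tV] int[OF V(2)] by simp
  note qm [measurable] = borel_measurable_integrable[OF qi]
  define w where "w y = (SUP n. ennreal \<bar>q n y\<bar>)" for y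
  have wm [measurable]: "w \<in> borel_measurable \<nu>" unfolding w_def[abs_def] by measurable
  have wle: "AE y in \<nu>. w y \<le> (SUP \<theta>'\<in>V. ennreal \<bar>partial_deriv s (\<lambda>\<theta>'. h \<theta>' y) \<theta>'\<bar>)"
    using diff
  proof eventually_elim
    case (elim y)
    let ?B = "SUP \<theta>'\<in>V. ennreal \<bar>partial_deriv s (\<lambda>\<theta>'. h \<theta>' y) \<theta>'\<bar>"
    show ?case
    proof (cases ?B)
      case (real B)
      have d: "((\<lambda>u. h (\<theta> + u *\<^sub>R axis s 1) y) has_real_derivative partial_deriv s (\<lambda>\<theta>'. h \<theta>' y) (\<theta> + u *\<^sub>R axis s 1)) (at u within {0..\<tau>})"
        if "u \<in> {0..\<tau>}" for u
        using elim \<tau>(2)[of u] that by (intro has_field_derivative_at_within[OF partial_differentiable_DERIV]) auto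
      have b: "norm (partial_deriv s (\<lambda>\<theta>'. h \<theta>' y) (\<theta> + u *\<^sub>R axis s 1)) \<le> B" if "u \<in> {0..\<tau>}" for u
      proof -
        have "ennreal \<bar>partial_deriv s (\<lambda>\<theta>'. h \<theta>' y) (\<theta> + u *\<^sub>R axis s 1)\<bar> \<le> ?B"
          using \<tau>(2)[of u] that by (intro SUP_upper) auto
        then show ?thesis using real by simp
      qed
      have "ennreal \<bar>q n y\<bar> \<le> ennreal B" for n
      proof -
        have "norm (h (\<theta> + t n *\<^sub>R axis s 1) y - h (\<theta> + 0 *\<^sub>R axis s 1) y) \<le> B * norm (t n - 0)"
          using t[of n] by (intro field_differentiable_bound[OF _ d b]) auto
        then show ?thesis using t[of n] by (intro ennreal_leI) (simp add: q_def abs_mult divide_le_eq)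
      qed
      then show ?thesis unfolding w_def real(2) by (intro SUP_least)
    qed (metis top_greatest)
  qed
  have wfin: "(\<integral>\<^sup>+ y. w y \<partial>\<nu>) < \<infinity>" using nn_integral_mono_AE[OF wle] dom by (rule le_less_trans)
  then have wae: "AE y in \<nu>. w y \<noteq> \<infinity>" by (intro nn_integral_PInf_AE) auto
  have lim: "AE y in \<nu>. (\<lambda>n. q n y) \<longlonglongrightarrow> D y"
    using diff D(2)
  proof eventually_elim
    case (elim y)
    then show ?case
      using partial_difference_quotient_tendsto[of s "\<lambda>\<theta>'. h \<theta>' y" \<theta> \<tau>] V(2) \<tau>(1) by (simp add: q_def t_def)
  qed
  have wi: "integrable \<nu> (\<lambda>y. enn2real (w y))"
  proof (rule integrableI_bounded)
    have "(\<integral>\<^sup>+ y. ennreal (norm (enn2real (w y))) \<partial>\<nu>) \<le> (\<integral>\<^sup>+ y. w y \<partial>\<nu>)"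
      by (intro nn_integral_mono) (simp add: ennreal_enn2real_if)
    then show "(\<integral>\<^sup>+ y. ennreal (norm (enn2real (w y))) \<partial>\<nu>) < \<infinity>" using wfin by (rule le_less_trans)
  qed measurable
  have bound: "AE y in \<nu>. norm (q n y) \<le> enn2real (w y)" for n
    using wae
  proof eventually_elim
    case (elim y)
    have "ennreal \<bar>q n y\<bar> \<le> w y" unfolding w_def by (rule SUP_upper) simp
    then have "enn2real (ennreal \<bar>q n y\<bar>) \<le> enn2real (w y)" using elim by (intro enn2real_mono) (auto simp: less_top)
    then show ?case by simp
  qed
  note dct = D(1) borel_measurable_integrable[OF qi] wi lim bound
  show "integrable \<nu> D" by (rule integrable_dominated_convergence[OF dct])
  have "(\<lambda>n. \<integral>y. q n y \<partial>\<nu>) \<longlonglongrightarrow> (\<integral>y. D y \<partial>\<nu>)" by (rule integral_dominated_convergence[OF dct])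
  moreover have "(\<integral>y. q n y \<partial>\<nu>) = ((\<integral>y. h (\<theta> + t n *\<^sub>R axis s 1) y \<partial>\<nu>) - (\<integral>y. h \<theta> y \<partial>\<nu>)) / t n" for n
    unfolding q_def using int[OF tV] int[OF V(2)] by simp
  ultimately show "(\<integral>y. D y \<partial>\<nu>) = partial_deriv s (\<lambda>\<theta>'. \<integral>y. h \<theta>' y \<partial>\<nu>) \<theta>"
    using partial_difference_quotient_tendsto[OF F \<tau>(1)] unfolding t_def by (simp add: LIMSEQ_unique)
qed

lemma loglik1_uncensored: "loglik1 \<nu> f (x, y, 1) = (\<lambda>\<theta>. ln (f \<theta> x y))"
  by (auto simp: loglik1_def fun_eq_iff)

lemma loglik1_censored:
  "loglik1 \<nu> f (x, c, 0) \<theta> = (if cond_df \<nu> f \<theta> x c = 1 then 0 else ln (1 - cond_df \<nu> f \<theta> x c))"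
  by (simp add: loglik1_def)

lemma observed_eq: "observed X Y C \<omega> = (if Y \<omega> \<le> C \<omega> then (X \<omega>, Y \<omega>, 1) else (X \<omega>, C \<omega>, 0))"
  by (simp add: observed_def)

text \<open>The set \<open>N\<close> consists of observations at which the log-likelihood is smooth; it is a Borel set of
  full measure.\<close>

locale censored_regression = conditional_model M X Y C \<nu> "f \<theta>\<^sub>0" G
  for M :: "'a measure" and X :: "'a \<Rightarrow> real^'p::finite" and Y C :: "'a \<Rightarrow> real" and \<nu> :: "real measure"
    and f :: "real^'q::finite \<Rightarrow> real^'p \<Rightarrow> real \<Rightarrow> real" and \<theta>\<^sub>0 :: "real^'q" and G :: "real^'p \<Rightarrow> real measure" +
  fixes \<Theta> V :: "(real^'q) set" and N :: "((real^'p) \<times> real \<times> real) set"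
  assumes family: "conditional_density_family \<nu> \<Theta> f"
    and nbhd: "open V" "\<theta>\<^sub>0 \<in> V" "V \<subseteq> \<Theta>"
    and nonneg: "\<And>\<omega>. \<omega> \<in> space M \<Longrightarrow> 0 \<le> Y \<omega>" "\<And>\<omega>. \<omega> \<in> space M \<Longrightarrow> 0 \<le> C \<omega>"
    and N: "N \<in> sets borel" "AE \<omega> in M. observed X Y C \<omega> \<in> N"
    and N_smooth: "\<And>w. w \<in> N \<Longrightarrow> has_continuous_second_derivatives_on (loglik1 \<nu> f w) V"
    and dominated_density: "AE x in distr M borel X. \<forall>r.
           (AE y in \<nu>. \<forall>\<theta>\<in>V. partial_differentiable r (\<lambda>\<theta>'. f \<theta>' x y) \<theta>) \<and>
           (\<integral>\<^sup>+ y. (SUP \<theta>\<in>V. ennreal \<bar>partial_deriv r (\<lambda>\<theta>'. f \<theta>' x y) \<theta>\<bar>) \<partial>\<nu>) < \<infinity>"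
    and defect_exists: "\<And>r s. AE x in distr M borel X.
           (AE c in G x. set_integrable \<nu> {..c} (\<lambda>y. partial_deriv2 r s (\<lambda>\<theta>'. f \<theta>' x y) \<theta>\<^sub>0)) \<and>
           integrable (G x) (interchange_defect \<nu> f \<theta>\<^sub>0 r s x)"
      "\<And>r s. integrable (distr M borel X) (\<lambda>x. \<integral>c. interchange_defect \<nu> f \<theta>\<^sub>0 r s x c \<partial>G x)"
    and defect_zero: "\<And>r s. (\<integral>x. (\<integral>c. interchange_defect \<nu> f \<theta>\<^sub>0 r s x c \<partial>G x) \<partial>distr M borel X) = 0"
    and Sigma_exists: "Sigma_exists M \<nu> f \<theta>\<^sub>0 X Y C G"
begin

lemma f_measurable: "\<theta> \<in> \<Theta> \<Longrightarrow> (\<lambda>(x, y). f \<theta> x y) \<in> borel_measurable borel2"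
  using family by (simp add: conditional_density_family_def borel_prod)

lemma f_pos: "\<theta> \<in> \<Theta> \<Longrightarrow> 0 \<le> y \<Longrightarrow> 0 < f \<theta> x y"
  using family by (simp add: conditional_density_family_def)

lemma f_prob: "\<theta> \<in> \<Theta> \<Longrightarrow> (\<integral>y. f \<theta> x y \<partial>\<nu>) = 1"
  using family by (simp add: conditional_density_family_def)

lemma \<theta>\<^sub>0_in: "\<theta>\<^sub>0 \<in> \<Theta>" using nbhd by auto

lemma f_integrable: "\<theta> \<in> \<Theta> \<Longrightarrow> integrable \<nu> (f \<theta> x)"
  using f_prob[of \<theta> x] not_integrable_integral_eq[of \<nu> "f \<theta> x"] by fastforce

lemma f_set_integrable: "\<theta> \<in> \<Theta> \<Longrightarrow> A \<in> sets borel \<Longrightarrow> integrable \<nu> (\<lambda>y. indicator A y * f \<theta> x y)"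
  using integrable_mult_indicator[OF _ f_integrable[of \<theta> x], of A] sets_\<nu> by simp

abbreviation F :: "real^'q \<Rightarrow> real^'p \<Rightarrow> real \<Rightarrow> real" where "F \<equiv> cond_df \<nu> f"

lemma F_eq: "F \<theta> x c = (\<integral>y. indicator {..c} y * f \<theta> x y \<partial>\<nu>)"
  by (simp add: cond_df_def set_lebesgue_integral_def)

lemma one_minus_F: "\<theta> \<in> \<Theta> \<Longrightarrow> 1 - F \<theta> x c = (\<integral>y. indicator {c<..} y * f \<theta> x y \<partial>\<nu>)"
proof -
  assume \<theta>: "\<theta> \<in> \<Theta>"
  have "1 - F \<theta> x c = (\<integral>y. f \<theta> x y - indicator {..c} y * f \<theta> x y \<partial>\<nu>)"
    unfolding F_eq using f_integrable[OF \<theta>] f_set_integrable[OF \<theta>, of "{..c}"] f_prob[OF \<theta>] by simp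
  also have "\<dots> = (\<integral>y. indicator {c<..} y * f \<theta> x y \<partial>\<nu>)"
    by (intro Bochner_Integration.integral_cong) (auto simp: indicator_def)
  finally show ?thesis .
qed

lemma F_le_1: "\<theta> \<in> \<Theta> \<Longrightarrow> F \<theta> x c \<le> 1"
proof -
  assume \<theta>: "\<theta> \<in> \<Theta>"
  have "0 \<le> (\<integral>y. indicator {c<..} y * f \<theta> x y \<partial>\<nu>)"
    by (rule integral_nonneg_AE) (use AE_\<nu>_nonneg f_pos[OF \<theta>] in \<open>auto elim!: eventually_mono simp: less_imp_le\<close>)
  then show ?thesis using one_minus_F[OF \<theta>, of x c] by simp
qed

text \<open>Since all densities are positive on the same half-line, whether \<open>F\<close> reaches 1 at \<open>c\<close> depends on \<open>\<nu>\<close>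
  alone. The case distinction in the log-likelihood is thus the same for all parameters.\<close>

lemma F_eq_1_iff: "\<theta> \<in> \<Theta> \<Longrightarrow> F \<theta> x c = 1 \<longleftrightarrow> (AE y in \<nu>. y \<le> c)"
proof -
  assume \<theta>: "\<theta> \<in> \<Theta>"
  have "F \<theta> x c = 1 \<longleftrightarrow> (\<integral>y. indicator {c<..} y * f \<theta> x y \<partial>\<nu>) = 0"
    using one_minus_F[OF \<theta>, of x c] by auto
  also have "\<dots> \<longleftrightarrow> (AE y in \<nu>. indicator {c<..} y * f \<theta> x y = 0)"
    by (rule integral_nonneg_eq_0_iff_AE[OF f_set_integrable[OF \<theta>]])
       (use AE_\<nu>_nonneg f_pos[OF \<theta>] in \<open>auto elim!: eventually_mono simp: less_imp_le\<close>)
  also have "\<dots> \<longleftrightarrow> (AE y in \<nu>. y \<le> c)"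
  proof
    assume "AE y in \<nu>. indicator {c<..} y * f \<theta> x y = 0"
    with AE_\<nu>_nonneg show "AE y in \<nu>. y \<le> c"
    proof eventually_elim
      case (elim y) then show ?case using f_pos[OF \<theta>, of y x] by (auto simp: indicator_def split: if_splits)
    qed
  qed (auto elim!: eventually_mono simp: indicator_def)
  finally show ?thesis .
qed

lemma F_measurable: "\<theta> \<in> \<Theta> \<Longrightarrow> (\<lambda>p. F \<theta> (fst p) (snd p)) \<in> borel_measurable borel2"
proof -
  assume \<theta>: "\<theta> \<in> \<Theta>"
  have "(\<lambda>z. f \<theta> (fst (fst z)) (snd z)) \<in> borel_measurable borel3"
  proof -
    have "(\<lambda>z. (fst (fst z), snd z)) \<in> borel3 \<rightarrow>\<^sub>M (borel :: (real^'p) measure) \<Otimes>\<^sub>M (borel :: real measure)"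
      by measurable
    from measurable_compose[OF this f_measurable[OF \<theta>]] show ?thesis by simp
  qed
  note this [measurable]
  have m: "(\<lambda>(p, y). (if y \<le> snd p then 1 else 0) * f \<theta> (fst p) y) \<in> borel_measurable (borel2 \<Otimes>\<^sub>M \<nu>)"
    unfolding measurable_cong_sets[OF sets_pair_measure_cong[OF refl sets_\<nu>] refl] split_beta' by measurable
  have "F \<theta> (fst p) (snd p) = (\<integral>y. (if y \<le> snd p then 1 else 0) * f \<theta> (fst p) y \<partial>\<nu>)" for p
    unfolding F_eq by (intro Bochner_Integration.integral_cong) (auto simp: indicator_def)
  then show ?thesis using \<nu>.borel_measurable_lebesgue_integral[OF m] by simp
qed

lemma loglik1_measurable: "\<theta> \<in> \<Theta> \<Longrightarrow> (\<lambda>w. loglik1 \<nu> f w \<theta>) \<in> borel_measurable borel"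
proof -
  assume \<theta>: "\<theta> \<in> \<Theta>"
  have [measurable]: "(\<lambda>w::(real^'p) \<times> real \<times> real. fst w) \<in> borel_measurable borel" "(\<lambda>w::(real^'p) \<times> real \<times> real. fst (snd w)) \<in> borel_measurable borel"
     "(\<lambda>w::(real^'p) \<times> real \<times> real. snd (snd w)) \<in> borel_measurable borel"
    by (intro borel_measurable_continuous_onI continuous_intros)+
  have [measurable]: "(\<lambda>w::(real^'p) \<times> real \<times> real. f \<theta> (fst w) (fst (snd w))) \<in> borel_measurable borel"
    using measurable_compose[OF _ f_measurable[OF \<theta>], of "\<lambda>w::(real^'p) \<times> real \<times> real. (fst w, fst (snd w))" borel] by simp
  have [measurable]: "(\<lambda>w::(real^'p) \<times> real \<times> real. F \<theta> (fst w) (fst (snd w))) \<in> borel_measurable borel"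
    using measurable_compose[OF _ F_measurable[OF \<theta>], of "\<lambda>w::(real^'p) \<times> real \<times> real. (fst w, fst (snd w))" borel] by simp
  show ?thesis unfolding loglik1_def split_beta' by measurable
qed

text \<open>The value 0 off \<open>N\<close> makes the log-likelihood smooth, and its derivatives measurable, at every
  observation.\<close>

definition ell :: "(real^'p) \<times> real \<times> real \<Rightarrow> real^'q \<Rightarrow> real" where
  "ell w = (if w \<in> N then loglik1 \<nu> f w else (\<lambda>_. 0))"

lemma ell_smooth: "has_continuous_second_derivatives_on (ell w) V"
  using N_smooth by (simp add: ell_def has_continuous_second_derivatives_on_zero)

lemma ell_measurable: "\<theta> \<in> V \<Longrightarrow> (\<lambda>w. ell w \<theta>) \<in> borel_measurable borel"
proof -
  assume "\<theta> \<in> V"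
  then have "(\<lambda>w. if w \<in> N then loglik1 \<nu> f w \<theta> else 0) \<in> borel_measurable borel"
    using loglik1_measurable nbhd N(1) by (intro measurable_If_set) auto
  then show ?thesis by (simp add: ell_def if_distrib[of "\<lambda>h. h \<theta>"])
qed

definition score :: "'q \<Rightarrow> (real^'p) \<times> real \<times> real \<Rightarrow> real" where "score s w = partial_deriv s (ell w) \<theta>\<^sub>0"
definition hess :: "'q \<Rightarrow> 'q \<Rightarrow> (real^'p) \<times> real \<times> real \<Rightarrow> real" where "hess r s w = partial_deriv2 r s (ell w) \<theta>\<^sub>0"

text \<open>The second derivative of the likelihood divided by the likelihood.\<close>

definition bartlett :: "'q \<Rightarrow> 'q \<Rightarrow> (real^'p) \<times> real \<times> real \<Rightarrow> real" where "bartlett r s w = hess r s w + score r w * score s w"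

lemma ell_partial_differentiable: "\<theta> \<in> V \<Longrightarrow> partial_differentiable s (ell w) \<theta>"
  and ell_partial_differentiable2: "\<theta> \<in> V \<Longrightarrow> partial_differentiable r (partial_deriv s (ell w)) \<theta>"
  using ell_smooth[of w] by (auto simp: has_continuous_second_derivatives_on_def)

lemma ell_measurable1: "\<theta> \<in> V \<Longrightarrow> (\<lambda>w. partial_deriv s (ell w) \<theta>) \<in> borel_measurable borel"
  by (rule borel_measurable_partial_deriv[OF nbhd(1) _ ell_measurable ell_partial_differentiable])

lemma score_measurable [measurable]: "score s \<in> borel_measurable borel"
  unfolding score_def[abs_def] by (rule ell_measurable1[OF nbhd(2)])

lemma hess_measurable [measurable]: "hess r s \<in> borel_measurable borel"
  unfolding hess_def[abs_def] by (rule borel_measurable_partial_deriv[OF nbhd(1,2) ell_measurable1 ell_partial_differentiable2[OF nbhd(2)]])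

lemma bartlett_measurable [measurable]: "bartlett r s \<in> borel_measurable borel"
  unfolding bartlett_def[abs_def] by measurable

abbreviation W :: "'a \<Rightarrow> (real^'p) \<times> real \<times> real" where "W \<equiv> observed X Y C"

text \<open>The observation as a function of \<open>((x, c), y)\<close>, with the arguments arranged as in the joint law.\<close>

definition obs :: "((real^'p) \<times> real) \<times> real \<Rightarrow> (real^'p) \<times> real \<times> real" where
  "obs z = (if snd z \<le> snd (fst z) then (fst (fst z), snd z, 1) else (fst (fst z), snd (fst z), 0))"

lemma W_eq: "W \<omega> = obs (XC \<omega>, Y \<omega>)"
  by (simp add: observed_eq obs_def)

lemma obs_measurable [measurable]: "obs \<in> borel3 \<rightarrow>\<^sub>M borel"
  unfolding obs_def[abs_def] borel_prod[symmetric] by measurable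

text \<open>For almost all pairs \<open>(x, c)\<close>, smoothness holds at the observations from almost all \<open>y\<close>.\<close>

definition good :: "real^'p \<Rightarrow> real \<Rightarrow> bool" where "good x c \<longleftrightarrow> (AE y in \<nu>. obs ((x, c), y) \<in> N)"

lemma good_measurable: "Measurable.pred borel2 (\<lambda>p. good (fst p) (snd p))"
proof -
  have Nm: "{z \<in> space borel3. obs z \<notin> N} \<in> sets (((borel :: (real^'p) measure) \<Otimes>\<^sub>M (borel :: real measure)) \<Otimes>\<^sub>M (borel :: real measure))"
    using N(1) by measurable
  define u :: "((real^'p) \<times> real) \<times> real \<Rightarrow> ennreal" where "u = indicator {z \<in> space borel3. obs z \<notin> N}"
  have um: "u \<in> borel_measurable (borel2 \<Otimes>\<^sub>M \<nu>)"
    unfolding measurable_cong_sets[OF sets_pair_measure_cong[OF refl sets_\<nu>] refl] u_def using Nm by simp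
  have u1: "(\<lambda>y. u (p, y)) \<in> borel_measurable \<nu>" for p
    by (rule measurable_compose[OF _ um]) (simp add: space_pair_measure)
  have "good (fst p) (snd p) \<longleftrightarrow> (\<integral>\<^sup>+y. u (p, y) \<partial>\<nu>) = 0" for p
    unfolding good_def by (subst nn_integral_0_iff_AE[OF u1]) (simp add: u_def indicator_def space_pair_measure)
  moreover have "(\<lambda>p. \<integral>\<^sup>+y. u (p, y) \<partial>\<nu>) \<in> borel_measurable borel2"
    using um by (rule \<nu>.borel_measurable_nn_integral_fst)
  ultimately show ?thesis by simp
qed

lemma AE_good: "AE p in PXC. good (fst p) (snd p)"
proof -
  have "AE p in PXC. AE y in \<nu>. obs (p, y) \<in> N"
  proof (rule AE_joint)
    show "Measurable.pred borel3 (\<lambda>z. obs z \<in> N)" using N(1) by measurable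
    show "AE \<omega> in M. obs (XC \<omega>, Y \<omega>) \<in> N" using N(2) by (simp add: W_eq)
  qed
  then show ?thesis by (simp add: good_def)
qed

lemma AE_good_kernel: "AE x in H. AE c in G x. good x c"
  using AE_PXC[OF good_measurable AE_good] by simp

lemma good_uncensored: "good x c \<Longrightarrow> AE y in \<nu>. y \<le> c \<longrightarrow> (x, y, 1) \<in> N"
  unfolding good_def by (auto elim!: eventually_mono simp: obs_def)

text \<open>All \<open>y > c\<close> give the same observation \<open>(x, c, 0)\<close>; if they do not form a null set, then this single
  observation belongs to \<open>N\<close>.\<close>

lemma good_censored:
  assumes "good x c" "F \<theta>\<^sub>0 x c \<noteq> 1" shows "(x, c, 0) \<in> N"
proof (rule ccontr)
  assume n: "(x, c, 0) \<notin> N"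
  have "AE y in \<nu>. y \<le> c"
    using assms(1) n unfolding good_def by (auto elim!: eventually_mono simp: obs_def split: if_splits)
  then show False using assms(2) F_eq_1_iff[OF \<theta>\<^sub>0_in] by blast
qed

text \<open>For an uncensored observation \<open>f = exp (log f)\<close>.\<close>

lemma density_derivs:
  assumes "(x, y, 1) \<in> N" "0 \<le> y"
  shows "partial_deriv s (\<lambda>\<theta>. f \<theta> x y) \<theta>\<^sub>0 = f \<theta>\<^sub>0 x y * score s (x, y, 1)"
    and "partial_deriv2 r s (\<lambda>\<theta>. f \<theta> x y) \<theta>\<^sub>0 = f \<theta>\<^sub>0 x y * bartlett r s (x, y, 1)"
proof -
  have ell_N: "ell (x, y, 1) = (\<lambda>\<theta>. ln (f \<theta> x y))" using assms(1) by (simp add: ell_def loglik1_uncensored)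
  have e: "f \<theta> x y = 0 + 1 * exp (ell (x, y, 1) \<theta>)" if "\<theta> \<in> V" for \<theta>
    using f_pos[of \<theta> y x] that nbhd(3) assms(2) by (auto simp: ell_N)
  note d = partial_derivs_affine_exp[OF nbhd(1,2) ell_smooth, of "\<lambda>\<theta>. f \<theta> x y" 0 1 "(x, y, 1)", OF e]
  show "partial_deriv s (\<lambda>\<theta>. f \<theta> x y) \<theta>\<^sub>0 = f \<theta>\<^sub>0 x y * score s (x, y, 1)"
    using d(2) e[OF nbhd(2)] by (simp add: score_def)
  show "partial_deriv2 r s (\<lambda>\<theta>. f \<theta> x y) \<theta>\<^sub>0 = f \<theta>\<^sub>0 x y * bartlett r s (x, y, 1)"
    using d(3) e[OF nbhd(2)] by (simp add: score_def hess_def bartlett_def)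
qed

text \<open>For a censored observation \<open>F = 1 - exp (log (1 - F))\<close>; where \<open>F\<close> is identically 1 both sides vanish.\<close>

lemma cond_df_derivs:
  assumes "good x c"
  shows "partial_differentiable s (\<lambda>\<theta>. F \<theta> x c) \<theta>\<^sub>0"
    and "partial_deriv s (\<lambda>\<theta>. F \<theta> x c) \<theta>\<^sub>0 = - (1 - F \<theta>\<^sub>0 x c) * score s (x, c, 0)"
    and "partial_deriv2 r s (\<lambda>\<theta>. F \<theta> x c) \<theta>\<^sub>0 = - (1 - F \<theta>\<^sub>0 x c) * bartlett r s (x, c, 0)"
proof -
  have "partial_differentiable s (\<lambda>\<theta>. F \<theta> x c) \<theta>\<^sub>0 \<and>
    partial_deriv s (\<lambda>\<theta>. F \<theta> x c) \<theta>\<^sub>0 = - (1 - F \<theta>\<^sub>0 x c) * score s (x, c, 0) \<and>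
    partial_deriv2 r s (\<lambda>\<theta>. F \<theta> x c) \<theta>\<^sub>0 = - (1 - F \<theta>\<^sub>0 x c) * bartlett r s (x, c, 0)"
  proof (cases "F \<theta>\<^sub>0 x c = 1")
    case True
    then have "F \<theta> x c = 1 + 0 * exp 0" if "\<theta> \<in> V" for \<theta>
      using F_eq_1_iff[OF \<theta>\<^sub>0_in] F_eq_1_iff[of \<theta>] that nbhd(3) by auto
    from partial_derivs_affine_exp[OF nbhd(1,2) has_continuous_second_derivatives_on_zero, of "\<lambda>\<theta>. F \<theta> x c" 1 0, OF this]
    show ?thesis using True by simp
  next
    case False
    have ell_N: "ell (x, c, 0) = loglik1 \<nu> f (x, c, 0)" using good_censored[OF assms False] by (simp add: ell_def)
    have e: "F \<theta> x c = 1 + (-1) * exp (ell (x, c, 0) \<theta>)" if "\<theta> \<in> V" for \<theta>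
    proof -
      have \<theta>: "\<theta> \<in> \<Theta>" using that nbhd(3) by auto
      have "F \<theta> x c \<noteq> 1" using False F_eq_1_iff[OF \<theta>\<^sub>0_in] F_eq_1_iff[OF \<theta>] by blast
      then show ?thesis using F_le_1[OF \<theta>, of x c] by (simp add: ell_N loglik1_censored)
    qed
    note d = partial_derivs_affine_exp[OF nbhd(1,2) ell_smooth, of "\<lambda>\<theta>. F \<theta> x c" 1 "-1" "(x, c, 0)", OF e]
    have "exp (ell (x, c, 0) \<theta>\<^sub>0) = 1 - F \<theta>\<^sub>0 x c" using e[OF nbhd(2)] by simp
    with d show ?thesis by (simp add: score_def hess_def bartlett_def)
  qed
  then show "partial_differentiable s (\<lambda>\<theta>. F \<theta> x c) \<theta>\<^sub>0"
    and "partial_deriv s (\<lambda>\<theta>. F \<theta> x c) \<theta>\<^sub>0 = - (1 - F \<theta>\<^sub>0 x c) * score s (x, c, 0)"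
    and "partial_deriv2 r s (\<lambda>\<theta>. F \<theta> x c) \<theta>\<^sub>0 = - (1 - F \<theta>\<^sub>0 x c) * bartlett r s (x, c, 0)" by auto
qed

definition dominated_at :: "real^'p \<Rightarrow> bool" where
  "dominated_at x \<longleftrightarrow> (\<forall>r. (AE y in \<nu>. \<forall>\<theta>\<in>V. partial_differentiable r (\<lambda>\<theta>'. f \<theta>' x y) \<theta>) \<and>
     (\<integral>\<^sup>+ y. (SUP \<theta>\<in>V. ennreal \<bar>partial_deriv r (\<lambda>\<theta>'. f \<theta>' x y) \<theta>\<bar>) \<partial>\<nu>) < \<infinity>)"

lemma AE_dominated_at: "AE p in PXC. dominated_at (fst p)"
proof -
  have "distr PXC borel fst = (H :: (real^'p) measure)"
    unfolding PXC_def H_def by (subst distr_distr) (auto simp: comp_def)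
  moreover have "AE x in H. dominated_at x" unfolding H_def dominated_at_def by (rule dominated_density)
  ultimately have "AE x in distr PXC borel fst. dominated_at x" by (simp only:)
  then show ?thesis by (rule AE_distrD[rotated]) measurable
qed

lemma section_measurable: "u \<in> borel_measurable borel \<Longrightarrow> (\<lambda>y. u (x, y, d)) \<in> borel_measurable borel"
  for u :: "(real^'p) \<times> real \<times> real \<Rightarrow> real"
  by (rule measurable_compose[of "\<lambda>y. (x, y, d)" borel borel]) (intro borel_measurable_continuous_onI continuous_intros)

text \<open>Differentiating \<open>F(c|\<theta>,x)\<close> under the integral: the left-hand side is the integral of \<open>D\<^sub>s f\<close> over
  \<open>y \<le> c\<close>, and the right-hand side is \<open>D\<^sub>s F\<close> by the lemma on its derivatives.\<close>

lemma uncensored_score_integral: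
  assumes good: "good x c" and dom: "dominated_at x"
  shows "integrable \<nu> (\<lambda>y. indicator {..c} y * (f \<theta>\<^sub>0 x y * score s (x, y, 1)))"
    and "(\<integral>y. indicator {..c} y * (f \<theta>\<^sub>0 x y * score s (x, y, 1)) \<partial>\<nu>) = - (1 - F \<theta>\<^sub>0 x c) * score s (x, c, 0)"
proof -
  let ?h = "\<lambda>\<theta> y. indicator {..c} y * f \<theta> x y"
  have scale: "partial_differentiable s (\<lambda>\<theta>'. ?h \<theta>' y) \<theta> \<and>
    partial_deriv s (\<lambda>\<theta>'. ?h \<theta>' y) \<theta> = indicator {..c} y * partial_deriv s (\<lambda>\<theta>'. f \<theta>' x y) \<theta>"
    if "partial_differentiable s (\<lambda>\<theta>'. f \<theta>' x y) \<theta>" for y \<theta>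
    using partial_derivI[OF DERIV_cmult[OF partial_differentiable_DERIV0[OF that], of "indicator {..c} y"]] by simp
  have diff: "AE y in \<nu>. \<forall>\<theta>\<in>V. partial_differentiable s (\<lambda>\<theta>'. f \<theta>' x y) \<theta>"
    using dom by (simp add: dominated_at_def)
  have 1: "AE y in \<nu>. \<forall>\<theta>\<in>V. partial_differentiable s (\<lambda>\<theta>'. ?h \<theta>' y) \<theta>"
    using diff by eventually_elim (use scale in blast)
  have "(\<integral>\<^sup>+ y. (SUP \<theta>\<in>V. ennreal \<bar>partial_deriv s (\<lambda>\<theta>'. ?h \<theta>' y) \<theta>\<bar>) \<partial>\<nu>) \<le>
      (\<integral>\<^sup>+ y. (SUP \<theta>\<in>V. ennreal \<bar>partial_deriv s (\<lambda>\<theta>'. f \<theta>' x y) \<theta>\<bar>) \<partial>\<nu>)"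
  proof (rule nn_integral_mono_AE)
    show "AE y in \<nu>. (SUP \<theta>\<in>V. ennreal \<bar>partial_deriv s (\<lambda>\<theta>'. ?h \<theta>' y) \<theta>\<bar>) \<le> (SUP \<theta>\<in>V. ennreal \<bar>partial_deriv s (\<lambda>\<theta>'. f \<theta>' x y) \<theta>\<bar>)"
      using diff
    proof eventually_elim
      case (elim y)
      then have "ennreal \<bar>partial_deriv s (\<lambda>\<theta>'. ?h \<theta>' y) \<theta>\<bar> \<le> ennreal \<bar>partial_deriv s (\<lambda>\<theta>'. f \<theta>' x y) \<theta>\<bar>" if "\<theta> \<in> V" for \<theta>
        using scale[of y \<theta>] that by (intro ennreal_leI) (auto simp: indicator_def)
      then show ?case by (intro SUP_mono) blast
    qed
  qed
  also have "\<dots> < \<infinity>" using dom by (simp add: dominated_at_def)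
  finally have 2: "(\<integral>\<^sup>+ y. (SUP \<theta>\<in>V. ennreal \<bar>partial_deriv s (\<lambda>\<theta>'. ?h \<theta>' y) \<theta>\<bar>) \<partial>\<nu>) < \<infinity>" .
  have 3: "(\<lambda>y. indicator {..c} y * (f \<theta>\<^sub>0 x y * score s (x, y, 1))) \<in> borel_measurable \<nu>"
    using section_measurable[OF score_measurable, of s x 1] by measurable
  have 4: "AE y in \<nu>. indicator {..c} y * (f \<theta>\<^sub>0 x y * score s (x, y, 1)) = partial_deriv s (\<lambda>\<theta>'. ?h \<theta>' y) \<theta>\<^sub>0"
    using good_uncensored[OF good] AE_\<nu>_nonneg diff
  proof eventually_elim
    case (elim y)
    then show ?case using density_derivs(1)[of x y s] scale[of y \<theta>\<^sub>0] nbhd(2) by (simp add: indicator_def)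
  qed
  have 5: "partial_differentiable s (\<lambda>\<theta>'. \<integral>y. ?h \<theta>' y \<partial>\<nu>) \<theta>\<^sub>0"
    using cond_df_derivs(1)[OF good, of s] by (simp add: F_eq)
  have int: "integrable \<nu> (?h \<theta>)" if "\<theta> \<in> V" for \<theta>
    using that nbhd(3) by (intro f_set_integrable) auto
  note * = partial_deriv_integral[OF nbhd(1,2) int 1 2 3 4 5]
  show "integrable \<nu> (\<lambda>y. indicator {..c} y * (f \<theta>\<^sub>0 x y * score s (x, y, 1)))" by (rule *(1))
  show "(\<integral>y. indicator {..c} y * (f \<theta>\<^sub>0 x y * score s (x, y, 1)) \<partial>\<nu>) = - (1 - F \<theta>\<^sub>0 x c) * score s (x, c, 0)"
    using *(2) cond_df_derivs(2)[OF good, of s] by (simp add: F_eq)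
qed

text \<open>Given \<open>X = x\<close> and \<open>C = c\<close>, an observation is uncensored with \<open>y \<le> c\<close>, or censored with probability \<open>1 - F\<close>.\<close>

lemma integral_obs_split:
  fixes u :: "(real^'p) \<times> real \<times> real \<Rightarrow> real"
  assumes "integrable \<nu> (\<lambda>y. indicator {..c} y * (f \<theta>\<^sub>0 x y * u (x, y, 1)))"
  shows "(\<integral>y. f \<theta>\<^sub>0 x y * u (obs ((x, c), y)) \<partial>\<nu>) =
    (\<integral>y. indicator {..c} y * (f \<theta>\<^sub>0 x y * u (x, y, 1)) \<partial>\<nu>) + (1 - F \<theta>\<^sub>0 x c) * u (x, c, 0)"
proof -
  have i: "integrable \<nu> (\<lambda>y. (indicator {c<..} y * f \<theta>\<^sub>0 x y) * u (x, c, 0))"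
    using f_set_integrable[OF \<theta>\<^sub>0_in, of "{c<..}" x] by simp
  have "(\<integral>y. f \<theta>\<^sub>0 x y * u (obs ((x, c), y)) \<partial>\<nu>) =
    (\<integral>y. indicator {..c} y * (f \<theta>\<^sub>0 x y * u (x, y, 1)) + (indicator {c<..} y * f \<theta>\<^sub>0 x y) * u (x, c, 0) \<partial>\<nu>)"
    by (intro Bochner_Integration.integral_cong) (auto simp: obs_def indicator_def)
  also have "\<dots> = (\<integral>y. indicator {..c} y * (f \<theta>\<^sub>0 x y * u (x, y, 1)) \<partial>\<nu>) + (1 - F \<theta>\<^sub>0 x c) * u (x, c, 0)"
    using assms i one_minus_F[OF \<theta>\<^sub>0_in, of x c] by simp
  finally show ?thesis .
qed

lemma expectation_obs:
  fixes u :: "(real^'p) \<times> real \<times> real \<Rightarrow> real"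
  assumes [measurable]: "u \<in> borel_measurable borel" and "integrable M (\<lambda>\<omega>. u (W \<omega>))"
  shows "expectation (\<lambda>\<omega>. u (W \<omega>)) = (\<integral>p. (\<integral>y. f \<theta>\<^sub>0 (fst p) y * u (obs (p, y)) \<partial>\<nu>) \<partial>PXC)"
    and "integrable PXC (\<lambda>p. \<integral>y. f \<theta>\<^sub>0 (fst p) y * u (obs (p, y)) \<partial>\<nu>)"
  using integral_joint[of "\<lambda>z. u (obs z)"] assms(2) by (simp_all add: W_eq)

text \<open>The uncensored and the censored part of the conditional mean given \<open>X\<close> and \<open>C\<close> cancel.\<close>

lemma score_mean_zero:
  assumes "integrable M (\<lambda>\<omega>. score s (W \<omega>))"
  shows "expectation (\<lambda>\<omega>. score s (W \<omega>)) = 0"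
proof -
  note ex = expectation_obs[OF score_measurable assms]
  have "(\<integral>p. (\<integral>y. f \<theta>\<^sub>0 (fst p) y * score s (obs (p, y)) \<partial>\<nu>) \<partial>PXC) = (\<integral>p. 0 \<partial>PXC)"
  proof (rule integral_cong_AE)
    show "(\<lambda>p. \<integral>y. f \<theta>\<^sub>0 (fst p) y * score s (obs (p, y)) \<partial>\<nu>) \<in> borel_measurable PXC"
      using ex(2) by (rule borel_measurable_integrable)
    show "AE p in PXC. (\<integral>y. f \<theta>\<^sub>0 (fst p) y * score s (obs (p, y)) \<partial>\<nu>) = 0"
      using AE_good AE_dominated_at
    proof eventually_elim
      case (elim p)
      note us = uncensored_score_integral[OF elim, of s]
      show ?case using integral_obs_split[of "snd p" "fst p" "score s", OF us(1)] us(2) by (simp add: algebra_simps)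
    qed
  qed simp
  then show ?thesis unfolding ex(1) by simp
qed

text \<open>Given \<open>X = x\<close> and \<open>C = c\<close>, the uncensored observations contribute the integral of \<open>D\<^sub>r\<^sub>s f\<close> over \<open>y \<le> c\<close>
  and the censored one contributes \<open>- D\<^sub>r\<^sub>s F\<close>. Their sum is the interchange defect, which vanishes on
  average only.\<close>

lemma information_identity:
  assumes "integrable M (\<lambda>\<omega>. bartlett r s (W \<omega>))"
  shows "expectation (\<lambda>\<omega>. bartlett r s (W \<omega>)) = 0"
proof -
  define D where "D p = (\<integral>y. f \<theta>\<^sub>0 (fst p) y * bartlett r s (obs (p, y)) \<partial>\<nu>)" for p
  have Di: "integrable PXC D" and DE: "expectation (\<lambda>\<omega>. bartlett r s (W \<omega>)) = (\<integral>p. D p \<partial>PXC)"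
    using expectation_obs[OF bartlett_measurable assms] unfolding D_def by auto
  have Dm: "D \<in> borel_measurable borel2"
    using borel_measurable_integrable[OF Di] by (simp add: measurable_cong_sets[OF sets_PXC refl])
  have "AE x in H. AE c in G x. interchange_defect \<nu> f \<theta>\<^sub>0 r s x c = D (x, c)"
    using AE_good_kernel defect_exists(1)[of r s, folded H_def]
  proof eventually_elim
    case (elim x)
    from elim(1) conjunct1[OF elim(2)] show ?case
    proof eventually_elim
      case (elim c)
      have eq: "AE y in \<nu>. indicator {..c} y * (f \<theta>\<^sub>0 x y * bartlett r s (x, y, 1)) = indicator {..c} y * partial_deriv2 r s (\<lambda>\<theta>'. f \<theta>' x y) \<theta>\<^sub>0"
        using good_uncensored[OF elim(1)] AE_\<nu>_nonneg
        by eventually_elim (use density_derivs(2) in \<open>simp add: indicator_def\<close>)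
      have m: "(\<lambda>y. indicator {..c} y * (f \<theta>\<^sub>0 x y * bartlett r s (x, y, 1))) \<in> borel_measurable \<nu>"
        using section_measurable[OF bartlett_measurable, of r s x 1] by measurable
      have i: "integrable \<nu> (\<lambda>y. indicator {..c} y * partial_deriv2 r s (\<lambda>\<theta>'. f \<theta>' x y) \<theta>\<^sub>0)"
        using elim(2) by (simp add: set_integrable_def)
      have i': "integrable \<nu> (\<lambda>y. indicator {..c} y * (f \<theta>\<^sub>0 x y * bartlett r s (x, y, 1)))"
        using integrable_cong_AE[OF m borel_measurable_integrable[OF i] eq] i by simp
      have I: "(\<integral>y. indicator {..c} y * (f \<theta>\<^sub>0 x y * bartlett r s (x, y, 1)) \<partial>\<nu>) = (\<integral>y. indicator {..c} y * partial_deriv2 r s (\<lambda>\<theta>'. f \<theta>' x y) \<theta>\<^sub>0 \<partial>\<nu>)"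
        by (rule integral_cong_AE[OF m borel_measurable_integrable[OF i] eq])
      show ?case
        using integral_obs_split[OF i'] I cond_df_derivs(3)[OF elim(1), of r s]
        by (simp add: D_def interchange_defect_def set_lebesgue_integral_def algebra_simps)
    qed
  qed
  then have ae: "AE x in H. (\<integral>c. interchange_defect \<nu> f \<theta>\<^sub>0 r s x c \<partial>G x) = (\<integral>c. D (x, c) \<partial>G x)"
    using defect_exists(1)[of r s, folded H_def]
  proof eventually_elim
    case (elim x)
    have "(\<lambda>c. D (x, c)) \<in> borel_measurable (G x)" using Dm by measurable
    with elim show ?case by (intro integral_cong_AE) auto
  qed
  have "(\<integral>p. D p \<partial>PXC) = (\<integral>x. (\<integral>c. D (x, c) \<partial>G x) \<partial>H)" by (rule integral_PXC[OF Dm Di])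
  also have "\<dots> = (\<integral>x. (\<integral>c. interchange_defect \<nu> f \<theta>\<^sub>0 r s x c \<partial>G x) \<partial>H)"
  proof (rule integral_cong_AE[symmetric, OF _ _ ae])
    show "(\<lambda>x. \<integral>c. interchange_defect \<nu> f \<theta>\<^sub>0 r s x c \<partial>G x) \<in> borel_measurable H"
      using borel_measurable_integrable[OF defect_exists(2)[of r s]] by (simp add: H_def)
    show "(\<lambda>x. \<integral>c. D (x, c) \<partial>G x) \<in> borel_measurable H" by (rule kernel_integral_measurable[OF Dm])
  qed
  also have "\<dots> = 0" using defect_zero[of r s] by (simp add: H_def)
  finally show ?thesis unfolding DE .
qed

lemma uncensored_score_eq:
  assumes "(X \<omega>, Y \<omega>, 1) \<in> N"
  shows "uncensored_score f \<theta>\<^sub>0 X Y \<omega> $ r = score r (X \<omega>, Y \<omega>, 1)"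
  using assms by (simp add: uncensored_score_def gradient_def score_def ell_def loglik1_uncensored)

lemma AE_uncensored_N: "AE \<omega> in M. Y \<omega> \<le> C \<omega> \<longrightarrow> (X \<omega>, Y \<omega>, 1) \<in> N"
  using N(2) by eventually_elim (auto simp: observed_eq)

definition score_prod :: "'q \<Rightarrow> 'q \<Rightarrow> (real^'p) \<times> real \<times> real \<Rightarrow> real" where "score_prod r s w = score r w * score s w"

lemma score_prod_measurable [measurable]: "score_prod r s \<in> borel_measurable borel"
  unfolding score_prod_def[abs_def] by measurable

lemma triple_measurable:
  fixes u :: "(real^'p) \<times> real \<times> real \<Rightarrow> real"
  assumes "u \<in> borel_measurable borel"
  shows "(\<lambda>z. u (fst z, snd z, d)) \<in> borel_measurable borel2"
  unfolding borel_prod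
  by (rule measurable_compose[OF _ assms]) (intro borel_measurable_continuous_onI continuous_intros)

text \<open>The score in \<open>\<Sigma>\<close> is the derivative of \<open>log f\<close> and is known to agree with \<open>score\<close> on \<open>N\<close> only. Values
  \<open>(X, Y, 1)\<close> outside \<open>N\<close> can be neglected, as almost surely they have weight \<open>1 - G(Y-|X) = 0\<close>.\<close>

lemma uncensored_part:
  shows "integrable M (\<lambda>\<omega>. of_bool (Y \<omega> \<le> C \<omega>) * score_prod r s (X \<omega>, Y \<omega>, 1))"
    and "expectation (\<lambda>\<omega>. of_bool (Y \<omega> \<le> C \<omega>) * score_prod r s (X \<omega>, Y \<omega>, 1)) = expectation (Sigma_integrand1 f \<theta>\<^sub>0 X Y G r s)"
proof -
  let ?\<psi> = "\<lambda>z::(real^'p) \<times> real. score_prod r s (fst z, snd z, 1)"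
  have \<psi>m: "?\<psi> \<in> borel_measurable borel2" by (rule triple_measurable) simp
  have "AE \<omega> in M. Gtail (X \<omega>) (Y \<omega>) \<noteq> 0 \<longrightarrow> (fst (X \<omega>, Y \<omega>), snd (X \<omega>, Y \<omega>), 1) \<in> N"
  proof (rule AE_uncensored)
    have "(\<lambda>z::(real^'p) \<times> real. (fst z, snd z, 1::real)) \<in> borel2 \<rightarrow>\<^sub>M borel"
      unfolding borel_prod by (intro borel_measurable_continuous_onI continuous_intros)
    from measurable_compose[OF this] N(1)
    show "Measurable.pred borel2 (\<lambda>z::(real^'p) \<times> real. (fst z, snd z, 1) \<in> N)"
      by measurable
  qed (use AE_uncensored_N in simp)
  then have ae: "AE \<omega> in M. Sigma_integrand1 f \<theta>\<^sub>0 X Y G r s \<omega> = Gtail (X \<omega>) (Y \<omega>) * ?\<psi> (X \<omega>, Y \<omega>)"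
    by eventually_elim (auto simp: Sigma_integrand1_def Gtail_def score_prod_def uncensored_score_eq)
  have i: "integrable M (Sigma_integrand1 f \<theta>\<^sub>0 X Y G r s)" using Sigma_exists by (simp add: Sigma_exists_def)
  have m: "(\<lambda>\<omega>. Gtail (X \<omega>) (Y \<omega>) * ?\<psi> (X \<omega>, Y \<omega>)) \<in> borel_measurable M"
    using measurable_compose[OF measurable_Pair[OF rv(1,2)] Gtail_measurable] measurable_compose[OF measurable_Pair[OF rv(1,2)] \<psi>m]
    by (intro borel_measurable_times) auto
  have i': "integrable M (\<lambda>\<omega>. Gtail (X \<omega>) (Y \<omega>) * ?\<psi> (X \<omega>, Y \<omega>))"
    using integrable_cong_AE[OF borel_measurable_integrable[OF i] m ae] i by simp
  show "integrable M (\<lambda>\<omega>. of_bool (Y \<omega> \<le> C \<omega>) * score_prod r s (X \<omega>, Y \<omega>, 1))"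
    using i' integral_uncensored(1)[OF \<psi>m] by simp
  show "expectation (\<lambda>\<omega>. of_bool (Y \<omega> \<le> C \<omega>) * score_prod r s (X \<omega>, Y \<omega>, 1)) = expectation (Sigma_integrand1 f \<theta>\<^sub>0 X Y G r s)"
    using integral_uncensored(2)[OF \<psi>m] integral_cong_AE[OF borel_measurable_integrable[OF i] m ae] by simp
qed

abbreviation surv :: "(real^'p) \<times> real \<Rightarrow> real" where "surv p \<equiv> 1 - F \<theta>\<^sub>0 (fst p) (snd p)"
abbreviation cscore :: "'q \<Rightarrow> (real^'p) \<times> real \<Rightarrow> real" where "cscore r p \<equiv> score r (fst p, snd p, 0)"

lemma surv_measurable [measurable]: "surv \<in> borel_measurable borel2"
  using F_measurable[OF \<theta>\<^sub>0_in] by measurable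

lemma cscore_measurable [measurable]: "cscore r \<in> borel_measurable borel2"
  by (rule triple_measurable) simp

lemma AE_PXC_D: "AE p in PXC. P p \<Longrightarrow> AE \<omega> in M. P (XC \<omega>)"
  unfolding PXC_def by (rule AE_distrD[OF XC_measurable])

text \<open>The conditional expectation is the integral of \<open>D\<^sub>r f\<close> over \<open>y \<le> C\<close>, because \<open>Y\<close> has density \<open>f\<close> given
  \<open>X\<close> and \<open>C\<close>; this integral is \<open>D\<^sub>r F\<close>, expressed through the score of the censored observation.\<close>

lemma conditional_score:
  "AE \<omega> in M. cond_exp_given M XC (\<lambda>\<omega>. of_bool (Y \<omega> \<le> C \<omega>) * uncensored_score f \<theta>\<^sub>0 X Y \<omega> $ r) \<omega> = - surv (XC \<omega>) * cscore r (XC \<omega>)"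
proof -
  let ?u = "\<lambda>\<omega>. of_bool (Y \<omega> \<le> C \<omega>) * uncensored_score f \<theta>\<^sub>0 X Y \<omega> $ r"
  let ?v = "\<lambda>z. of_bool (snd z \<le> snd (fst z)) * score r (fst (fst z), snd z, 1)"
  have tm: "(\<lambda>z::((real^'p) \<times> real) \<times> real. score r (fst (fst z), snd z, 1)) \<in> borel_measurable borel3"
    unfolding borel_prod by (rule measurable_compose[OF _ score_measurable]) (intro borel_measurable_continuous_onI continuous_intros)
  note tm [measurable]
  have vm [measurable]: "?v \<in> borel_measurable borel3"
    unfolding of_bool_def by measurable
  have ui: "integrable M ?u" using Sigma_exists by (simp add: Sigma_exists_def)
  have ae: "AE \<omega> in M. ?u \<omega> = ?v (XC \<omega>, Y \<omega>)"
    using AE_uncensored_N by eventually_elim (auto simp: uncensored_score_eq)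
  have vm': "(\<lambda>\<omega>. ?v (XC \<omega>, Y \<omega>)) \<in> borel_measurable M" by (rule measurable_compose[OF joint_measurable vm])
  have vi: "integrable M (\<lambda>\<omega>. ?v (XC \<omega>, Y \<omega>))"
    using integrable_cong_AE[OF borel_measurable_integrable[OF ui] vm' ae] ui by simp
  define m where "m p = (\<integral>y. f \<theta>\<^sub>0 (fst p) y * ?v (p, y) \<partial>\<nu>)" for p
  have mi: "integrable PXC m" unfolding m_def using integral_joint(2)[OF vm vi] by simp
  have mm: "m \<in> borel_measurable borel2"
    using borel_measurable_integrable[OF mi] by (simp add: measurable_cong_sets[OF sets_PXC refl])
  have miM: "integrable M (\<lambda>\<omega>. m (XC \<omega>))"
    using mi unfolding PXC_def by (subst (asm) integrable_distr_eq[OF XC_measurable mm])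
  have XCb: "XC \<in> borel_measurable M" using XC_measurable by (simp add: borel_prod)
  let ?\<F> = "sigma_generated M XC"
  interpret S: sigma_finite_subalgebra M ?\<F> by (rule sigma_finite_subalgebra_generated[OF XCb])
  have "AE \<omega> in M. real_cond_exp M ?\<F> ?u \<omega> = m (XC \<omega>)"
  proof (rule S.real_cond_exp_charact[OF _ ui miM])
    show "(\<lambda>\<omega>. m (XC \<omega>)) \<in> borel_measurable ?\<F>"
      by (rule measurable_sigma_generated[OF XCb]) (use mm in \<open>simp add: borel_prod\<close>)
    fix A assume "A \<in> sets ?\<F>"
    then obtain R where R: "R \<in> sets borel" "A = XC -` R \<inter> space M"
      unfolding sigma_generated_def by (subst (asm) sets_vimage_algebra2) auto
    have Rm [measurable]: "R \<in> sets borel2" unfolding borel_prod by (rule R(1))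
    have "(\<integral>\<omega>\<in>A. ?u \<omega> \<partial>M) = expectation (\<lambda>\<omega>. indicator R (XC \<omega>) * ?v (XC \<omega>, Y \<omega>))"
      unfolding set_lebesgue_integral_def
    proof (rule integral_cong_AE)
      have "A \<in> events" unfolding R(2) by (rule measurable_sets[OF XC_measurable Rm])
      then show "(\<lambda>\<omega>. indicat_real A \<omega> *\<^sub>R ?u \<omega>) \<in> borel_measurable M"
        using borel_measurable_integrable[OF ui] by (intro borel_measurable_scaleR) auto
      show "AE \<omega> in M. indicat_real A \<omega> *\<^sub>R ?u \<omega> = indicator R (XC \<omega>) * ?v (XC \<omega>, Y \<omega>)"
        using ae AE_space by eventually_elim (simp add: R(2) indicator_def)
    qed (use vm' in measurable)
    also have "\<dots> = (\<integral>p. (\<integral>y. f \<theta>\<^sub>0 (fst p) y * (indicator R p * ?v (p, y)) \<partial>\<nu>) \<partial>PXC)"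
    proof -
      have i: "integrable M (\<lambda>\<omega>. indicator R (XC \<omega>) * ?v (XC \<omega>, Y \<omega>))"
        by (rule Bochner_Integration.integrable_bound[OF vi]) (use vm' in \<open>auto simp: indicator_def\<close>)
      show ?thesis
        using integral_joint(1)[of "\<lambda>z. indicator R (fst z) * ?v z"] i by simp
    qed
    also have "\<dots> = (\<integral>p. indicator R p * m p \<partial>PXC)"
      unfolding m_def by (intro Bochner_Integration.integral_cong refl) (auto simp: indicator_def)
    also have "\<dots> = expectation (\<lambda>\<omega>. indicator R (XC \<omega>) * m (XC \<omega>))"
      unfolding PXC_def using mm by (subst integral_distr) auto
    also have "\<dots> = (\<integral>\<omega>\<in>A. m (XC \<omega>) \<partial>M)"
      unfolding set_lebesgue_integral_def
      by (intro Bochner_Integration.integral_cong refl) (simp add: R(2) indicator_def)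
    finally show "(\<integral>\<omega>\<in>A. ?u \<omega> \<partial>M) = (\<integral>\<omega>\<in>A. m (XC \<omega>) \<partial>M)" .
  qed
  moreover have "AE p in PXC. m p = - surv p * cscore r p"
    using AE_good AE_dominated_at
  proof eventually_elim
    case (elim p)
    have "m p = (\<integral>y. indicator {..snd p} y * (f \<theta>\<^sub>0 (fst p) y * score r (fst p, y, 1)) \<partial>\<nu>)"
      unfolding m_def by (intro Bochner_Integration.integral_cong refl) (auto simp: indicator_def)
    then show ?case using uncensored_score_integral(2)[OF elim, of r] by simp
  qed
  then have "AE \<omega> in M. m (XC \<omega>) = - surv (XC \<omega>) * cscore r (XC \<omega>)" by (rule AE_PXC_D)
  ultimately show ?thesis unfolding cond_exp_given_def by eventually_elim simp
qed

text \<open>Given \<open>X\<close> and \<open>C\<close>, the observation is censored with probability \<open>\<sigma> = 1 - F\<close>, and its score is \<open>- m / \<sigma>\<close>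
  with the conditional expectation \<open>m\<close> of the previous lemma. So the score products contribute
  \<open>\<sigma> (m\<^sub>r / \<sigma>) (m\<^sub>s / \<sigma>)\<close>, the integrand of \<open>\<Sigma>\<close>. Where \<open>\<sigma> = 0\<close>, the former vanishes and the
  latter is 0 by definition.\<close>

lemma censored_part:
  shows "integrable M (\<lambda>\<omega>. of_bool (C \<omega> < Y \<omega>) * score_prod r s (X \<omega>, C \<omega>, 0))"
    and "expectation (\<lambda>\<omega>. of_bool (C \<omega> < Y \<omega>) * score_prod r s (X \<omega>, C \<omega>, 0)) = expectation (Sigma_integrand2 M \<nu> f \<theta>\<^sub>0 X Y C r s)"
proof -
  let ?q = "\<lambda>p. surv p * (cscore r p * cscore s p)"
  have ae: "AE \<omega> in M. Sigma_integrand2 M \<nu> f \<theta>\<^sub>0 X Y C r s \<omega> = ?q (XC \<omega>)"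
    using conditional_score[of r] conditional_score[of s]
  proof eventually_elim
    case (elim \<omega>)
    show ?case
    proof (cases "F \<theta>\<^sub>0 (X \<omega>) (C \<omega>) = 1")
      case True then show ?thesis by (simp add: Sigma_integrand2_def)
    next
      case False
      have "inverse \<sigma> * (- \<sigma> * x) * (- \<sigma> * y) = \<sigma> * (x * y)" if "\<sigma> \<noteq> 0" for \<sigma> x y :: real
        using that by (simp add: field_simps)
      from this[of "1 - F \<theta>\<^sub>0 (X \<omega>) (C \<omega>)"] False show ?thesis
        unfolding Sigma_integrand2_def Let_def elim by simp
    qed
  qed
  have i: "integrable M (Sigma_integrand2 M \<nu> f \<theta>\<^sub>0 X Y C r s)" using Sigma_exists by (simp add: Sigma_exists_def)
  have qm: "?q \<in> borel_measurable borel2" by measurable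
  have qm': "(\<lambda>\<omega>. ?q (XC \<omega>)) \<in> borel_measurable M" by (rule measurable_compose[OF XC_measurable qm])
  have qi: "integrable M (\<lambda>\<omega>. ?q (XC \<omega>))"
    using integrable_cong_AE[OF borel_measurable_integrable[OF i] qm' ae] i by simp
  have qE: "expectation (Sigma_integrand2 M \<nu> f \<theta>\<^sub>0 X Y C r s) = expectation (\<lambda>\<omega>. ?q (XC \<omega>))"
    by (rule integral_cong_AE[OF borel_measurable_integrable[OF i] qm' ae])
  let ?\<phi> = "\<lambda>z. of_bool (snd (fst z) < snd z) * (cscore r (fst z) * cscore s (fst z))"
  have \<phi>m [measurable]: "?\<phi> \<in> borel_measurable borel3"
    unfolding of_bool_def by measurable
  have s0: "0 \<le> surv p" for p using F_le_1[OF \<theta>\<^sub>0_in] by simp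
  have pY_surv: "pY {c<..} x = 1 - F \<theta>\<^sub>0 x c" for x c
    using one_minus_F[OF \<theta>\<^sub>0_in, of x c] by (simp add: pY_eq)
  have "(\<integral>\<^sup>+\<omega>. ennreal (norm (?\<phi> (XC \<omega>, Y \<omega>))) \<partial>M) = (\<integral>\<^sup>+p. (\<integral>\<^sup>+y. ennreal (f \<theta>\<^sub>0 (fst p) y) * ennreal (norm (?\<phi> (p, y))) \<partial>\<nu>) \<partial>PXC)"
    by (rule nn_integral_joint[of "\<lambda>z. ennreal (norm (?\<phi> z))"]) measurable
  also have "\<dots> = (\<integral>\<^sup>+p. ennreal (norm (?q p)) \<partial>PXC)"
  proof (rule nn_integral_cong)
    fix p
    have "(\<integral>\<^sup>+y. ennreal (f \<theta>\<^sub>0 (fst p) y) * ennreal (norm (?\<phi> (p, y))) \<partial>\<nu>) =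
      (\<integral>\<^sup>+y. ennreal (norm (cscore r p * cscore s p)) * (indicator {snd p<..} y * ennreal (f \<theta>\<^sub>0 (fst p) y)) \<partial>\<nu>)"
      by (intro nn_integral_cong) (auto simp: indicator_def mult_ac)
    also have "\<dots> = ennreal (norm (cscore r p * cscore s p)) * ennreal (surv p)"
      by (subst nn_integral_cmult) (simp_all add: nn_integral_pY pY_surv)
    also have "\<dots> = ennreal (norm (?q p))"
      using s0[of p] by (simp add: ennreal_mult[symmetric] abs_mult mult_ac)
    finally show "(\<integral>\<^sup>+y. ennreal (f \<theta>\<^sub>0 (fst p) y) * ennreal (norm (?\<phi> (p, y))) \<partial>\<nu>) = ennreal (norm (?q p))" .
  qed
  also have "\<dots> = (\<integral>\<^sup>+\<omega>. ennreal (norm (?q (XC \<omega>))) \<partial>M)"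
    unfolding PXC_def by (subst nn_integral_distr) auto
  also have "\<dots> < \<infinity>" using qi by (rule integrable_iff_bounded[THEN iffD1, THEN conjunct2])
  finally have \<phi>i: "integrable M (\<lambda>\<omega>. ?\<phi> (XC \<omega>, Y \<omega>))"
    using measurable_compose[OF joint_measurable \<phi>m] by (intro integrableI_bounded) auto
  then show "integrable M (\<lambda>\<omega>. of_bool (C \<omega> < Y \<omega>) * score_prod r s (X \<omega>, C \<omega>, 0))" by (simp add: score_prod_def)
  have "expectation (\<lambda>\<omega>. ?\<phi> (XC \<omega>, Y \<omega>)) = (\<integral>p. (\<integral>y. f \<theta>\<^sub>0 (fst p) y * ?\<phi> (p, y) \<partial>\<nu>) \<partial>PXC)"
    by (rule integral_joint(1)[OF \<phi>m \<phi>i])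
  also have "\<dots> = (\<integral>p. ?q p \<partial>PXC)"
  proof (rule Bochner_Integration.integral_cong[OF refl])
    fix p
    have "(\<integral>y. f \<theta>\<^sub>0 (fst p) y * ?\<phi> (p, y) \<partial>\<nu>) = (\<integral>y. (indicator {snd p<..} y * f \<theta>\<^sub>0 (fst p) y) * (cscore r p * cscore s p) \<partial>\<nu>)"
      by (intro Bochner_Integration.integral_cong) (auto simp: indicator_def)
    also have "\<dots> = ?q p" using one_minus_F[OF \<theta>\<^sub>0_in, of "fst p" "snd p"] by simp
    finally show "(\<integral>y. f \<theta>\<^sub>0 (fst p) y * ?\<phi> (p, y) \<partial>\<nu>) = ?q p" .
  qed
  also have "\<dots> = expectation (\<lambda>\<omega>. ?q (XC \<omega>))"
    unfolding PXC_def by (rule integral_distr[OF XC_measurable qm])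
  finally show "expectation (\<lambda>\<omega>. of_bool (C \<omega> < Y \<omega>) * score_prod r s (X \<omega>, C \<omega>, 0)) = expectation (Sigma_integrand2 M \<nu> f \<theta>\<^sub>0 X Y C r s)"
    unfolding qE by (simp add: score_prod_def)
qed

lemma score_covariance:
  shows "integrable M (\<lambda>\<omega>. score r (W \<omega>) * score s (W \<omega>))"
    and "expectation (\<lambda>\<omega>. score r (W \<omega>) * score s (W \<omega>)) = Sigma_matrix M \<nu> f \<theta>\<^sub>0 X Y C G $ r $ s"
proof -
  have eq: "score r (W \<omega>) * score s (W \<omega>) = of_bool (Y \<omega> \<le> C \<omega>) * score_prod r s (X \<omega>, Y \<omega>, 1) + of_bool (C \<omega> < Y \<omega>) * score_prod r s (X \<omega>, C \<omega>, 0)" for \<omega>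
    by (auto simp: observed_eq score_prod_def)
  show "integrable M (\<lambda>\<omega>. score r (W \<omega>) * score s (W \<omega>))"
    unfolding eq by (intro Bochner_Integration.integrable_add uncensored_part censored_part)
  have "expectation (\<lambda>\<omega>. score r (W \<omega>) * score s (W \<omega>)) = expectation (Sigma_integrand1 f \<theta>\<^sub>0 X Y G r s) + expectation (Sigma_integrand2 M \<nu> f \<theta>\<^sub>0 X Y C r s)"
    unfolding eq by (subst Bochner_Integration.integral_add[OF uncensored_part(1) censored_part(1)]) (simp only: uncensored_part(2) censored_part(2))
  then show "expectation (\<lambda>\<omega>. score r (W \<omega>) * score s (W \<omega>)) = Sigma_matrix M \<nu> f \<theta>\<^sub>0 X Y C G $ r $ s"
    by (simp add: Sigma_matrix_def)
qed

end

section \<open>The censored maximum likelihood estimator\<close>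

lemma borel_measurable_observed:
  fixes X :: "'a \<Rightarrow> real^'p::finite"
  assumes [measurable]: "X \<in> borel_measurable M" "Y \<in> borel_measurable M" "C \<in> borel_measurable M"
  shows "observed X Y C \<in> borel_measurable M"
  unfolding observed_def[abs_def] of_bool_def borel_prod[symmetric] by measurable

theorem theorem5:
  fixes M :: "'a measure"
    and \<nu> :: "real measure"
    and \<Theta> V :: "(real^'q::finite) set"
    and f :: "real^'q \<Rightarrow> real^'p::finite \<Rightarrow> real \<Rightarrow> real"
    and \<theta>\<^sub>0 :: "real^'q"
    and X :: "'a \<Rightarrow> real^'p" and Y C :: "'a \<Rightarrow> real"
    and G :: "real^'p \<Rightarrow> real measure"
    and Xs :: "nat \<Rightarrow> 'a \<Rightarrow> real^'p" and Ys Cs :: "nat \<Rightarrow> 'a \<Rightarrow> real"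
    and \<theta>h :: "nat \<Rightarrow> 'a \<Rightarrow> real^'q"
  defines "H \<equiv> distr M borel X"
    and "W \<equiv> observed X Y C"
    and "Ws \<equiv> \<lambda>i. observed (Xs i) (Ys i) (Cs i)"
    and "\<Sigma> \<equiv> Sigma_matrix M \<nu> f \<theta>\<^sub>0 X Y C G"
  assumes prob: "prob_space M"
    and family: "conditional_density_family \<nu> \<Theta> f"
    and true_parameter: "\<theta>\<^sub>0 \<in> \<Theta>"
    and rv: "X \<in> borel_measurable M" "Y \<in> borel_measurable M" "C \<in> borel_measurable M"
    and nonneg: "\<And>\<omega>. \<omega> \<in> space M \<Longrightarrow> 0 \<le> Y \<omega>" "\<And>\<omega>. \<omega> \<in> space M \<Longrightarrow> 0 \<le> C \<omega>"
    and cond_indep: "cond_independent M X Y C"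
    and Y_given_X: "has_cond_density M X Y \<nu> (f \<theta>\<^sub>0)"
    and C_given_X: "has_cond_cdf M X C G"
    and iid_indep: "prob_space.indep_vars M (\<lambda>_. borel) Ws UNIV"
    and iid_copies: "\<And>i. distr M borel (Ws i) = distr M borel W"
    and estimator_rv: "\<And>n. \<theta>h n \<in> borel_measurable M"
    and estimator_max: "\<And>n. n \<ge> 1 \<Longrightarrow> AE \<omega> in M. \<theta>h n \<omega> \<in> \<Theta> \<and>
           (\<forall>\<theta>\<in>\<Theta>. loglik \<nu> f (\<lambda>i. Ws i \<omega>) n \<theta> \<le> loglik \<nu> f (\<lambda>i. Ws i \<omega>) n (\<theta>h n \<omega>))"
    and i_nbhd: "open V" "\<theta>\<^sub>0 \<in> V" "V \<subseteq> \<Theta>"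
    and i_smooth: "AE w in distr M borel W. has_continuous_second_derivatives_on (loglik1 \<nu> f w) V"
    and i_bound: "\<And>r s. (\<integral>\<^sup>+ \<omega>. (SUP \<theta>\<in>V. ennreal \<bar>partial_deriv2 r s (loglik1 \<nu> f (W \<omega>)) \<theta>\<bar>) \<partial>M) < \<infinity>"
    and ii: "AE x in H. \<forall>r.
           (AE y in \<nu>. \<forall>\<theta>\<in>V. partial_differentiable r (\<lambda>\<theta>'. f \<theta>' x y) \<theta>) \<and>
           (\<integral>\<^sup>+ y. (SUP \<theta>\<in>V. ennreal \<bar>partial_deriv r (\<lambda>\<theta>'. f \<theta>' x y) \<theta>\<bar>) \<partial>\<nu>) < \<infinity>"
    and iii_exists: "\<And>r s. AE x in H.
           (AE c in G x. set_integrable \<nu> {..c} (\<lambda>y. partial_deriv2 r s (\<lambda>\<theta>'. f \<theta>' x y) \<theta>\<^sub>0)) \<and>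
           integrable (G x) (interchange_defect \<nu> f \<theta>\<^sub>0 r s x)"
      "\<And>r s. integrable H (\<lambda>x. \<integral>c. interchange_defect \<nu> f \<theta>\<^sub>0 r s x c \<partial>G x)"
    and iii: "\<And>r s. (\<integral>x. (\<integral>c. interchange_defect \<nu> f \<theta>\<^sub>0 r s x c \<partial>G x) \<partial>H) = 0"
    and iv_exists: "Sigma_exists M \<nu> f \<theta>\<^sub>0 X Y C G"
    and iv_posdef: "positive_definite \<Sigma>"
    and v: "converges_in_probability M \<theta>h \<theta>\<^sub>0"
  shows "converges_in_distribution M (\<lambda>n \<omega>. sqrt (real n) *\<^sub>R (\<theta>h n \<omega> - \<theta>\<^sub>0))
           (multivariate_normal 0 (matrix_inv \<Sigma>))"
proof -
  interpret prob_space M by (rule prob)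
  have Wm [measurable]: "W \<in> borel_measurable M" unfolding W_def by (rule borel_measurable_observed[OF rv])
  define Q where "Q = distr M borel W"
  \<comment> \<open>The observations without smoothness form a set that need not be Borel; a Borel null set contains it.\<close>
  obtain N\<^sub>0 where N\<^sub>0: "{w \<in> space Q. \<not> has_continuous_second_derivatives_on (loglik1 \<nu> f w) V} \<subseteq> N\<^sub>0"
      "emeasure Q N\<^sub>0 = 0" "N\<^sub>0 \<in> sets Q"
    using AE_E[OF i_smooth] unfolding Q_def by blast
  define N where "N = - N\<^sub>0"
  have Nb: "N \<in> sets borel" using N\<^sub>0(3) by (simp add: N_def Q_def)
  have smooth: "has_continuous_second_derivatives_on (loglik1 \<nu> f w) V" if "w \<in> N" for w
    using that N\<^sub>0(1) by (auto simp: N_def Q_def)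
  have QN: "AE w in Q. w \<in> N"
    by (rule AE_I[OF _ N\<^sub>0(2,3)]) (auto simp: N_def)
  have MN: "AE \<omega> in M. W \<omega> \<in> N" using AE_distrD[OF Wm] QN unfolding Q_def by blast
  have fam: "sigma_finite_measure \<nu>" "sets \<nu> = sets borel" "emeasure \<nu> {..<0} = 0"
      "(\<lambda>(x, y). f \<theta>\<^sub>0 x y) \<in> borel_measurable borel" "\<And>x y. 0 \<le> y \<Longrightarrow> 0 < f \<theta>\<^sub>0 x y"
      "\<And>x. (\<integral>y. f \<theta>\<^sub>0 x y \<partial>\<nu>) = 1"
    using family true_parameter by (auto simp: conditional_density_family_def)
  interpret R: censored_regression M X Y C \<nu> f \<theta>\<^sub>0 G \<Theta> V N
  proof (intro censored_regression.intro conditional_model.intro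
      conditional_model_axioms.intro censored_regression_axioms.intro)
    show "AE \<omega> in M. observed X Y C \<omega> \<in> N" using MN by (simp add: W_def)
  qed (fact prob rv fam cond_indep Y_given_X C_given_X family i_nbhd nonneg Nb smooth
        ii[unfolded H_def] iii_exists[unfolded H_def] iii[unfolded H_def] iv_exists)+
  have Wd: "observed X Y C = W" by (simp add: W_def)
  have ell_N: "R.ell w = loglik1 \<nu> f w" if "w \<in> N" for w using that by (simp add: R.ell_def)
  have bound: "(\<integral>\<^sup>+ \<omega>. (SUP \<theta>\<in>V. ennreal \<bar>partial_deriv2 r s (R.ell (W \<omega>)) \<theta>\<bar>) \<partial>M) < \<infinity>" for r s
  proof -
    have "(\<integral>\<^sup>+ \<omega>. (SUP \<theta>\<in>V. ennreal \<bar>partial_deriv2 r s (R.ell (W \<omega>)) \<theta>\<bar>) \<partial>M) =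
        (\<integral>\<^sup>+ \<omega>. (SUP \<theta>\<in>V. ennreal \<bar>partial_deriv2 r s (loglik1 \<nu> f (W \<omega>)) \<theta>\<bar>) \<partial>M)"
      by (rule nn_integral_cong_AE) (rule eventually_mono[OF MN], simp only: ell_N)
    then show ?thesis using i_bound[of r s] by simp
  qed
  have cov: "integrable M (\<lambda>\<omega>. R.score r (W \<omega>) * R.score s (W \<omega>))"
      "expectation (\<lambda>\<omega>. R.score r (W \<omega>) * R.score s (W \<omega>)) = \<Sigma> $ r $ s" for r s
    using R.score_covariance[of r s] unfolding Wd \<Sigma>_def by auto
  \<comment> \<open>The existence of the diagonal of \<open>\<Sigma>\<close> makes the score square integrable.\<close>
  have score_i: "integrable M (\<lambda>\<omega>. R.score s (W \<omega>))" for s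
  proof (rule square_integrable_imp_integrable)
    show "(\<lambda>\<omega>. R.score s (W \<omega>)) \<in> borel_measurable M" by (rule measurable_compose[OF Wm R.score_measurable])
    show "integrable M (\<lambda>\<omega>. (R.score s (W \<omega>))\<^sup>2)" unfolding power2_eq_square by (rule cov(1))
  qed
  have mean: "expectation (\<lambda>\<omega>. R.score s (W \<omega>)) = 0" for s
    using R.score_mean_zero[unfolded Wd, OF score_i] .
  have hess_i: "integrable M (\<lambda>\<omega>. R.hess r s (W \<omega>))" for r s
  proof (rule integrableI_bounded)
    have "(\<integral>\<^sup>+ \<omega>. ennreal (norm (R.hess r s (W \<omega>))) \<partial>M) \<le> (\<integral>\<^sup>+ \<omega>. (SUP \<theta>\<in>V. ennreal \<bar>partial_deriv2 r s (R.ell (W \<omega>)) \<theta>\<bar>) \<partial>M)"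
      unfolding R.hess_def by (intro nn_integral_mono) (auto intro: SUP_upper i_nbhd)
    then show "(\<integral>\<^sup>+ \<omega>. ennreal (norm (R.hess r s (W \<omega>))) \<partial>M) < \<infinity>" using bound by (rule le_less_trans)
    show "(\<lambda>\<omega>. R.hess r s (W \<omega>)) \<in> borel_measurable M" by (rule measurable_compose[OF Wm R.hess_measurable])
  qed
  have hess: "expectation (\<lambda>\<omega>. R.hess r s (W \<omega>)) = - \<Sigma> $ r $ s" for r s
  proof -
    have "integrable M (\<lambda>\<omega>. R.bartlett r s (W \<omega>))"
      unfolding R.bartlett_def using hess_i cov(1) by simp
    from R.information_identity[unfolded Wd, OF this]
    have "expectation (\<lambda>\<omega>. R.hess r s (W \<omega>)) + expectation (\<lambda>\<omega>. R.score r (W \<omega>) * R.score s (W \<omega>)) = 0"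
      unfolding R.bartlett_def using hess_i cov(1) by simp
    then show ?thesis unfolding cov(2) by simp
  qed
  interpret m_estimation M Ws R.ell V \<theta>\<^sub>0 \<Sigma> \<theta>h Q
  proof unfold_locales
    show "indep_vars (\<lambda>_. borel) Ws UNIV" by (rule iid_indep)
    show "distr M borel (Ws i) = Q" for i unfolding Q_def by (rule iid_copies)
    show "(\<lambda>w. R.ell w \<theta>) \<in> borel_measurable borel" if "\<theta> \<in> V" for \<theta> using that by (rule R.ell_measurable)
    show "has_continuous_second_derivatives_on (R.ell w) V" for w by (rule R.ell_smooth)
    show "(\<integral>\<^sup>+ w. (SUP \<theta>\<in>V. ennreal \<bar>partial_deriv2 r s (R.ell w) \<theta>\<bar>) \<partial>Q) < \<infinity>" for r s
    proof -
      have "(\<lambda>w. SUP \<theta>\<in>V. ennreal \<bar>partial_deriv2 r s (R.ell w) \<theta>\<bar>) \<in> borel_measurable borel"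
      proof (rule borel_measurable_SUP_continuous[OF i_nbhd(1)])
        show "(\<lambda>w. partial_deriv2 r s (R.ell w) \<theta>) \<in> borel_measurable borel" if "\<theta> \<in> V" for \<theta>
          by (rule borel_measurable_partial_deriv[OF i_nbhd(1) that R.ell_measurable1 R.ell_partial_differentiable2[OF that]])
        show "continuous_on V (partial_deriv2 r s (R.ell w))" for w
          using R.ell_smooth[of w] by (simp add: has_continuous_second_derivatives_on_def)
      qed
      then show ?thesis using bound[of r s] unfolding Q_def by (simp add: nn_integral_distr)
    qed
    show "(\<integral>w. partial_deriv r (R.ell w) \<theta>\<^sub>0 \<partial>Q) = 0" for r
      using mean[of r] integral_distr[OF Wm R.score_measurable[of r]] unfolding Q_def R.score_def by simp
    have m2: "(\<lambda>w. R.score r w * R.score s w) \<in> borel_measurable borel" for r s by measurable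
    show "integrable Q (\<lambda>w. partial_deriv r (R.ell w) \<theta>\<^sub>0 * partial_deriv s (R.ell w) \<theta>\<^sub>0)" for r s
      using cov(1)[of r s] integrable_distr_eq[OF Wm m2[of r s]] unfolding Q_def R.score_def by simp
    show "(\<integral>w. partial_deriv r (R.ell w) \<theta>\<^sub>0 * partial_deriv s (R.ell w) \<theta>\<^sub>0 \<partial>Q) = \<Sigma> $ r $ s" for r s
      using cov(2)[of r s] integral_distr[OF Wm m2[of r s]] unfolding Q_def R.score_def by simp
    show "(\<integral>w. partial_deriv2 r s (R.ell w) \<theta>\<^sub>0 \<partial>Q) = - \<Sigma> $ r $ s" for r s
      using hess[of r s] integral_distr[OF Wm R.hess_measurable[of r s]] unfolding Q_def R.hess_def by simp
    show "AE \<omega> in M. \<forall>\<theta>\<in>V. (\<Sum>i<n. R.ell (Ws i \<omega>) \<theta>) \<le> (\<Sum>i<n. R.ell (Ws i \<omega>) (\<theta>h n \<omega>))" if "1 \<le> n" for n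
    proof -
      have Wsm: "Ws i \<in> borel_measurable M" for i using iid_indep by (simp add: indep_vars_def2)
      \<comment> \<open>Almost surely no observation leaves \<open>N\<close>, so the modified log-likelihood is maximized as well.\<close>
      have "AE \<omega> in M. Ws i \<omega> \<in> N" for i
      proof (rule AE_distrD[OF Wsm[of i]])
        show "AE w in distr M borel (Ws i). w \<in> N" unfolding iid_copies using QN unfolding Q_def .
      qed
      then have "AE \<omega> in M. \<forall>i. Ws i \<omega> \<in> N" by (simp add: AE_all_countable)
      with estimator_max[OF that] show ?thesis
      proof eventually_elim
        case (elim \<omega>)
        then have "R.ell (Ws i \<omega>) = loglik1 \<nu> f (Ws i \<omega>)" for i by (simp add: ell_N)
        with elim i_nbhd(3) show ?case by (auto simp: loglik_def)
      qed
    qed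
  qed (fact i_nbhd iv_posdef estimator_rv v)+
  show ?thesis by (rule asymptotic_normality)
qed

end
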